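(* Let $\{d_i,\ i\ge1\}$ be a sequence of positive numbers with $d_1=1$ and $d=\inf_{i\ge1}d_i>0$, and let $X(t)$ be a continuous-time Markov chain as in the context, with the function $\alpha(t)$ defined there from the matrix $B^{**}(t)=DB(t)D^{-1}$, and with $\|B(t)\|_{1D}\le\mathfrak B<\infty$, $\|\mathbf f(t)\|_{1D}\le\mathfrak f<\infty$ for almost all $t\ge0$. Suppose there are constants $M>0$, $a>0$ such that for all $0\le s\le t$ $$e^{-\int_s^t\alpha(\tau)\,d\tau}\le Me^{-a(t-s)}.$$ Then $X(t)$ is $1D$-exponentially weakly ergodic. Moreover, let $\bar X(t)$ be a perturbed chain on the same state space with $\|B(t)-\bar B(t)\|_{1D}\le\Delta_B$ and $\|\mathbf f(t)-\bar{\mathbf f}(t)\|_{1D}\le\Delta_f$ for almost all $t\ge0$, where the perturbation is small enough that $M\Delta_B<a$. Then $\bar X(t)$ is also $1D$-exponentially weakly ergodic, and for any initial distributions of $X$ and $\bar X$ in $l_{1D}$ $$\limsup_{t\to\infty}\|\mathbf p(t)-\bar{\mathbf p}(t)\|_{1D}\le\frac{M\left(M\Delta_B\,\mathfrak f+a\,\Delta_f\right)}{a\left(a-M\Delta_B\right)}.$$ If, moreover, $W=\inf_{i\ge1}\frac{d_i}{i}>0$, then both chains have limiting means $\phi(t)$, $\bar\phi(t)$, and $$\limsup_{t\to\infty}|\phi(t)-\bar\phi(t)|\le\frac{M\left(M\Delta_B\,\mathfrak f+a\,\Delta_f\right)}{W\,a\left(a-M\Delta_B\right)}.$$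
   Context: $X(t)$, $t\ge0$, is a (generally inhomogeneous) continuous-time Markov chain on $\{0,1,\dots,S\}$, $S\le\infty$, with transition intensities $q_{ij}(t)\ge0$ ($i\ne j$), integrable in $t$ on bounded intervals. Put $a_{ij}(t)=q_{ji}(t)$ for $i\ne j$, $a_{ii}(t)=-\sum_{j\ne i}a_{ji}(t)$, $A(t)=(a_{ij}(t))$, and assume $|a_{ii}(t)|\le L<\infty$ for all $i$ and almost all $t$. The state probability vector $\mathbf p(t)=(p_0(t),p_1(t),\dots)^T$ satisfies $\frac{d\mathbf p}{dt}=A(t)\mathbf p(t)$ for almost all $t$ (locally absolutely continuous solutions in $l_1$). Substituting $p_0=1-\sum_{i\ge1}p_i$, the vector $\mathbf z=(p_1,p_2,\dots)^T$ satisfies $\frac{d\mathbf z}{dt}=B(t)\mathbf z(t)+\mathbf f(t)$ with $\mathbf f=(a_{10},a_{20},\dots)^T$ and $B=(a_{ij}-a_{i0})_{i,j\ge1}$. $D$ is the upper triangular matrix with $D_{ij}=d_i$ for $j\ge i\ge1$ and $D_{ij}=0$ for $j<i$. With $\|\cdot\|$ the $l_1$-norm of vectors and the induced matrix norm $\|B\|=\sup_j\sum_i|b_{ij}|$: $\|\mathbf z\|_{1D}=\|D\mathbf z\|$, $l_{1D}=\{\mathbf z:\|\mathbf z\|_{1D}<\infty\}$, $\|B\|_{1D}=\|DBD^{-1}\|$; for $\mathbf p=(p_0,p_1,\dots)^T$ one sets $\|\mathbf p\|_{1D}=\|\mathbf z\|_{1D}$ with $\mathbf z=(p_1,p_2,\dots)^T$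 (and $\mathbf p\in l_{1D}$ means $\mathbf z\in l_{1D}$). Let $B^{**}(t)=DB(t)D^{-1}=(b^{**}_{ij}(t))_{i,j\ge1}$, $\alpha_i(t)=-\big(b^{**}_{ii}(t)+\sum_{j\ne i}|b^{**}_{ji}(t)|\big)$, and $\alpha(t)=\inf_{i\ge1}\alpha_i(t)$. $X(t)$ is $1D$-exponentially weakly ergodic if there are positive constants $M',a'$ such that $\|\mathbf p^*(t)-\mathbf p^{**}(t)\|_{1D}\le M'e^{-a'(t-s)}\|\mathbf p^*(s)-\mathbf p^{**}(s)\|_{1D}$ for all $t\ge s\ge0$ and any state probability vectors (solutions of the forward system) with initial conditions $\mathbf p^*(s),\mathbf p^{**}(s)\in l_{1D}$. The perturbed chain $\bar X(t)$ is a Markov chain of the same type on the same state space; its characteristics are denoted with bars. With $E(t,k)=E\{X(t)\mid X(0)=k\}$, $X$ has the limiting mean $\phi(t)$ if $|E(t,k)-\phi(t)|\to0$ as $t\to\infty$ for every $k$; similarly for $\bar X$ and $\bar\phi$. *)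

theory Defs
  imports "HOL-Probability.Probability"
begin

section \<open>Vectors and matrices over a countable index set\<close>

text \<open>
  Vectors are functions \<open>nat \<Rightarrow> real\<close> and matrices are functions \<open>nat \<Rightarrow> nat \<Rightarrow> real\<close>; only the
  entries whose indices lie in the index set \<open>I\<close> matter. Norms take values in \<open>ennreal\<close>, so
  that they may be infinite.
\<close>

definition l1_norm :: "nat set \<Rightarrow> (nat \<Rightarrow> real) \<Rightarrow> ennreal" where
  "l1_norm I x = (\<Sum>\<^sub>\<infinity>i\<in>I. ennreal \<bar>x i\<bar>)"

definition mat_norm :: "nat set \<Rightarrow> (nat \<Rightarrow> nat \<Rightarrow> real) \<Rightarrow> ennreal" where
  "mat_norm I X = (SUP j\<in>I. \<Sum>\<^sub>\<infinity>i\<in>I. ennreal \<bar>X i j\<bar>)"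

definition mat_vec :: "nat set \<Rightarrow> (nat \<Rightarrow> nat \<Rightarrow> real) \<Rightarrow> (nat \<Rightarrow> real) \<Rightarrow> nat \<Rightarrow> real" where
  "mat_vec I X x i = (\<Sum>\<^sub>\<infinity>j\<in>I. X i j * x j)"

definition mat_mult ::
  "nat set \<Rightarrow> (nat \<Rightarrow> nat \<Rightarrow> real) \<Rightarrow> (nat \<Rightarrow> nat \<Rightarrow> real) \<Rightarrow> nat \<Rightarrow> nat \<Rightarrow> real" where
  "mat_mult I X Y i k = (\<Sum>\<^sub>\<infinity>j\<in>I. X i j * Y j k)"

definition l1_abs_continuous_on ::
  "nat set \<Rightarrow> real \<Rightarrow> real \<Rightarrow> (real \<Rightarrow> nat \<Rightarrow> real) \<Rightarrow> bool" where
  "l1_abs_continuous_on I s T x \<longleftrightarrow>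
     (\<forall>\<epsilon>>0. \<exists>\<delta>>0. \<forall>(n::nat) (a :: nat \<Rightarrow> real) (b :: nat \<Rightarrow> real).
        (\<forall>k<n. s \<le> a k \<and> a k \<le> b k \<and> b k \<le> T) \<longrightarrow>
        (\<forall>k<n. \<forall>l<n. k \<noteq> l \<longrightarrow> {a k<..<b k} \<inter> {a l<..<b l} = {}) \<longrightarrow>
        (\<Sum>k<n. b k - a k) < \<delta> \<longrightarrow>
        (\<Sum>k<n. l1_norm I (\<lambda>i. x (b k) i - x (a k) i)) < ennreal \<epsilon>)"

definition has_l1_derivative ::
  "nat set \<Rightarrow> (real \<Rightarrow> nat \<Rightarrow> real) \<Rightarrow> (nat \<Rightarrow> real) \<Rightarrow> real \<Rightarrow> bool" where
  "has_l1_derivative I x v t \<longleftrightarrow>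
     ((\<lambda>h. l1_norm I (\<lambda>i. (x (t + h) i - x t i) / h - v i)) \<longlongrightarrow> 0) (at 0)"


section \<open>Intensities and the forward system\<close>

definition states :: "enat \<Rightarrow> nat set" where
  "states S = {i. enat i \<le> S}"

definition pos_states :: "enat \<Rightarrow> nat set" where
  "pos_states S = {i. 1 \<le> i \<and> enat i \<le> S}"

text \<open>\<open>q i j t\<close> is the intensity of the transition from \<open>i\<close> to \<open>j\<close> at time \<open>t\<close>.\<close>

definition A_mat :: "enat \<Rightarrow> (nat \<Rightarrow> nat \<Rightarrow> real \<Rightarrow> real) \<Rightarrow> real \<Rightarrow> nat \<Rightarrow> nat \<Rightarrow> real" where
  "A_mat S q t i j =
     (if i = j then - (\<Sum>\<^sub>\<infinity>k\<in>states S - {i}. q i k t) else q j i t)"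

definition B_mat :: "enat \<Rightarrow> (nat \<Rightarrow> nat \<Rightarrow> real \<Rightarrow> real) \<Rightarrow> real \<Rightarrow> nat \<Rightarrow> nat \<Rightarrow> real" where
  "B_mat S q t i j = A_mat S q t i j - A_mat S q t i 0"

definition f_vec :: "enat \<Rightarrow> (nat \<Rightarrow> nat \<Rightarrow> real \<Rightarrow> real) \<Rightarrow> real \<Rightarrow> nat \<Rightarrow> real" where
  "f_vec S q t i = A_mat S q t i 0"

text \<open>
  The summability clause makes the bound on \<open>\<bar>a\<^sub>i\<^sub>i(t)\<bar>\<close> meaningful: without it, a divergent
  row sum would be read as 0.
\<close>

definition bounded_intensities :: "enat \<Rightarrow> (nat \<Rightarrow> nat \<Rightarrow> real \<Rightarrow> real) \<Rightarrow> bool" where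
  "bounded_intensities S q \<longleftrightarrow>
     (\<forall>i\<in>states S. \<forall>j\<in>states S. i \<noteq> j \<longrightarrow>
        (\<forall>t\<ge>0. 0 \<le> q i j t) \<and> (\<forall>T\<ge>0. set_integrable lebesgue {0..T} (q i j))) \<and>
     (\<exists>L. AE t in lebesgue. 0 \<le> t \<longrightarrow>
        (\<forall>i\<in>states S. (\<lambda>k. q i k t) summable_on (states S - {i}) \<and> \<bar>A_mat S q t i i\<bar> \<le> L))"

text \<open>
  State probability vectors are given as probability mass functions concentrated on the state
  space; the values \<open>p t\<close> for \<open>t < s\<close> are irrelevant.
\<close>

definition forward_solution ::
  "enat \<Rightarrow> (nat \<Rightarrow> nat \<Rightarrow> real \<Rightarrow> real) \<Rightarrow> real \<Rightarrow> (real \<Rightarrow> nat pmf) \<Rightarrow> bool" where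
  "forward_solution S q s p \<longleftrightarrow>
     (\<forall>t\<ge>s. set_pmf (p t) \<subseteq> states S) \<and>
     (\<forall>T\<ge>s. l1_abs_continuous_on (states S) s T (\<lambda>t. pmf (p t))) \<and>
     (AE t in lebesgue. s < t \<longrightarrow>
        has_l1_derivative (states S) (\<lambda>t. pmf (p t))
          (mat_vec (states S) (A_mat S q t) (pmf (p t))) t)"

text \<open>
  A Markov chain is given by its transition function: \<open>P s t i\<close> is the conditional distribution
  of \<open>X(t)\<close> given \<open>X(s) = i\<close>.
\<close>

definition markov_chain ::
  "enat \<Rightarrow> (nat \<Rightarrow> nat \<Rightarrow> real \<Rightarrow> real) \<Rightarrow> (real \<Rightarrow> real \<Rightarrow> nat \<Rightarrow> nat pmf) \<Rightarrow> bool" where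
  "markov_chain S q P \<longleftrightarrow>
     bounded_intensities S q \<and>
     (\<forall>s\<ge>0. \<forall>i\<in>states S. P s s i = return_pmf i) \<and>
     (\<forall>s t u. \<forall>i\<in>states S. 0 \<le> s \<longrightarrow> s \<le> t \<longrightarrow> t \<le> u \<longrightarrow>
        P s u i = bind_pmf (P s t i) (\<lambda>j. P t u j)) \<and>
     (\<forall>s\<ge>0. \<forall>i\<in>states S. forward_solution S q s (\<lambda>t. P s t i))"


section \<open>The weighted norm\<close>

definition D_mat :: "(nat \<Rightarrow> real) \<Rightarrow> nat \<Rightarrow> nat \<Rightarrow> real" where
  "D_mat d i j = (if i \<le> j then d i else 0)"

definition Dinv_mat :: "(nat \<Rightarrow> real) \<Rightarrow> nat \<Rightarrow> nat \<Rightarrow> real" where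
  "Dinv_mat d i j = (if j = i then 1 / d i else if j = Suc i then - 1 / d j else 0)"

lemma infsum_pos_states_finite:
  fixes g :: "nat \<Rightarrow> real"
  assumes F: "finite F" "F \<subseteq> pos_states S"
    and "\<And>j. j \<in> pos_states S \<Longrightarrow> j \<notin> F \<Longrightarrow> g j = 0"
  shows "(\<Sum>\<^sub>\<infinity>j\<in>pos_states S. g j) = sum g F"
proof -
  have "(\<Sum>\<^sub>\<infinity>j\<in>pos_states S. g j) = (\<Sum>\<^sub>\<infinity>j\<in>F. g j)"
    by (rule infsum_cong_neutral) (use assms in auto)
  then show ?thesis using F by simp
qed

lemma D_Dinv:
  assumes d: "\<And>i. i \<in> pos_states S \<Longrightarrow> d i > 0"
    and i: "i \<in> pos_states S" and k: "k \<in> pos_states S"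
  shows "mat_mult (pos_states S) (D_mat d) (Dinv_mat d) i k = (if i = k then 1 else 0)"
proof -
  let ?F = "{k - 1, k} \<inter> pos_states S"
  have "mat_mult (pos_states S) (D_mat d) (Dinv_mat d) i k
        = (\<Sum>j\<in>?F. D_mat d i j * Dinv_mat d j k)"
    unfolding mat_mult_def
    by (rule infsum_pos_states_finite) (auto simp: Dinv_mat_def)
  also have "\<dots> = (if i = k then 1 else 0)"
  proof (cases "k = 1")
    case True
    then have "?F = {k}" using k by (auto simp: pos_states_def)
    then show ?thesis using True i d[OF k]
      by (auto simp: D_mat_def Dinv_mat_def pos_states_def)
  next
    case False
    then have k2: "2 \<le> k" using k by (auto simp: pos_states_def)
    then have "enat (k - 1) \<le> S" using k
      by (metis diff_le_self enat_ord_simps(1) mem_Collect_eq order_trans pos_states_def)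
    then have "?F = {k - 1, k}" using k k2 by (auto simp: pos_states_def)
    then show ?thesis using k2 d[OF k]
      by (auto simp: D_mat_def Dinv_mat_def)
  qed
  finally show ?thesis .
qed

lemma Dinv_D:
  assumes d: "\<And>i. i \<in> pos_states S \<Longrightarrow> d i > 0"
    and i: "i \<in> pos_states S" and k: "k \<in> pos_states S"
  shows "mat_mult (pos_states S) (Dinv_mat d) (D_mat d) i k = (if i = k then 1 else 0)"
proof -
  let ?F = "{i, Suc i} \<inter> pos_states S"
  have "mat_mult (pos_states S) (Dinv_mat d) (D_mat d) i k
        = (\<Sum>j\<in>?F. Dinv_mat d i j * D_mat d j k)"
    unfolding mat_mult_def
    by (rule infsum_pos_states_finite) (auto simp: Dinv_mat_def)
  also have "\<dots> = (if i = k then 1 else 0)"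
  proof (cases "Suc i \<in> pos_states S")
    case True
    then have "?F = {i, Suc i}" using i by auto
    then show ?thesis using d[OF i] d[OF True]
      by (auto simp: D_mat_def Dinv_mat_def)
  next
    case False
    then have "?F = {i}" using i by auto
    moreover have "k \<le> i"
    proof (rule ccontr)
      assume "\<not> k \<le> i"
      then have "enat (Suc i) \<le> S" using k
        by (metis enat_ord_simps(1) mem_Collect_eq not_less_eq_eq order_trans pos_states_def)
      then show False using False by (simp add: pos_states_def)
    qed
    ultimately show ?thesis using d[OF i]
      by (auto simp: D_mat_def Dinv_mat_def)
  qed
  finally show ?thesis .
qed

text \<open>
  In \<open>norm1D\<close> and \<open>l1D\<close> only the entries with indices at least 1 are used, so they apply
  directly to vectors \<open>(p\<^sub>0, p\<^sub>1, \<dots>)\<close>.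
\<close>

definition norm1D :: "enat \<Rightarrow> (nat \<Rightarrow> real) \<Rightarrow> (nat \<Rightarrow> real) \<Rightarrow> ennreal" where
  "norm1D S d z = l1_norm (pos_states S) (mat_vec (pos_states S) (D_mat d) z)"

definition l1D :: "enat \<Rightarrow> (nat \<Rightarrow> real) \<Rightarrow> (nat \<Rightarrow> real) set" where
  "l1D S d = {z. (\<forall>i\<in>pos_states S. (\<lambda>j. D_mat d i j * z j) summable_on pos_states S) \<and>
                 norm1D S d z < \<infinity>}"

definition conj_D ::
  "enat \<Rightarrow> (nat \<Rightarrow> real) \<Rightarrow> (nat \<Rightarrow> nat \<Rightarrow> real) \<Rightarrow> nat \<Rightarrow> nat \<Rightarrow> real" where
  "conj_D S d X = mat_mult (pos_states S) (mat_mult (pos_states S) (D_mat d) X) (Dinv_mat d)"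

definition mat_norm1D :: "enat \<Rightarrow> (nat \<Rightarrow> real) \<Rightarrow> (nat \<Rightarrow> nat \<Rightarrow> real) \<Rightarrow> ennreal" where
  "mat_norm1D S d X = mat_norm (pos_states S) (conj_D S d X)"

definition B_star2 ::
  "enat \<Rightarrow> (nat \<Rightarrow> nat \<Rightarrow> real \<Rightarrow> real) \<Rightarrow> (nat \<Rightarrow> real) \<Rightarrow> real \<Rightarrow> nat \<Rightarrow> nat \<Rightarrow> real" where
  "B_star2 S q d t = conj_D S d (B_mat S q t)"

definition alpha_i ::
  "enat \<Rightarrow> (nat \<Rightarrow> nat \<Rightarrow> real \<Rightarrow> real) \<Rightarrow> (nat \<Rightarrow> real) \<Rightarrow> nat \<Rightarrow> real \<Rightarrow> real" where
  "alpha_i S q d i t =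
     - (B_star2 S q d t i i + (\<Sum>\<^sub>\<infinity>j\<in>pos_states S - {i}. \<bar>B_star2 S q d t j i\<bar>))"

definition alpha ::
  "enat \<Rightarrow> (nat \<Rightarrow> nat \<Rightarrow> real \<Rightarrow> real) \<Rightarrow> (nat \<Rightarrow> real) \<Rightarrow> real \<Rightarrow> real" where
  "alpha S q d t = (INF i\<in>pos_states S. alpha_i S q d i t)"


section \<open>Ergodicity and limiting means\<close>

definition exp_weakly_ergodic_1D ::
  "enat \<Rightarrow> (nat \<Rightarrow> nat \<Rightarrow> real \<Rightarrow> real) \<Rightarrow> (nat \<Rightarrow> real) \<Rightarrow> bool" where
  "exp_weakly_ergodic_1D S q d \<longleftrightarrow>
     (\<exists>M' a'. 0 < M' \<and> 0 < a' \<and>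
        (\<forall>s\<ge>0. \<forall>p1 p2. forward_solution S q s p1 \<longrightarrow> forward_solution S q s p2 \<longrightarrow>
           pmf (p1 s) \<in> l1D S d \<longrightarrow> pmf (p2 s) \<in> l1D S d \<longrightarrow>
           (\<forall>t\<ge>s. norm1D S d (\<lambda>i. pmf (p1 t) i - pmf (p2 t) i)
                    \<le> ennreal (M' * exp (- a' * (t - s))) *
                      norm1D S d (\<lambda>i. pmf (p1 s) i - pmf (p2 s) i))))"

definition mean_from :: "(real \<Rightarrow> real \<Rightarrow> nat \<Rightarrow> nat pmf) \<Rightarrow> real \<Rightarrow> nat \<Rightarrow> real" where
  "mean_from P t k = measure_pmf.expectation (P 0 t k) real"

text \<open>The integrability clause says that all the means \<open>E(t, k)\<close> are finite.\<close>

definition has_limiting_mean ::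
  "enat \<Rightarrow> (real \<Rightarrow> real \<Rightarrow> nat \<Rightarrow> nat pmf) \<Rightarrow> (real \<Rightarrow> real) \<Rightarrow> bool" where
  "has_limiting_mean S P \<phi> \<longleftrightarrow>
     (\<forall>k\<in>states S. (\<forall>t\<ge>0. integrable (measure_pmf (P 0 t k)) real) \<and>
        ((\<lambda>t. \<bar>mean_from P t k - \<phi> t\<bar>) \<longlongrightarrow> 0) at_top)"

end

theory Submission
  imports Defs
begin

text \<open>
The weight matrix turns a vector into weighted tail sums: \<open>(D x)\<^sub>i = d\<^sub>i \<Sum>\<^sub>j\<^sub>\<ge>\<^sub>i x\<^sub>j\<close>. In these
coordinates \<open>\<parallel>\<cdot>\<parallel>\<^sub>1\<^sub>D\<close> is the plain \<open>l\<^sub>1\<close> norm, and for a state probability vector \<open>p\<close>, \<open>u = D p\<close>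
satisfies \<open>u' = B\<^sup>*\<^sup>* u + D f\<close>; for the difference of two solutions of the same system the
term \<open>D f\<close> drops out. The number \<open>-\<alpha>\<close> is the logarithmic norm of \<open>B\<^sup>*\<^sup>*\<close> on \<open>l\<^sub>1\<close>, so that
\<open>\<parallel>u(t)\<parallel> \<le> exp (- \<integral>\<alpha>) \<parallel>u(s)\<parallel>\<close> up to the contribution of the inhomogeneity. Everything follows from
this one energy estimate (\<open>l1_energy_decay\<close>).

\<^item> Applied to a single solution it bounds \<open>limsup \<parallel>p(t)\<parallel>\<^sub>1\<^sub>D\<close> by \<open>M \<ff> / a\<close>, where \<open>\<ff>\<close> bounds
  \<open>\<parallel>f\<parallel>\<^sub>1\<^sub>D\<close> (\<open>solution_bound\<close>).

\<^item> A perturbation of size \<open>\<Delta>\<^sub>B\<close> lowers the logarithmic decay rate by at most \<open>\<Delta>\<^sub>B\<close>. Hence the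
  perturbed chain contracts with rate \<open>a - \<Delta>\<^sub>B\<close> (\<open>contraction\<close>).

\<^item> The difference \<open>v\<close> of a solution \<open>p\<close> of the original chain and a solution of the perturbed
  one satisfies \<open>v' = B'\<^sup>*\<^sup>* v + (B\<^sup>*\<^sup>* - B'\<^sup>*\<^sup>*) D p + D (f - f')\<close>, a system with decay rate
  \<open>a - \<Delta>\<^sub>B\<close> and an inhomogeneity of norm at most \<open>\<Delta>\<^sub>B \<parallel>p\<parallel>\<^sub>1\<^sub>D + \<Delta>\<^sub>f\<close> (\<open>stability\<close>). With the
  first item this gives \<open>M (M \<Delta>\<^sub>B \<ff> + a \<Delta>\<^sub>f) / (a (a - \<Delta>\<^sub>B))\<close>. Since \<open>M \<ge> 1\<close> (take \<open>s = t\<close> in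
  the decay condition), this is at most the bound of the theorem.

The analytic difficulty is that a solution is given as an absolutely continuous curve in \<open>l\<^sub>1\<close>,
not in the space with norm \<open>\<parallel>\<cdot>\<parallel>\<^sub>1\<^sub>D\<close>. A Lyapunov argument closes the gap: for a
probability vector, \<open>\<parallel>p\<parallel>\<^sub>1\<^sub>D\<close> is the mean of \<open>d\<^sub>1 + \<dots> + d\<^sub>k\<close>, and truncating this weight at level
\<open>n\<close> gives a bounded functional whose growth is controlled uniformly in \<open>n\<close>
(\<open>lyapunov_weighted\<close>). Each tail sum is an absolutely continuous real function, so
integral identities for single coordinates come from the fundamental theorem of calculus
(\<open>abs_cont_fundamental_theorem\<close>, \<open>forward_weak_form\<close>). The energy estimate uses them only for
finitely many coordinates at a time and takes a supremum, so that no vector-valued integration is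
needed.

Finally, summation by parts writes the mean of a distribution as the sum of its unweighted tails, and
\<open>d\<^sub>i \<ge> W\<close> turns the estimates in \<open>\<parallel>\<cdot>\<parallel>\<^sub>1\<^sub>D\<close> into estimates for means (\<open>expectation_difference\<close>).
\<close>


section \<open>The fundamental theorem of calculus for absolutely continuous functions\<close>

text \<open>
The inner statement of the definition of absolute continuity, named separately to keep the
quantifiers over families of intervals out of the proofs.
\<close>

definition small_variation :: "real \<Rightarrow> real \<Rightarrow> (real \<Rightarrow> real) \<Rightarrow> real \<Rightarrow> real \<Rightarrow> bool" where
  "small_variation s T F \<delta> \<epsilon> \<longleftrightarrow>
     (\<forall>(n::nat) a b.
        (\<forall>k<n. s \<le> a k \<and> a k \<le> b k \<and> b k \<le> T) \<longrightarrow>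
        (\<forall>k<n. \<forall>l<n. k \<noteq> l \<longrightarrow> {a k<..<b k} \<inter> {a l<..<b l} = {}) \<longrightarrow>
        (\<Sum>k<n. b k - a k) < \<delta> \<longrightarrow>
        (\<Sum>k<n. \<bar>F (b k) - F (a k)\<bar>) < \<epsilon>)"

definition abs_cont_on :: "real \<Rightarrow> real \<Rightarrow> (real \<Rightarrow> real) \<Rightarrow> bool" where
  "abs_cont_on s T F \<longleftrightarrow> (\<forall>\<epsilon>>0. \<exists>\<delta>>0. small_variation s T F \<delta> \<epsilon>)"

lemma abs_cont_onD:
  assumes "abs_cont_on s T F" "0 < \<epsilon>"
  obtains \<delta> where "0 < \<delta>" "small_variation s T F \<delta> \<epsilon>"
  using assms unfolding abs_cont_on_def by blast

lemma small_variationD: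
  fixes n :: nat
  assumes "small_variation s T F \<delta> \<epsilon>"
    and "\<And>k. k < n \<Longrightarrow> s \<le> a k \<and> a k \<le> b k \<and> b k \<le> T"
    and "\<And>k l. \<lbrakk>k < n; l < n; k \<noteq> l\<rbrakk> \<Longrightarrow> {a k<..<b k} \<inter> {a l<..<b l} = {}"
    and "(\<Sum>k<n. b k - a k) < \<delta>"
  shows "(\<Sum>k<n. \<bar>F (b k) - F (a k)\<bar>) < \<epsilon>"
  using assms(1)[unfolded small_variation_def, rule_format, of n a b] assms(2-4) by blast

lemma abs_cont_on_subset:
  assumes "abs_cont_on s T F" "s \<le> s'" "T' \<le> T"
  shows "abs_cont_on s' T' F"
proof -
  have "small_variation s' T' F \<delta> \<epsilon>" if "small_variation s T F \<delta> \<epsilon>" for \<delta> \<epsilon>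
    unfolding small_variation_def
    by (intro allI impI small_variationD[OF that]) (use assms in force)+
  then show ?thesis using assms(1) unfolding abs_cont_on_def by blast
qed

lemma abs_cont_on_imp_continuous_on:
  assumes "abs_cont_on s T F"
  shows "continuous_on {s..T} F"
  unfolding continuous_on_iff
proof (intro ballI allI impI)
  fix x \<epsilon> :: real assume x: "x \<in> {s..T}" and "0 < \<epsilon>"
  obtain \<delta> where "0 < \<delta>" and \<delta>: "small_variation s T F \<delta> \<epsilon>"
    using abs_cont_onD[OF assms \<open>0 < \<epsilon>\<close>] .
  show "\<exists>d>0. \<forall>x'\<in>{s..T}. dist x' x < d \<longrightarrow> dist (F x') (F x) < \<epsilon>"
  proof (intro exI[of _ \<delta>] conjI ballI impI)
    fix y assume y: "y \<in> {s..T}" "dist y x < \<delta>"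
    have "(\<Sum>k<(1::nat). \<bar>F (max x y) - F (min x y)\<bar>) < \<epsilon>"
      by (rule small_variationD[OF \<delta>, of 1 "\<lambda>_. min x y" "\<lambda>_. max x y"])
         (use x y in \<open>auto simp: dist_real_def min_def max_def abs_real_def split: if_splits\<close>)
    then show "dist (F y) (F x) < \<epsilon>"
      by (auto simp: dist_real_def min_def max_def split: if_splits)
  qed fact
qed

lemma Lipschitz_imp_abs_cont_on:
  assumes L: "\<And>x y. \<lbrakk>s \<le> x; x \<le> y; y \<le> T\<rbrakk> \<Longrightarrow> \<bar>F y - F x\<bar> \<le> C * (y - x)"
  shows "abs_cont_on s T F"
  unfolding abs_cont_on_def small_variation_def
proof (intro allI impI)
  fix \<epsilon> :: real assume \<epsilon>: "0 < \<epsilon>"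
  show "\<exists>\<delta>>0. \<forall>(n::nat) a b.
        (\<forall>k<n. s \<le> a k \<and> a k \<le> b k \<and> b k \<le> T) \<longrightarrow>
        (\<forall>k<n. \<forall>l<n. k \<noteq> l \<longrightarrow> {a k<..<b k} \<inter> {a l<..<b l} = {}) \<longrightarrow>
        (\<Sum>k<n. b k - a k) < \<delta> \<longrightarrow> (\<Sum>k<n. \<bar>F (b k) - F (a k)\<bar>) < \<epsilon>"
  proof (intro exI[of _ "\<epsilon> / (\<bar>C\<bar> + 1)"] conjI allI impI)
    fix n :: nat and a b
    assume 1: "\<forall>k<n. s \<le> a k \<and> a k \<le> b k \<and> b k \<le> T"
      and 3: "(\<Sum>k<n. b k - a k) < \<epsilon> / (\<bar>C\<bar> + 1)"
    have "(\<Sum>k<n. \<bar>F (b k) - F (a k)\<bar>) \<le> (\<Sum>k<n. (\<bar>C\<bar> + 1) * (b k - a k))"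
    proof (rule sum_mono)
      fix k assume k: "k \<in> {..<n}"
      have "\<bar>F (b k) - F (a k)\<bar> \<le> C * (b k - a k)" using L 1 k by auto
      also have "\<dots> \<le> (\<bar>C\<bar> + 1) * (b k - a k)" using 1 k by (intro mult_right_mono) auto
      finally show "\<bar>F (b k) - F (a k)\<bar> \<le> (\<bar>C\<bar> + 1) * (b k - a k)" .
    qed
    also have "\<dots> = (\<bar>C\<bar> + 1) * (\<Sum>k<n. b k - a k)" by (simp add: sum_distrib_left)
    also have "\<dots> < (\<bar>C\<bar> + 1) * (\<epsilon> / (\<bar>C\<bar> + 1))"
      by (intro mult_strict_left_mono 3) auto
    also have "\<dots> = \<epsilon>" by (simp add: add_nonneg_eq_0_iff)
    finally show "(\<Sum>k<n. \<bar>F (b k) - F (a k)\<bar>) < \<epsilon>" .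
  qed (use \<epsilon> in auto)
qed

lemma abs_cont_on_mult:
  assumes f: "abs_cont_on s T f" and g: "abs_cont_on s T g"
  shows "abs_cont_on s T (\<lambda>t. f t * g t)"
  unfolding abs_cont_on_def
proof (intro allI impI)
  fix \<epsilon> :: real assume \<epsilon>: "0 < \<epsilon>"
  have "bounded (f ` {s..T} \<union> g ` {s..T})"
    using f g by (auto intro!: compact_imp_bounded compact_continuous_image abs_cont_on_imp_continuous_on simp: bounded_Un)
  then obtain B where "0 < B" and "\<And>y. y \<in> f ` {s..T} \<union> g ` {s..T} \<Longrightarrow> norm y \<le> B"
    by (auto simp: bounded_pos)
  then have B: "\<bar>f t\<bar> \<le> B" "\<bar>g t\<bar> \<le> B" if "s \<le> t" "t \<le> T" for t
    using that by auto
  have e2: "0 < \<epsilon> / (2 * B)" using \<epsilon> \<open>0 < B\<close> by simp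
  obtain \<delta>1 where \<delta>1: "0 < \<delta>1" "small_variation s T f \<delta>1 (\<epsilon> / (2 * B))" using abs_cont_onD[OF f e2] .
  obtain \<delta>2 where \<delta>2: "0 < \<delta>2" "small_variation s T g \<delta>2 (\<epsilon> / (2 * B))" using abs_cont_onD[OF g e2] .
  show "\<exists>\<delta>>0. small_variation s T (\<lambda>t. f t * g t) \<delta> \<epsilon>"
  proof (intro exI[of _ "min \<delta>1 \<delta>2"] conjI)
    show "small_variation s T (\<lambda>t. f t * g t) (min \<delta>1 \<delta>2) \<epsilon>"
      unfolding small_variation_def
    proof (intro allI impI)
      fix n :: nat and a b
      assume 1: "\<forall>k<n. s \<le> a k \<and> a k \<le> b k \<and> b k \<le> T"
        and 2: "\<forall>k<n. \<forall>l<n. k \<noteq> l \<longrightarrow> {a k<..<b k} \<inter> {a l<..<b l} = {}"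
        and 3: "(\<Sum>k<n. b k - a k) < min \<delta>1 \<delta>2"
      have "(\<Sum>k<n. \<bar>f (b k) - f (a k)\<bar>) < \<epsilon> / (2 * B)"
        by (rule small_variationD[OF \<delta>1(2)]) (use 1 2 3 in auto)
      moreover have "(\<Sum>k<n. \<bar>g (b k) - g (a k)\<bar>) < \<epsilon> / (2 * B)"
        by (rule small_variationD[OF \<delta>2(2)]) (use 1 2 3 in auto)
      ultimately have "B * (\<Sum>k<n. \<bar>f (b k) - f (a k)\<bar>) + B * (\<Sum>k<n. \<bar>g (b k) - g (a k)\<bar>) < \<epsilon>"
        using \<open>0 < B\<close> by (simp add: field_simps)
      moreover have "(\<Sum>k<n. \<bar>f (b k) * g (b k) - f (a k) * g (a k)\<bar>)
          \<le> (\<Sum>k<n. B * \<bar>f (b k) - f (a k)\<bar> + B * \<bar>g (b k) - g (a k)\<bar>)"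
      proof (rule sum_mono)
        fix k assume "k \<in> {..<n}"
        then have k: "s \<le> a k" "a k \<le> b k" "b k \<le> T" using 1 by auto
        have "f (b k) * g (b k) - f (a k) * g (a k) = g (b k) * (f (b k) - f (a k)) + f (a k) * (g (b k) - g (a k))"
          by (simp add: algebra_simps)
        also have "\<bar>\<dots>\<bar> \<le> \<bar>g (b k)\<bar> * \<bar>f (b k) - f (a k)\<bar> + \<bar>f (a k)\<bar> * \<bar>g (b k) - g (a k)\<bar>"
          using abs_triangle_ineq[of "g (b k) * (f (b k) - f (a k))" "f (a k) * (g (b k) - g (a k))"]
          by (simp add: abs_mult)
        also have "\<dots> \<le> B * \<bar>f (b k) - f (a k)\<bar> + B * \<bar>g (b k) - g (a k)\<bar>"
          using B k by (intro add_mono mult_right_mono) auto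
        finally show "\<bar>f (b k) * g (b k) - f (a k) * g (a k)\<bar> \<le> B * \<bar>f (b k) - f (a k)\<bar> + B * \<bar>g (b k) - g (a k)\<bar>" .
      qed
      ultimately show "(\<Sum>k<n. \<bar>f (b k) * g (b k) - f (a k) * g (a k)\<bar>) < \<epsilon>"
        by (simp add: sum.distrib sum_distrib_left)
    qed
  qed (use \<delta>1 \<delta>2 in auto)
qed

lemma abs_cont_on_exp: "abs_cont_on s T (\<lambda>t. exp (c * t :: real))"
proof (rule Lipschitz_imp_abs_cont_on)
  fix x y assume xy: "s \<le> x" "x \<le> y" "y \<le> T"
  let ?C = "\<bar>c\<bar> * exp (\<bar>c\<bar> * max \<bar>s\<bar> \<bar>T\<bar>)"
  have "norm (exp (c * y) - exp (c * x)) \<le> ?C * norm (y - x)"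
  proof (rule field_differentiable_bound[of "{s..T}" "\<lambda>t. exp (c * t)" "\<lambda>t. c * exp (c * t)"])
    fix z assume z: "z \<in> {s..T}"
    show "((\<lambda>t. exp (c * t)) has_field_derivative c * exp (c * z)) (at z within {s..T})"
      by (auto intro!: derivative_eq_intros)
    have "c * z \<le> \<bar>c\<bar> * \<bar>z\<bar>" by (metis abs_ge_self abs_mult)
    also have "\<dots> \<le> \<bar>c\<bar> * max \<bar>s\<bar> \<bar>T\<bar>" using z by (intro mult_left_mono) auto
    finally show "norm (c * exp (c * z)) \<le> ?C" by (simp add: abs_mult mult_left_mono)
  qed (use xy in auto)
  then show "\<bar>exp (c * y) - exp (c * x)\<bar> \<le> ?C * (y - x)" using xy by simp
qed

text \<open>
The open intervals are disjoint subsets of \<open>U\<close>. In the fundamental theorem below, \<open>U\<close> is a thin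
neighbourhood of the exceptional null set.
\<close>

lemma sum_lengths_le_measure_open:
  fixes a b :: "nat \<Rightarrow> real"
  assumes le: "\<And>k. k < n \<Longrightarrow> a k \<le> b k"
    and disj: "\<And>k l. \<lbrakk>k < n; l < n; k \<noteq> l\<rbrakk> \<Longrightarrow> {a k<..<b k} \<inter> {a l<..<b l} = {}"
    and sub: "\<And>k. k < n \<Longrightarrow> {a k<..<b k} \<subseteq> U" and "open U"
    and U: "emeasure lebesgue U < ennreal \<delta>"
  shows "(\<Sum>k<n. b k - a k) < \<delta>"
proof -
  have "ennreal (\<Sum>k<n. b k - a k) = (\<Sum>k<n. ennreal (b k - a k))"
    by (rule sum_ennreal[symmetric]) (use le in auto)
  also have "\<dots> = (\<Sum>k<n. emeasure lborel {a k<..<b k})"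
    using le by (intro sum.cong) auto
  also have "\<dots> = emeasure lborel (\<Union>k<n. {a k<..<b k})"
    by (rule sum_emeasure) (use disj in \<open>auto simp: disjoint_family_on_def\<close>)
  also have "\<dots> \<le> emeasure lborel U"
    using sub \<open>open U\<close> by (intro emeasure_mono) auto
  also have "\<dots> < ennreal \<delta>" using U \<open>open U\<close> by simp
  finally show ?thesis
    by (subst (asm) ennreal_less_iff) (auto intro!: sum_nonneg simp: le)
qed

text \<open>
The exceptional set may be any null set, because the Henstock--Kurzweil gauge can treat it
separately: at a point of differentiability it is chosen so that the difference quotient is almost the
derivative, and at an exceptional point so that the interval lies in an open set of small measure, where
absolute continuity makes the total increment of \<open>F\<close> small.
\<close>

theorem abs_cont_fundamental_theorem:
  fixes F f :: "real \<Rightarrow> real"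
  assumes ab: "a \<le> b" and ac: "abs_cont_on a b F" and N: "N \<in> null_sets lebesgue"
    and der: "\<And>x. \<lbrakk>a < x; x < b; x \<notin> N\<rbrakk> \<Longrightarrow> (F has_real_derivative f x) (at x)"
  shows "(f has_integral (F b - F a)) {a..b}"
proof -
  define E where "E = N \<union> {a, b}"
  have E: "E \<in> null_sets lebesgue" using N by (simp add: E_def)
  define g where "g x = (if x \<in> E then 0 else f x)" for x
  have "(g has_integral (F b - F a)) (cbox a b)"
    unfolding has_integral
  proof (intro allI impI)
    fix e :: real assume e: "0 < e"
    define e2 where "e2 = e / (2 * (b - a + 1))"
    have e2: "0 < e2" using e ab by (simp add: e2_def)
    obtain \<delta> where \<delta>: "0 < \<delta>" "small_variation a b F \<delta> (e / 2)"
      using abs_cont_onD[OF ac, of "e / 2"] e by auto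
    obtain U where U: "open U" "E \<subseteq> U" "U - E \<in> lmeasurable" "emeasure lebesgue (U - E) < ennreal \<delta>"
      using sets_lebesgue_outer_open[of E \<delta>] E \<delta>(1) by auto
    have "emeasure lebesgue U = emeasure lebesgue ((U - E) \<union> E)"
      using U(2) by (intro arg_cong[where f = "emeasure lebesgue"]) auto
    also have "\<dots> = emeasure lebesgue (U - E)"
      using U(3) E by (intro emeasure_Un_null_set) auto
    finally have Um: "emeasure lebesgue U < ennreal \<delta>" using U(4) by simp
    \<comment> \<open>the gauge: inside \<open>U\<close> on the exceptional set, differentiability elsewhere\<close>
    have "\<exists>d>0. (x \<in> E \<longrightarrow> ball x d \<subseteq> U) \<and> (x \<in> {a..b} - E \<longrightarrow>
            (\<forall>y. \<bar>y - x\<bar> < d \<longrightarrow> \<bar>F y - F x - f x * (y - x)\<bar> \<le> e2 * \<bar>y - x\<bar>))" for x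
    proof (cases "x \<in> E")
      case True
      then show ?thesis using U(1,2) open_contains_ball by blast
    next
      case xE: False
      show ?thesis
      proof (cases "x \<in> {a..b}")
        case True
        then have "(F has_derivative (\<lambda>h. f x * h)) (at x)"
          using der[of x] xE by (auto simp: E_def has_field_derivative_def)
        then obtain d where "d > 0" and
          "\<And>y. norm (y - x) < d \<Longrightarrow> norm (F y - F x - f x * (y - x)) \<le> e2 * norm (y - x)"
          using e2 unfolding has_derivative_at_alt by meson
        then show ?thesis using xE by auto
      qed (use xE in \<open>auto intro: exI[of _ 1]\<close>)
    qed
    then obtain d where d: "\<And>x. 0 < d x" "\<And>x. x \<in> E \<Longrightarrow> ball x (d x) \<subseteq> U"
      "\<And>x y. \<lbrakk>x \<in> {a..b}; x \<notin> E; \<bar>y - x\<bar> < d x\<rbrakk> \<Longrightarrow> \<bar>F y - F x - f x * (y - x)\<bar> \<le> e2 * \<bar>y - x\<bar>"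
      by (metis DiffI)
    show "\<exists>\<gamma>. gauge \<gamma> \<and> (\<forall>\<D>. \<D> tagged_division_of (cbox a b) \<and> \<gamma> fine \<D> \<longrightarrow>
            norm ((\<Sum>(x, K)\<in>\<D>. measure lborel K *\<^sub>R g x) - (F b - F a)) < e)"
    proof (rule exI[of _ "\<lambda>x. ball x (d x)"], safe)
      show "gauge (\<lambda>x. ball x (d x))" using d(1) gauge_ball_dependent by blast
    next
      fix p assume p: "p tagged_division_of cbox a b" and fine: "(\<lambda>x. ball x (d x)) fine p"
      have finp: "finite p" using p by blast
      have K: "\<And>x K. (x, K) \<in> p \<Longrightarrow> x \<in> K \<and> K = {Inf K..Sup K} \<and> Inf K \<le> x \<and> x \<le> Sup K \<and>
          a \<le> Inf K \<and> Sup K \<le> b \<and> K \<subseteq> ball x (d x)"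
      proof -
        fix x K assume xK: "(x, K) \<in> p"
        then obtain u v where uv: "K = cbox u v" "x \<in> K" "K \<subseteq> cbox a b"
          using p by (meson tagged_division_ofD(2-4))
        then have "u \<le> v" by auto
        moreover have "K \<subseteq> ball x (d x)" using fine xK by blast
        ultimately show "x \<in> K \<and> K = {Inf K..Sup K} \<and> Inf K \<le> x \<and> x \<le> Sup K \<and>
          a \<le> Inf K \<and> Sup K \<le> b \<and> K \<subseteq> ball x (d x)"
          using uv by auto
      qed
      have ba: "b - a = (\<Sum>(x,K)\<in>p. Sup K - Inf K)" "F b - F a = (\<Sum>(x,K)\<in>p. F (Sup K) - F (Inf K))"
        using additive_tagged_division_1[where f= "\<lambda>x. x"] additive_tagged_division_1[where f= F] ab p by auto
      define pE where "pE = {z \<in> p. fst z \<in> E}"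
      have pE: "finite pE" "pE \<subseteq> p" using finp by (auto simp: pE_def)
      have good: "\<bar>\<Sum>(x,K)\<in>p - pE. measure lborel K * g x - (F (Sup K) - F (Inf K))\<bar> \<le> e2 * (b - a)"
      proof -
        have "\<bar>\<Sum>(x,K)\<in>p - pE. measure lborel K * g x - (F (Sup K) - F (Inf K))\<bar>
            \<le> (\<Sum>(x,K)\<in>p - pE. e2 * (Sup K - Inf K))"
          unfolding case_prod_unfold
        proof (rule order_trans[OF sum_abs sum_mono])
          fix z assume "z \<in> p - pE"
          moreover obtain x K where z: "z = (x, K)" by (cases z)
          ultimately have xK: "(x, K) \<in> p" "x \<notin> E" by (auto simp: pE_def)
          note Kx = K[OF xK(1)]
          define u v where "u = Inf K" and "v = Sup K"
          have uv: "u \<le> x" "x \<le> v" "K = {u..v}" "a \<le> u" "v \<le> b" using Kx by (auto simp: u_def v_def)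
          have "u \<in> {u..v}" "v \<in> {u..v}" using uv by auto
          then have "u \<in> ball x (d x)" "v \<in> ball x (d x)" using Kx uv(3) by (metis subsetD)+
          then have "\<bar>F u - F x - f x * (u - x)\<bar> \<le> e2 * (x - u)" "\<bar>F v - F x - f x * (v - x)\<bar> \<le> e2 * (v - x)"
            using d(3)[of x u] d(3)[of x v] xK uv by (auto simp: dist_real_def)
          then have "\<bar>(v - u) * f x - (F v - F u)\<bar> \<le> e2 * (v - u)"
            by (simp add: abs_le_iff algebra_simps)
          moreover have "measure lborel K = v - u" using uv by simp
          ultimately show "\<bar>measure lborel (snd z) * g (fst z) - (F (Sup (snd z)) - F (Inf (snd z)))\<bar>
              \<le> e2 * (Sup (snd z) - Inf (snd z))"
            using xK(2) by (simp add: z g_def u_def v_def)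
        qed
        also have "\<dots> \<le> (\<Sum>(x,K)\<in>p. e2 * (Sup K - Inf K))"
          using K e2 by (intro sum_mono2 finp) (force intro!: mult_nonneg_nonneg)+
        also have "\<dots> = e2 * (b - a)" by (simp add: ba(1) sum_distrib_left case_prod_unfold)
        finally show ?thesis .
      qed
      have bad: "(\<Sum>(x,K)\<in>pE. \<bar>F (Sup K) - F (Inf K)\<bar>) < e / 2"
      proof -
        obtain h where h: "bij_betw h {0..<card pE} pE"
          using ex_bij_betw_nat_finite[OF pE(1)] by blast
        let ?n = "card pE"
        have hp: "h k \<in> pE" if "k < ?n" for k using h that by (auto simp: bij_betw_def)
        then have hp': "(fst (h k), snd (h k)) \<in> p" "fst (h k) \<in> E" if "k < ?n" for k
          using that pE(2) by (auto simp: pE_def)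
        define l r where "l k = Inf (snd (h k))" and "r k = Sup (snd (h k))" for k
        have lr: "a \<le> l k \<and> l k \<le> r k \<and> r k \<le> b \<and> snd (h k) = {l k..r k} \<and> {l k..r k} \<subseteq> U" if "k < ?n" for k
        proof -
          note * = K[OF hp'(1)[OF that]] and ** = d(2)[OF hp'(2)[OF that]]
          from * have sn: "snd (h k) = {l k..r k}" by (simp add: l_def r_def)
          moreover have "{l k..r k} \<subseteq> U" using * ** sn by blast
          ultimately show ?thesis using * unfolding l_def r_def by auto
        qed
        have disj: "{l k<..<r k} \<inter> {l m<..<r m} = {}" if "k < ?n" "m < ?n" "k \<noteq> m" for k m
        proof -
          have "h k \<noteq> h m" using h that by (auto simp: bij_betw_def inj_on_def)
          then have "interior (snd (h k)) \<inter> interior (snd (h m)) = {}"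
            using tagged_division_ofD(5)[OF p hp'(1)[OF that(1)] hp'(1)[OF that(2)]] by (simp add: prod_eq_iff)
          then show ?thesis using lr[OF that(1)] lr[OF that(2)] by simp
        qed
        have "(\<Sum>k<?n. r k - l k) < \<delta>"
          by (rule sum_lengths_le_measure_open[OF _ _ _ U(1) Um]) (use lr disj in \<open>force+\<close>)
        then have "(\<Sum>k<?n. \<bar>F (r k) - F (l k)\<bar>) < e / 2"
          using lr disj by (intro small_variationD[OF \<delta>(2)]) auto
        also have "(\<Sum>k<?n. \<bar>F (r k) - F (l k)\<bar>) = (\<Sum>z\<in>pE. \<bar>F (Sup (snd z)) - F (Inf (snd z))\<bar>)"
          unfolding l_def r_def
          using sum.reindex_bij_betw[OF h, of "\<lambda>z. \<bar>F (Sup (snd z)) - F (Inf (snd z))\<bar>"]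
          by (simp add: atLeast0LessThan)
        finally show ?thesis by (simp add: case_prod_unfold)
      qed
      have "(\<Sum>(x,K)\<in>p. measure lborel K *\<^sub>R g x) - (F b - F a)
          = (\<Sum>(x,K)\<in>p. measure lborel K * g x - (F (Sup K) - F (Inf K)))"
        unfolding ba(2) by (simp add: sum_subtractf case_prod_unfold)
      also have "\<dots> = (\<Sum>(x,K)\<in>p - pE. measure lborel K * g x - (F (Sup K) - F (Inf K)))
           + (\<Sum>(x,K)\<in>pE. measure lborel K * g x - (F (Sup K) - F (Inf K)))"
        by (rule sum.subset_diff[OF pE(2) finp])
      finally have eq: "(\<Sum>(x,K)\<in>p. measure lborel K *\<^sub>R g x) - (F b - F a)
          = (\<Sum>(x,K)\<in>p - pE. measure lborel K * g x - (F (Sup K) - F (Inf K)))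
           + (\<Sum>(x,K)\<in>pE. measure lborel K * g x - (F (Sup K) - F (Inf K)))" .
      have "\<bar>\<Sum>(x,K)\<in>pE. measure lborel K * g x - (F (Sup K) - F (Inf K))\<bar>
          \<le> (\<Sum>(x,K)\<in>pE. \<bar>F (Sup K) - F (Inf K)\<bar>)"
        unfolding case_prod_unfold
        by (rule order_trans[OF sum_abs sum_mono]) (auto simp: pE_def g_def)
      then have "\<bar>(\<Sum>(x,K)\<in>p. measure lborel K *\<^sub>R g x) - (F b - F a)\<bar> < e2 * (b - a) + e / 2"
        unfolding eq using good bad by linarith
      moreover have "e2 * (b - a) \<le> e / 2" using e ab by (simp add: e2_def field_simps)
      ultimately show "norm ((\<Sum>(x, K)\<in>p. measure lborel K *\<^sub>R g x) - (F b - F a)) < e" by simp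
    qed
  qed
  then have "(g has_integral (F b - F a)) {a..b}" by simp
  moreover have "negligible E" using E by (simp add: negligible_iff_null_sets)
  ultimately show ?thesis
    by (rule has_integral_spike[rotated 2]) (auto simp: g_def)
qed


section \<open>Gronwall estimates\<close>

text \<open>
Increments that are quadratic in a continuous increasing clock \<open>\<psi>\<close> disappear under subdivision:
each bisection of the clock halves their sum. This replaces differentiation in situations where
only integral inequalities are available.
\<close>

lemma antimono_of_quadratic_increments:
  fixes q \<psi> :: "real \<Rightarrow> real"
  assumes cont: "continuous_on {s..T} \<psi>" and C: "0 \<le> C"
    and q: "\<And>r t. \<lbrakk>s \<le> r; r \<le> t; t \<le> T\<rbrakk> \<Longrightarrow> q t - q r \<le> C * (\<psi> t - \<psi> r)\<^sup>2"
    and mono: "\<And>r t. \<lbrakk>s \<le> r; r \<le> t; t \<le> T\<rbrakk> \<Longrightarrow> \<psi> r \<le> \<psi> t"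
    and "s \<le> T"
  shows "q T \<le> q s"
proof -
  have step: "q t - q r \<le> C * (\<psi> t - \<psi> r)\<^sup>2 / 2 ^ n" if "s \<le> r" "r \<le> t" "t \<le> T" for r t n
    using that
  proof (induction n arbitrary: r t)
    case 0
    then show ?case using q by simp
  next
    case (Suc n)
    have "continuous_on {r..t} \<psi>" using cont Suc.prems by (auto intro: continuous_on_subset)
    moreover have "\<psi> r \<le> (\<psi> r + \<psi> t) / 2" "(\<psi> r + \<psi> t) / 2 \<le> \<psi> t"
      using mono[OF Suc.prems] by auto
    ultimately obtain w where w: "r \<le> w" "w \<le> t" "\<psi> w = (\<psi> r + \<psi> t) / 2"
      using IVT'[of \<psi> r "(\<psi> r + \<psi> t) / 2" t] Suc.prems by auto
    have "q t - q w \<le> C * (\<psi> t - \<psi> w)\<^sup>2 / 2 ^ n" "q w - q r \<le> C * (\<psi> w - \<psi> r)\<^sup>2 / 2 ^ n"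
      by (rule Suc.IH; use w(1,2) Suc.prems in linarith)+
    then have "q t - q r \<le> C * (\<psi> t - \<psi> w)\<^sup>2 / 2 ^ n + C * (\<psi> w - \<psi> r)\<^sup>2 / 2 ^ n" by linarith
    also have "\<dots> = C * (\<psi> t - \<psi> r)\<^sup>2 / 2 ^ Suc n"
      unfolding w(3) by (simp add: field_simps power2_eq_square)
    finally show ?case .
  qed
  have "(\<lambda>n. C * (\<psi> T - \<psi> s)\<^sup>2 / 2 ^ n) \<longlonglongrightarrow> 0" by real_asymp
  then have "q T - q s \<le> 0"
    by (rule LIMSEQ_le_const) (use step[of s T] \<open>s \<le> T\<close> in auto)
  then show ?thesis by simp
qed

lemma integral_le_AE:
  fixes f g :: "real \<Rightarrow> real"
  assumes f: "f integrable_on {a..b}" and g: "g integrable_on {a..b}"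
    and AE: "AE x in lebesgue. a \<le> x \<longrightarrow> x \<le> b \<longrightarrow> f x \<le> g x"
  shows "integral {a..b} f \<le> integral {a..b} g"
proof -
  from AE obtain N where N: "N \<in> null_sets lebesgue"
    and sub: "{x \<in> space lebesgue. \<not> (a \<le> x \<longrightarrow> x \<le> b \<longrightarrow> f x \<le> g x)} \<subseteq> N"
    by (auto simp: eventually_ae_filter)
  have neg: "negligible N" using N by (simp add: negligible_iff_null_sets)
  let ?f = "\<lambda>x. if x \<in> N then g x else f x"
  have "?f integrable_on {a..b}"
    by (rule integrable_spike[OF f neg]) auto
  moreover have "integral {a..b} ?f = integral {a..b} f"
    by (rule integral_spike[OF neg]) auto
  moreover have "integral {a..b} ?f \<le> integral {a..b} g"
    by (rule integral_le[OF _ g]) (use calculation(1) sub in auto)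
  ultimately show ?thesis by simp
qed

text \<open>
Gronwall's inequality with an integrable kernel and a forcing term. The discounted function
\<open>q t = e\<^sup>-\<^sup>K\<^sup>(\<^sup>t\<^sup>) y t - \<integral> e\<^sup>-\<^sup>K h\<close> with \<open>K t = \<integral> \<kappa>\<close> would be decreasing by the product rule if \<open>K\<close>
were differentiable. Instead, its increments are bounded by the square of the increment of \<open>\<integral> (\<kappa> + h)\<close>.
\<close>

theorem forced_gronwall:
  fixes y \<kappa> h :: "real \<Rightarrow> real"
  assumes sT: "s \<le> T"
    and \<kappa>: "\<kappa> integrable_on {s..T}" "\<And>t. 0 \<le> \<kappa> t"
    and h: "continuous_on {s..T} h" "\<And>t. 0 \<le> h t"
    and y: "\<And>t. \<lbrakk>s \<le> t; t \<le> T\<rbrakk> \<Longrightarrow> 0 \<le> y t \<and> y t \<le> C"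
    and int: "(\<lambda>t. \<kappa> t * y t) integrable_on {s..T}"
    and ineq: "\<And>r t. \<lbrakk>s \<le> r; r \<le> t; t \<le> T\<rbrakk> \<Longrightarrow>
       y t \<le> y r + integral {r..t} (\<lambda>\<tau>. \<kappa> \<tau> * y \<tau> + h \<tau>)"
  shows "y T \<le> exp (integral {s..T} \<kappa>) *
           (y s + integral {s..T} (\<lambda>\<tau>. exp (- integral {s..\<tau>} \<kappa>) * h \<tau>))"
proof -
  define K where "K t = integral {s..t} \<kappa>" for t
  define H where "H t = integral {s..t} h" for t
  define J where "J t = integral {s..t} (\<lambda>\<tau>. exp (- K \<tau>) * h \<tau>)" for t
  define q where "q t = exp (- K t) * y t - J t" for t
  have hi: "h integrable_on {s..T}" using h(1) by (rule integrable_continuous_real)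
  have contK: "continuous_on {s..T} K"
    unfolding K_def by (rule indefinite_integral_continuous_1[OF \<kappa>(1)])
  have contH: "continuous_on {s..T} H"
    unfolding H_def by (rule indefinite_integral_continuous_1[OF hi])
  have contE: "continuous_on {s..T} (\<lambda>\<tau>. exp (- K \<tau>) * h \<tau>)"
    by (intro continuous_intros contK h)
  have subi: "f integrable_on {r..t}" if "f integrable_on {s..T}" "s \<le> r" "t \<le> T"
    for f :: "real \<Rightarrow> real" and r t
    by (rule integrable_on_subinterval[OF that(1)]) (use that in auto)
  have inc: "integral {s..t} f - integral {s..r} f = integral {r..t} f"
    if "f integrable_on {s..T}" "s \<le> r" "r \<le> t" "t \<le> T" for f :: "real \<Rightarrow> real" and r t
    using Henstock_Kurzweil_Integration.integral_combine[of s r t f] subi[OF that(1), of s t] that by auto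
  have K0: "0 \<le> K t" for t unfolding K_def using \<kappa>(2)
    by (cases "\<kappa> integrable_on {s..t}") (auto simp: integral_nonneg not_integrable_integral)
  have Cnn: "0 \<le> C" using y[of s] sT by auto
  have "q T \<le> q s"
  proof (rule antimono_of_quadratic_increments[of s T "\<lambda>t. K t + H t" "C + 1"])
    show "continuous_on {s..T} (\<lambda>t. K t + H t)" by (intro continuous_intros contK contH)
  next
    fix r t assume rt: "s \<le> r" "r \<le> t" "t \<le> T"
    define k where "k = integral {r..t} \<kappa>"
    define \<eta> where "\<eta> = integral {r..t} h"
    have k: "K t = K r + k" "0 \<le> k"
      using inc[OF \<kappa>(1) rt] subi[OF \<kappa>(1) rt(1,3)] \<kappa>(2) by (auto simp: K_def k_def integral_nonneg)
    have \<eta>: "H t - H r = \<eta>" "0 \<le> \<eta>"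
      using inc[OF hi rt] subi[OF hi rt(1,3)] h(2) by (auto simp: H_def \<eta>_def integral_nonneg)
    have upto: "y \<tau> \<le> y r + k * m + \<eta>" if \<tau>: "r \<le> \<tau>" "\<tau> \<le> t" and m: "0 \<le> m" "\<And>x. \<lbrakk>r \<le> x; x \<le> t\<rbrakk> \<Longrightarrow> y x \<le> m" for m \<tau>
    proof -
      have "y \<tau> \<le> y r + integral {r..\<tau>} (\<lambda>x. \<kappa> x * y x + h x)" using ineq[of r \<tau>] \<tau> rt by auto
      also have "integral {r..\<tau>} (\<lambda>x. \<kappa> x * y x + h x) \<le> integral {r..\<tau>} (\<lambda>x. \<kappa> x * m + h x)"
        by (rule integral_le) (use \<tau> rt m \<kappa>(2) in \<open>auto intro!: integrable_add subi[OF int] subi[OF hi] integrable_on_mult_left subi[OF \<kappa>(1)] mult_left_mono\<close>)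
      also have "\<dots> \<le> integral {r..t} (\<lambda>x. \<kappa> x * m + h x)"
        by (rule integral_subset_le) (use \<tau> rt m \<kappa>(2) h(2) in \<open>auto intro!: integrable_add subi[OF hi] integrable_on_mult_left subi[OF \<kappa>(1)]\<close>)
      also have "\<dots> = k * m + \<eta>"
        using rt by (simp add: integral_add integrable_on_mult_left subi[OF \<kappa>(1)] subi[OF hi] k_def \<eta>_def)
      finally show ?thesis by simp
    qed
    \<comment> \<open>a crude bound on the whole interval, inserted once more into the integral inequality\<close>
    have 0: "y \<tau> \<le> y r + k * C + \<eta>" if "r \<le> \<tau>" "\<tau> \<le> t" for \<tau>
      by (rule upto) (use that rt y Cnn in auto)
    have yr: "0 \<le> y r" "y r \<le> C" using y rt by auto
    have "y t \<le> y r + k * (y r + k * C + \<eta>) + \<eta>"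
      by (rule upto[OF rt(2) order_refl _ 0]) (use yr k(2) \<eta>(2) Cnn in auto)
    then have "exp (- K t) * y t \<le> exp (- K t) * ((1 + k) * y r + (k * k * C + k * \<eta>) + \<eta>)"
      by (intro mult_left_mono) (auto simp: algebra_simps)
    also have "\<dots> \<le> exp (- K t) * (exp k * y r) + (k * k * C + k * \<eta>) + exp (- K t) * \<eta>"
    proof -
      have "(1 + k) * y r \<le> exp k * y r" using yr by (intro mult_right_mono) auto
      then have "exp (- K t) * ((1 + k) * y r) \<le> exp (- K t) * (exp k * y r)"
        by (intro mult_left_mono) auto
      moreover have "exp (- K t) * (k * k * C + k * \<eta>) \<le> 1 * (k * k * C + k * \<eta>)"
        using K0[of t] k \<eta> Cnn by (intro mult_right_mono) auto
      ultimately show ?thesis unfolding distrib_left mult_1_left by linarith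
    qed
    also have "exp (- K t) * (exp k * y r) = exp (- K r) * y r"
      by (simp add: k(1) flip: exp_add mult.assoc)
    finally have 1: "exp (- K t) * y t \<le> exp (- K r) * y r + (k * k * C + k * \<eta>) + exp (- K t) * \<eta>" .
    have "exp (- K t) * \<eta> = integral {r..t} (\<lambda>\<tau>. exp (- K t) * h \<tau>)"
      unfolding \<eta>_def by simp
    also have "\<dots> \<le> integral {r..t} (\<lambda>\<tau>. exp (- K \<tau>) * h \<tau>)"
    proof (rule integral_le)
      show "(\<lambda>\<tau>. exp (- K t) * h \<tau>) integrable_on {r..t}"
        using subi[OF hi] rt by (intro integrable_on_mult_right) auto
      show "(\<lambda>\<tau>. exp (- K \<tau>) * h \<tau>) integrable_on {r..t}"
        by (rule subi) (use rt contE in \<open>auto intro: integrable_continuous_real\<close>)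
      fix \<tau> assume \<tau>: "\<tau> \<in> {r..t}"
      have "K t - K \<tau> = integral {\<tau>..t} \<kappa>" unfolding K_def by (rule inc[OF \<kappa>(1)]) (use \<tau> rt in auto)
      also have "\<dots> \<ge> 0" by (rule integral_nonneg) (use \<tau> rt \<kappa> in \<open>auto intro: subi\<close>)
      finally show "exp (- K t) * h \<tau> \<le> exp (- K \<tau>) * h \<tau>"
        using h(2) by (intro mult_right_mono) auto
    qed
    also have "\<dots> = J t - J r"
      unfolding J_def by (rule inc[symmetric]) (use rt contE in \<open>auto intro: integrable_continuous_real\<close>)
    finally have "q t - q r \<le> k * k * C + k * \<eta>" using 1 by (simp add: q_def)
    also have "\<dots> \<le> (C + 1) * (k + \<eta>)\<^sup>2"
    proof -
      have "(C + 1) * (k + \<eta>)\<^sup>2 = (k * k * C + k * \<eta>) + (C * (2 * k * \<eta> + \<eta> * \<eta>) + k * k + k * \<eta> + \<eta> * \<eta>)"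
        by (simp add: power2_eq_square algebra_simps)
      moreover have "0 \<le> C * (2 * k * \<eta> + \<eta> * \<eta>) + k * k + k * \<eta> + \<eta> * \<eta>"
        using k(2) \<eta>(2) Cnn by simp
      ultimately show ?thesis by linarith
    qed
    also have "k + \<eta> = K t + H t - (K r + H r)" using k \<eta> by simp
    finally show "q t - q r \<le> (C + 1) * (K t + H t - (K r + H r))\<^sup>2" .
    show "K r + H r \<le> K t + H t" using k \<eta> by simp
  qed (use sT Cnn in auto)
  then have "exp (- K T) * y T \<le> y s + J T" by (simp add: q_def J_def K_def)
  then have "exp (K T) * (exp (- K T) * y T) \<le> exp (K T) * (y s + J T)" by (intro mult_left_mono) auto
  then show ?thesis by (simp add: exp_minus field_simps J_def K_def)
qed

lemma infsum_eq_suminf: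
  fixes f :: "nat \<Rightarrow> real"
  assumes "f summable_on I"
  shows "infsum f I = (\<Sum>i. if i \<in> I then f i else 0)"
proof -
  have "(f has_sum infsum f I) I" using assms by simp
  then have "((\<lambda>i. if i \<in> I then f i else 0) has_sum infsum f I) UNIV"
    by (rule has_sum_cong_neutral[THEN iffD1, rotated -1]) auto
  then show ?thesis using has_sum_imp_sums sums_unique by blast
qed

text \<open>
The energy estimate: \<open>h\<close> plays the role of \<open>u'\<close>, the constant \<open>c\<close> is so large that \<open>c + b\<^sub>i\<^sub>i \<ge> 0\<close> in
the applications, and \<open>\<gamma>\<close> is the decay rate. Multiplying \<open>u\<close> by \<open>e\<^sup>c\<^sup>t\<close> makes the diagonal
nonnegative, so absolute values can be taken under the integral without losing the
damping; no differentiation of \<open>\<bar>u\<^sub>i\<bar>\<close> is needed. What remains is Gronwall's inequality for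
\<open>e\<^sup>c\<^sup>t \<parallel>u(t)\<parallel>\<close> with kernel \<open>c - \<gamma>\<close>.
\<close>

theorem l1_energy_decay:
  fixes u h :: "real \<Rightarrow> nat \<Rightarrow> real" and \<gamma> :: "real \<Rightarrow> real" and I :: "nat set"
  defines "V \<equiv> \<lambda>t. \<Sum>\<^sub>\<infinity>i\<in>I. \<bar>u t i\<bar>"
  assumes sT: "s \<le> T" and M: "0 \<le> M" and a: "0 < a" and G: "0 \<le> G"
    and \<gamma>: "\<gamma> absolutely_integrable_on {s..T}"
    and \<gamma>c: "AE t in lebesgue. s \<le> t \<longrightarrow> t \<le> T \<longrightarrow> \<gamma> t \<le> c"
    and decay: "\<And>t. \<lbrakk>s \<le> t; t \<le> T\<rbrakk> \<Longrightarrow> exp (- integral {t..T} \<gamma>) \<le> M * exp (- a * (T - t))"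
    and summ: "\<And>t. \<lbrakk>s \<le> t; t \<le> T\<rbrakk> \<Longrightarrow> (\<lambda>i. \<bar>u t i\<bar>) summable_on I"
    and bnd: "\<And>t. \<lbrakk>s \<le> t; t \<le> T\<rbrakk> \<Longrightarrow> V t \<le> C"
    and ai: "\<And>i. i \<in> I \<Longrightarrow> (\<lambda>t. exp (c * t) * (c * u t i + h t i)) absolutely_integrable_on {s..T}"
    and weak: "\<And>i r t. \<lbrakk>i \<in> I; s \<le> r; r \<le> t; t \<le> T\<rbrakk> \<Longrightarrow>
        ((\<lambda>\<tau>. exp (c * \<tau>) * (c * u \<tau> i + h \<tau> i)) has_integral (exp (c * t) * u t i - exp (c * r) * u r i)) {r..t}"
    and dissip: "AE t in lebesgue. s \<le> t \<longrightarrow> t \<le> T \<longrightarrow>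
       (\<forall>F. finite F \<longrightarrow> F \<subseteq> I \<longrightarrow> (\<Sum>i\<in>F. \<bar>c * u t i + h t i\<bar>) \<le> (c - \<gamma> t) * V t + G)"
  shows "V T \<le> M * exp (- a * (T - s)) * V s + G * M / a"
proof -
  define \<kappa> where "\<kappa> t = max 0 (c - \<gamma> t)" for t
  define y where "y t = exp (c * t) * V t" for t
  have V0: "0 \<le> V t" for t unfolding V_def by (rule infsum_nonneg) auto
  have cont: "continuous_on {s..T} (\<lambda>t. u t i)" if i: "i \<in> I" for i
  proof -
    let ?g = "\<lambda>\<tau>. exp (c * \<tau>) * (c * u \<tau> i + h \<tau> i)"
    have "?g integrable_on {s..T}" using weak[OF i, of s T] sT by (auto simp: integrable_on_def)
    then have "continuous_on {s..T} (\<lambda>t. exp (- c * t) * (integral {s..t} ?g + exp (c * s) * u s i))"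
      by (intro continuous_intros indefinite_integral_continuous_1)
    moreover have "exp (- c * t) * (integral {s..t} ?g + exp (c * s) * u s i) = u t i" if "t \<in> {s..T}" for t
    proof -
      have "integral {s..t} ?g = exp (c * t) * u t i - exp (c * s) * u s i"
        using weak[OF i, of s t] that by (auto intro: integral_unique)
      then show ?thesis by (simp add: exp_minus)
    qed
    ultimately show ?thesis using continuous_on_eq by (metis (no_types, lifting))
  qed
  have measV: "V \<in> borel_measurable (lebesgue_on {s..T})"
  proof -
    have "(\<lambda>t. if i \<in> I then \<bar>u t i\<bar> else 0) \<in> borel_measurable (lebesgue_on {s..T})" for i
    proof (cases "i \<in> I")
      case True
      then show ?thesis using cont[OF True]
        by (auto intro!: continuous_imp_measurable_on_sets_lebesgue continuous_intros)
    qed simp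
    then have "(\<lambda>t. \<Sum>i. if i \<in> I then \<bar>u t i\<bar> else 0) \<in> borel_measurable (lebesgue_on {s..T})"
      by (rule borel_measurable_suminf)
    then show ?thesis
      by (rule measurable_cong[THEN iffD1, rotated])
         (auto simp: V_def infsum_eq_suminf[OF summ])
  qed
  have VC: "bounded (V ` {s..T})"
    using bnd V0 by (auto intro!: boundedI[of _ C])
  have \<kappa>ai: "\<kappa> absolutely_integrable_on {s..T}"
    unfolding \<kappa>_def by (intro absolutely_integrable_max_1 set_integral_diff(1) \<gamma>) auto
  then have \<kappa>i: "\<kappa> integrable_on {s..T}" by (rule set_lebesgue_integral_eq_integral(1))
  have \<gamma>i: "\<gamma> integrable_on {s..T}" using \<gamma> by (rule set_lebesgue_integral_eq_integral(1))
  have subi: "f integrable_on {r..t}" if "f integrable_on {s..T}" "s \<le> r" "t \<le> T"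
    for f :: "real \<Rightarrow> real" and r t
    by (rule integrable_on_subinterval[OF that(1)]) (use that in auto)
  have ey: "(\<lambda>t. exp (c * t)) integrable_on {s..T}"
    by (intro integrable_continuous_real continuous_intros)
  have measy: "y \<in> borel_measurable (lebesgue_on {s..T})"
    unfolding y_def
    by (intro borel_measurable_times measV continuous_imp_measurable_on_sets_lebesgue continuous_intros) auto
  define Cy where "Cy = exp (\<bar>c\<bar> * max \<bar>s\<bar> \<bar>T\<bar>) * C"
  have ybound: "0 \<le> y t \<and> y t \<le> Cy" if "s \<le> t" "t \<le> T" for t
  proof -
    have "c * t \<le> \<bar>c\<bar> * \<bar>t\<bar>" by (metis abs_ge_self abs_mult)
    also have "\<dots> \<le> \<bar>c\<bar> * max \<bar>s\<bar> \<bar>T\<bar>" using that by (intro mult_left_mono) auto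
    finally show ?thesis unfolding y_def Cy_def using V0[of t] bnd[OF that] by (auto intro!: mult_mono)
  qed
  have int: "(\<lambda>t. \<kappa> t * y t) absolutely_integrable_on {s..T}"
  proof -
    have "(\<lambda>t. y t * \<kappa> t) absolutely_integrable_on {s..T}"
      by (rule absolutely_integrable_bounded_measurable_product_real[OF measy _ _ \<kappa>ai])
         (use ybound in \<open>auto intro!: boundedI[of _ Cy]\<close>)
    then show ?thesis by (simp add: mult.commute)
  qed
  then have inti: "(\<lambda>t. \<kappa> t * y t) integrable_on {s..T}" by (rule set_lebesgue_integral_eq_integral(1))
  have step: "y t \<le> y r + integral {r..t} (\<lambda>\<tau>. \<kappa> \<tau> * y \<tau> + G * exp (c * \<tau>))"
    if rt: "s \<le> r" "r \<le> t" "t \<le> T" for r t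
  proof -
    let ?R = "integral {r..t} (\<lambda>\<tau>. \<kappa> \<tau> * y \<tau> + G * exp (c * \<tau>))"
    \<comment> \<open>finitely many coordinates can be integrated term by term; the supremum over \<open>F\<close> comes last\<close>
    have fin: "(\<Sum>i\<in>F. \<bar>u t i\<bar>) \<le> exp (- (c * t)) * (y r + ?R)" if F: "finite F" "F \<subseteq> I" for F
    proof -
      let ?g = "\<lambda>i \<tau>. exp (c * \<tau>) * (c * u \<tau> i + h \<tau> i)"
      have gi: "?g i absolutely_integrable_on {r..t}" if "i \<in> F" for i
        by (rule set_integrable_subset[OF ai]) (use that F rt in auto)
      have gni: "(\<lambda>\<tau>. \<bar>?g i \<tau>\<bar>) integrable_on {r..t}" if "i \<in> F" for i
        using gi[OF that] by (simp add: absolutely_integrable_on_def)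
      have one: "exp (c * t) * \<bar>u t i\<bar> \<le> exp (c * r) * \<bar>u r i\<bar> + integral {r..t} (\<lambda>\<tau>. \<bar>?g i \<tau>\<bar>)" if i: "i \<in> F" for i
      proof -
        have "integral {r..t} (?g i) = exp (c * t) * u t i - exp (c * r) * u r i"
          using weak[of i r t] F i rt by (auto intro: integral_unique)
        moreover have "norm (integral {r..t} (?g i)) \<le> integral {r..t} (\<lambda>\<tau>. \<bar>?g i \<tau>\<bar>)"
          by (rule integral_norm_bound_integral[OF _ gni[OF i]])
             (use gi[OF i] in \<open>auto intro: set_lebesgue_integral_eq_integral(1)\<close>)
        ultimately have "\<bar>exp (c * t) * u t i\<bar> \<le> \<bar>exp (c * r) * u r i\<bar> + integral {r..t} (\<lambda>\<tau>. \<bar>?g i \<tau>\<bar>)"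
          by simp
        then show ?thesis by (simp add: abs_mult)
      qed
      have "exp (c * t) * (\<Sum>i\<in>F. \<bar>u t i\<bar>) \<le> exp (c * r) * (\<Sum>i\<in>F. \<bar>u r i\<bar>) + (\<Sum>i\<in>F. integral {r..t} (\<lambda>\<tau>. \<bar>?g i \<tau>\<bar>))"
        unfolding sum_distrib_left sum.distrib[symmetric] by (rule sum_mono) (rule one)
      also have "(\<Sum>i\<in>F. integral {r..t} (\<lambda>\<tau>. \<bar>?g i \<tau>\<bar>)) = integral {r..t} (\<lambda>\<tau>. \<Sum>i\<in>F. \<bar>?g i \<tau>\<bar>)"
        by (rule integral_sum[symmetric]) (use F gni in auto)
      also have "\<dots> \<le> ?R"
      proof (rule integral_le_AE)
        show "(\<lambda>\<tau>. \<Sum>i\<in>F. \<bar>?g i \<tau>\<bar>) integrable_on {r..t}"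
          by (rule integrable_sum) (use F gni in auto)
        show "(\<lambda>\<tau>. \<kappa> \<tau> * y \<tau> + G * exp (c * \<tau>)) integrable_on {r..t}"
          by (intro integrable_add subi[OF inti] integrable_on_mult_right subi[OF ey] rt)
        show "AE x in lebesgue. r \<le> x \<longrightarrow> x \<le> t \<longrightarrow> (\<Sum>i\<in>F. \<bar>?g i x\<bar>) \<le> \<kappa> x * y x + G * exp (c * x)"
          using dissip
        proof eventually_elim
          case (elim x)
          show ?case
          proof (intro impI)
            assume x: "r \<le> x" "x \<le> t"
            have "(\<Sum>i\<in>F. \<bar>?g i x\<bar>) = exp (c * x) * (\<Sum>i\<in>F. \<bar>c * u x i + h x i\<bar>)"
              by (simp add: abs_mult sum_distrib_left)
            also have "\<dots> \<le> exp (c * x) * (\<kappa> x * V x + G)"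
            proof (rule mult_left_mono)
              have "(\<Sum>i\<in>F. \<bar>c * u x i + h x i\<bar>) \<le> (c - \<gamma> x) * V x + G" using elim x rt F by auto
              also have "\<dots> \<le> \<kappa> x * V x + G"
                unfolding \<kappa>_def using V0 by (intro add_right_mono mult_right_mono) auto
              finally show "(\<Sum>i\<in>F. \<bar>c * u x i + h x i\<bar>) \<le> \<kappa> x * V x + G" .
            qed auto
            finally show "(\<Sum>i\<in>F. \<bar>?g i x\<bar>) \<le> \<kappa> x * y x + G * exp (c * x)"
              by (simp add: y_def algebra_simps)
          qed
        qed
      qed
      also have "exp (c * r) * (\<Sum>i\<in>F. \<bar>u r i\<bar>) \<le> y r"
        unfolding y_def V_def using summ[of r] rt F by (intro mult_left_mono finite_sum_le_infsum) auto
      finally have "exp (c * t) * (\<Sum>i\<in>F. \<bar>u t i\<bar>) \<le> y r + ?R" by simp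
      then show ?thesis by (simp add: exp_minus field_simps)
    qed
    have "V t \<le> exp (- (c * t)) * (y r + ?R)"
      unfolding V_def by (rule infsum_le_finite_sums) (use summ[of t] rt fin in auto)
    then have "y t \<le> exp (c * t) * (exp (- (c * t)) * (y r + ?R))"
      unfolding y_def by (intro mult_left_mono) auto
    then show ?thesis by (simp add: exp_minus flip: mult.assoc)
  qed
  have gr: "y T \<le> exp (integral {s..T} \<kappa>) *
           (y s + integral {s..T} (\<lambda>\<tau>. exp (- integral {s..\<tau>} \<kappa>) * (G * exp (c * \<tau>))))"
    by (rule forced_gronwall[where C = Cy, OF sT \<kappa>i _ _ _ _ inti step])
       (use ybound G in \<open>auto intro!: continuous_intros simp: \<kappa>_def\<close>)
  have K: "integral {r..t} \<kappa> = c * (t - r) - integral {r..t} \<gamma>" if rt: "s \<le> r" "r \<le> t" "t \<le> T" for r t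
  proof -
    have ci: "(\<lambda>\<tau>. c - \<gamma> \<tau>) integrable_on {r..t}" by (intro integrable_diff subi[OF \<gamma>i] rt) auto
    have "integral {r..t} \<kappa> = integral {r..t} (\<lambda>\<tau>. c - \<gamma> \<tau>)"
    proof (rule antisym)
      show "integral {r..t} \<kappa> \<le> integral {r..t} (\<lambda>\<tau>. c - \<gamma> \<tau>)"
        by (rule integral_le_AE[OF subi[OF \<kappa>i rt(1,3)] ci], use \<gamma>c in eventually_elim) (use rt in \<open>auto simp: \<kappa>_def\<close>)
      show "integral {r..t} (\<lambda>\<tau>. c - \<gamma> \<tau>) \<le> integral {r..t} \<kappa>"
        by (rule integral_le[OF ci subi[OF \<kappa>i rt(1,3)]]) (auto simp: \<kappa>_def)
    qed
    also have "\<dots> = c * (t - r) - integral {r..t} \<gamma>"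
      using rt Henstock_Kurzweil_Integration.integral_diff[of "\<lambda>_. c" "{r..t}" \<gamma>] subi[OF \<gamma>i, of r t]
      by (simp add: integrable_const_ivl mult.commute)
    finally show ?thesis .
  qed
  have comb: "integral {s..\<tau>} \<kappa> + integral {\<tau>..T} \<kappa> = integral {s..T} \<kappa>" if "s \<le> \<tau>" "\<tau> \<le> T" for \<tau>
    by (rule Henstock_Kurzweil_Integration.integral_combine[OF that \<kappa>i])
  have contk: "continuous_on {s..T} (\<lambda>\<tau>. integral {s..\<tau>} \<kappa>)" by (rule indefinite_integral_continuous_1[OF \<kappa>i])
  have e1: "exp (- (c * T)) * exp (integral {s..T} \<kappa>) * exp (- integral {s..\<tau>} \<kappa>) * exp (c * \<tau>) \<le> M * exp (- a * (T - \<tau>))"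
    if \<tau>: "s \<le> \<tau>" "\<tau> \<le> T" for \<tau>
  proof -
    have "exp (- (c * T)) * exp (integral {s..T} \<kappa>) * exp (- integral {s..\<tau>} \<kappa>) * exp (c * \<tau>)
        = exp (- (c * T) + integral {s..T} \<kappa> - integral {s..\<tau>} \<kappa> + c * \<tau>)"
      by (simp add: exp_add exp_diff exp_minus field_simps)
    also have "\<dots> = exp (- integral {\<tau>..T} \<gamma>)"
      using comb[OF \<tau>] K[of \<tau> T] \<tau> by (simp add: algebra_simps)
    also have "\<dots> \<le> M * exp (- a * (T - \<tau>))" by (rule decay[OF \<tau>])
    finally show ?thesis .
  qed
  let ?c = "exp (- (c * T)) * exp (integral {s..T} \<kappa>)"
  have "V T = exp (- (c * T)) * y T" by (simp add: y_def exp_minus)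
  also have "\<dots> \<le> ?c * (y s + integral {s..T} (\<lambda>\<tau>. exp (- integral {s..\<tau>} \<kappa>) * (G * exp (c * \<tau>))))"
    using gr by (simp add: mult.assoc)
  also have "\<dots> = ?c * exp (c * s) * V s + integral {s..T} (\<lambda>\<tau>. G * (?c * exp (- integral {s..\<tau>} \<kappa>) * exp (c * \<tau>)))"
    by (simp add: y_def algebra_simps flip: integral_mult_right)
  also have "\<dots> \<le> M * exp (- a * (T - s)) * V s + G * M / a"
  proof (rule add_mono)
    show "?c * exp (c * s) * V s \<le> M * exp (- a * (T - s)) * V s"
      using e1[of s] sT V0 by (intro mult_right_mono) auto
    have E: "((\<lambda>\<tau>. G * (M * exp (- a * (T - \<tau>)))) has_integral
         (G * M / a * exp (- a * (T - T)) - G * M / a * exp (- a * (T - s)))) {s..T}"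
      by (rule fundamental_theorem_of_calculus[OF sT])
         (use a in \<open>auto intro!: derivative_eq_intros simp: has_real_derivative_iff_has_vector_derivative[symmetric]\<close>)
    have "integral {s..T} (\<lambda>\<tau>. G * (?c * exp (- integral {s..\<tau>} \<kappa>) * exp (c * \<tau>)))
        \<le> integral {s..T} (\<lambda>\<tau>. G * (M * exp (- a * (T - \<tau>))))"
    proof (rule integral_le)
      show "(\<lambda>\<tau>. G * (?c * exp (- integral {s..\<tau>} \<kappa>) * exp (c * \<tau>))) integrable_on {s..T}"
        by (intro integrable_continuous_real continuous_intros contk)
    qed (use E e1 G in \<open>auto intro!: mult_left_mono simp: integrable_on_def\<close>)
    also have "\<dots> = G * M / a * exp (- a * (T - T)) - G * M / a * exp (- a * (T - s))"
      by (rule integral_unique[OF E])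
    also have "\<dots> \<le> G * M / a" using G M a by simp
    finally show "integral {s..T} (\<lambda>\<tau>. G * (?c * exp (- integral {s..\<tau>} \<kappa>) * exp (c * \<tau>))) \<le> G * M / a" .
  qed
  finally show ?thesis .
qed


section \<open>Countable sums, column norms and the logarithmic norm\<close>

lemma summable_abs_iff: "(\<lambda>x. \<bar>f x :: real\<bar>) summable_on A \<longleftrightarrow> f summable_on A"
  using summable_on_iff_abs_summable_on_real[of f A] by simp

lemma summable_on_abs_bound:
  fixes f g :: "'a \<Rightarrow> real"
  assumes "g summable_on A" "\<And>x. x \<in> A \<Longrightarrow> \<bar>f x\<bar> \<le> g x"
  shows "f summable_on A"
proof -
  have "(\<lambda>x. norm (f x)) summable_on A"
  proof (rule Infinite_Sum.abs_summable_on_comparison_test[of g])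
    show "(\<lambda>x. norm (g x)) summable_on A" using assms(1) by (simp add: summable_abs_iff)
    show "norm (f x) \<le> norm (g x)" if "x \<in> A" for x using assms(2)[OF that] by auto
  qed
  then show ?thesis by (simp add: summable_abs_iff)
qed

lemma abs_infsum_le:
  fixes f :: "'a \<Rightarrow> real"
  assumes "f summable_on A"
  shows "\<bar>infsum f A\<bar> \<le> (\<Sum>\<^sub>\<infinity>x\<in>A. \<bar>f x\<bar>)"
  using norm_infsum_bound[of f A] assms by (simp add: summable_abs_iff)

text \<open>
Fubini's theorem for double series in the form used throughout: absolute convergence of one
iterated sum gives the exchange of summation together with all the summability facts.
\<close>

lemma infsum_swap_abs:
  fixes f :: "'a \<Rightarrow> 'b \<Rightarrow> real"
  assumes 1: "\<forall>i\<in>A. f i summable_on B"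
    and 2: "(\<lambda>i. \<Sum>\<^sub>\<infinity>j\<in>B. \<bar>f i j\<bar>) summable_on A"
  shows "(\<Sum>\<^sub>\<infinity>i\<in>A. \<Sum>\<^sub>\<infinity>j\<in>B. f i j) = (\<Sum>\<^sub>\<infinity>j\<in>B. \<Sum>\<^sub>\<infinity>i\<in>A. f i j)"
    and "(\<lambda>i. \<Sum>\<^sub>\<infinity>j\<in>B. f i j) summable_on A"
    and "(\<lambda>j. \<Sum>\<^sub>\<infinity>i\<in>A. f i j) summable_on B"
    and "\<And>j. j \<in> B \<Longrightarrow> (\<lambda>i. f i j) summable_on A"
    and "(\<lambda>j. \<Sum>\<^sub>\<infinity>i\<in>A. \<bar>f i j\<bar>) summable_on B"
    and "(\<Sum>\<^sub>\<infinity>i\<in>A. \<Sum>\<^sub>\<infinity>j\<in>B. \<bar>f i j\<bar>) = (\<Sum>\<^sub>\<infinity>j\<in>B. \<Sum>\<^sub>\<infinity>i\<in>A. \<bar>f i j\<bar>)"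
proof -
  have abs: "(\<lambda>x. norm ((\<lambda>(i, j). f i j) x)) summable_on A \<times> B"
    unfolding Infinite_Sum.abs_summable_on_Sigma_iff using 1 2
    by (auto simp: summable_abs_iff infsum_nonneg)
  have swap: "((\<lambda>(j, i). g i j) summable_on B \<times> A) \<longleftrightarrow> ((\<lambda>(i, j). g i j) summable_on A \<times> B)"
    for g :: "'a \<Rightarrow> 'b \<Rightarrow> real"
  proof -
    have "((\<lambda>(j, i). g i j) summable_on prod.swap ` (A \<times> B)) \<longleftrightarrow> ((\<lambda>(j, i). g i j) \<circ> prod.swap summable_on A \<times> B)"
      by (rule summable_on_reindex) simp
    then show ?thesis by (simp add: product_swap comp_def case_prod_unfold)
  qed
  have s: "(\<lambda>(i, j). f i j) summable_on A \<times> B"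
    using abs by (simp add: summable_abs_iff)
  have s': "(\<lambda>(j, i). f i j) summable_on B \<times> A" by (rule swap[THEN iffD2, OF s])
  have a: "(\<lambda>(i, j). \<bar>f i j\<bar>) summable_on A \<times> B" using abs by (simp add: case_prod_unfold)
  have a': "(\<lambda>(j, i). \<bar>f i j\<bar>) summable_on B \<times> A" by (rule swap[THEN iffD2, OF a])
  show "(\<Sum>\<^sub>\<infinity>i\<in>A. \<Sum>\<^sub>\<infinity>j\<in>B. f i j) = (\<Sum>\<^sub>\<infinity>j\<in>B. \<Sum>\<^sub>\<infinity>i\<in>A. f i j)"
    by (rule infsum_swap_banach[OF s])
  show "(\<Sum>\<^sub>\<infinity>i\<in>A. \<Sum>\<^sub>\<infinity>j\<in>B. \<bar>f i j\<bar>) = (\<Sum>\<^sub>\<infinity>j\<in>B. \<Sum>\<^sub>\<infinity>i\<in>A. \<bar>f i j\<bar>)"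
    by (rule infsum_swap_banach[OF a])
  show "(\<lambda>i. \<Sum>\<^sub>\<infinity>j\<in>B. f i j) summable_on A" by (rule summable_on_Sigma_banach[OF s])
  show "(\<lambda>j. \<Sum>\<^sub>\<infinity>i\<in>A. f i j) summable_on B" by (rule summable_on_Sigma_banach[OF s'])
  show "(\<lambda>j. \<Sum>\<^sub>\<infinity>i\<in>A. \<bar>f i j\<bar>) summable_on B" by (rule summable_on_Sigma_banach[OF a'])
  fix j assume j: "j \<in> B"
  have "(\<lambda>x. norm ((\<lambda>(j, i). f i j) x)) summable_on B \<times> A" using s' by (simp add: summable_abs_iff)
  then show "(\<lambda>i. f i j) summable_on A"
    unfolding Infinite_Sum.abs_summable_on_Sigma_iff using j by (auto simp: summable_abs_iff)
qed

lemma l1_norm_eq: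
  assumes "x summable_on I"
  shows "l1_norm I x = ennreal (\<Sum>\<^sub>\<infinity>i\<in>I. \<bar>x i\<bar>)"
proof -
  have "(\<lambda>i. \<bar>x i\<bar>) summable_on I" using assms by (simp add: summable_abs_iff)
  then have "ennreal (\<Sum>\<^sub>\<infinity>i\<in>I. \<bar>x i\<bar>) = (SUP F\<in>{F. finite F \<and> F \<subseteq> I}. ennreal (\<Sum>i\<in>F. \<bar>x i\<bar>))"
    by (rule infsum_nonneg_is_SUPREMUM_ennreal) auto
  also have "\<dots> = l1_norm I x"
    unfolding l1_norm_def by (subst nonneg_infsum_complete) (auto simp: sum_ennreal intro!: SUP_cong)
  finally show ?thesis ..
qed

lemma l1_norm_leD:
  assumes "l1_norm I x \<le> ennreal C" "0 \<le> C"
  shows "x summable_on I" "(\<Sum>\<^sub>\<infinity>i\<in>I. \<bar>x i\<bar>) \<le> C"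
proof -
  have fin: "(\<Sum>i\<in>F. \<bar>x i\<bar>) \<le> C" if F: "finite F" "F \<subseteq> I" for F
  proof -
    have "l1_norm I x = (SUP F\<in>{F. finite F \<and> F \<subseteq> I}. \<Sum>i\<in>F. ennreal \<bar>x i\<bar>)"
      unfolding l1_norm_def by (rule nonneg_infsum_complete) simp
    then have "(\<Sum>i\<in>F. ennreal \<bar>x i\<bar>) \<le> l1_norm I x"
      using F by (auto intro: SUP_upper2)
    then have "ennreal (\<Sum>i\<in>F. \<bar>x i\<bar>) \<le> ennreal C"
      using assms(1) by (simp add: sum_ennreal)
    then show ?thesis using assms(2) by (simp add: ennreal_le_iff)
  qed
  have s: "(\<lambda>i. \<bar>x i\<bar>) summable_on I"
    by (rule nonneg_bdd_above_summable_on) (use fin in \<open>auto intro!: bdd_aboveI2[of _ _ C]\<close>)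
  then show "x summable_on I" by (simp only: summable_abs_iff)
  show "(\<Sum>\<^sub>\<infinity>i\<in>I. \<bar>x i\<bar>) \<le> C"
    by (rule infsum_le_finite_sums[OF s]) (rule fin)
qed

lemma l1_norm_finiteD:
  assumes "l1_norm I x < \<infinity>"
  shows "x summable_on I"
proof -
  obtain C where "0 \<le> C" "l1_norm I x = ennreal C"
    using assms by (cases "l1_norm I x") auto
  then show ?thesis using l1_norm_leD(1)[of I x C] by simp
qed

lemma mat_norm_leD:
  assumes "mat_norm I X \<le> ennreal C" "0 \<le> C" "k \<in> I"
  shows "(\<lambda>i. X i k) summable_on I" "(\<Sum>\<^sub>\<infinity>i\<in>I. \<bar>X i k\<bar>) \<le> C"
proof -
  have "l1_norm I (\<lambda>i. X i k) \<le> mat_norm I X"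
    unfolding mat_norm_def l1_norm_def by (rule SUP_upper[OF assms(3)])
  then have "l1_norm I (\<lambda>i. X i k) \<le> ennreal C" using assms(1) by (rule order_trans)
  then show "(\<lambda>i. X i k) summable_on I" "(\<Sum>\<^sub>\<infinity>i\<in>I. \<bar>X i k\<bar>) \<le> C"
    using l1_norm_leD[of I "\<lambda>i. X i k" C] assms(2) by auto
qed

lemma mat_norm_entry_le:
  assumes "mat_norm I X \<le> ennreal C" "0 \<le> C" "k \<in> I" "i \<in> I"
  shows "\<bar>X i k\<bar> \<le> C"
proof -
  have "(\<Sum>i\<in>{i}. \<bar>X i k\<bar>) \<le> (\<Sum>\<^sub>\<infinity>i\<in>I. \<bar>X i k\<bar>)"
    using mat_norm_leD(1)[OF assms(1-3)] assms(4)
    by (intro finite_sum_le_infsum) (auto simp: summable_abs_iff)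
  then show ?thesis using mat_norm_leD(2)[OF assms(1-3)] by simp
qed

lemma mat_norm_finite_le:
  assumes "mat_norm I X \<le> ennreal C" "0 \<le> C" "k \<in> I" "finite F" "F \<subseteq> I"
  shows "(\<Sum>i\<in>F. \<bar>X i k\<bar>) \<le> C"
proof -
  have "(\<Sum>i\<in>F. \<bar>X i k\<bar>) \<le> (\<Sum>\<^sub>\<infinity>i\<in>I. \<bar>X i k\<bar>)"
    using mat_norm_leD(1)[OF assms(1-3)] assms(4,5)
    by (intro finite_sum_le_infsum) (auto simp: summable_abs_iff)
  then show ?thesis using mat_norm_leD(2)[OF assms(1-3)] by simp
qed

lemma summable_bounded_mult:
  fixes y c :: "nat \<Rightarrow> real"
  assumes "y summable_on I" "\<And>k. k \<in> I \<Longrightarrow> \<bar>c k\<bar> \<le> C"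
  shows "(\<lambda>k. c k * y k) summable_on I"
proof (rule summable_on_abs_bound)
  show "(\<lambda>k. C * \<bar>y k\<bar>) summable_on I"
    using assms(1) by (intro summable_on_cmult_right) (simp add: summable_abs_iff)
qed (use assms(2) in \<open>auto simp: abs_mult intro!: mult_right_mono\<close>)

text \<open>
The finite set \<open>F\<close> of rows may be any part of the index set, so a bound for the column sums over
\<open>F\<close> suffices.
\<close>

lemma column_bound_l1:
  fixes c :: "nat \<Rightarrow> nat \<Rightarrow> real"
  assumes F: "finite F" and y: "y summable_on I"
    and c: "\<And>k. k \<in> I \<Longrightarrow> (\<Sum>i\<in>F. \<bar>c i k\<bar>) \<le> \<kappa>"
  shows "(\<Sum>i\<in>F. \<bar>\<Sum>\<^sub>\<infinity>k\<in>I. c i k * y k\<bar>) \<le> \<kappa> * (\<Sum>\<^sub>\<infinity>k\<in>I. \<bar>y k\<bar>)"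
proof -
  have ya: "(\<lambda>k. \<bar>y k\<bar>) summable_on I" using y by (simp add: summable_abs_iff)
  have s: "(\<lambda>k. c i k * y k) summable_on I" if "i \<in> F" for i
  proof (rule summable_bounded_mult[OF y])
    fix k assume "k \<in> I"
    have "\<bar>c i k\<bar> \<le> (\<Sum>i\<in>F. \<bar>c i k\<bar>)" using F that by (intro member_le_sum) auto
    then show "\<bar>c i k\<bar> \<le> \<kappa>" using c[OF \<open>k \<in> I\<close>] by simp
  qed
  have "(\<Sum>i\<in>F. \<bar>\<Sum>\<^sub>\<infinity>k\<in>I. c i k * y k\<bar>) \<le> (\<Sum>i\<in>F. \<Sum>\<^sub>\<infinity>k\<in>I. \<bar>c i k * y k\<bar>)"
    by (intro sum_mono abs_infsum_le s)
  also have "\<dots> = (\<Sum>\<^sub>\<infinity>k\<in>I. \<Sum>i\<in>F. \<bar>c i k * y k\<bar>)"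
    using infsum_swap_abs(1)[of F "\<lambda>i k. \<bar>c i k * y k\<bar>" I] F s by (simp add: summable_abs_iff)
  also have "\<dots> \<le> (\<Sum>\<^sub>\<infinity>k\<in>I. \<kappa> * \<bar>y k\<bar>)"
  proof (rule infsum_mono)
    show "(\<lambda>k. \<Sum>i\<in>F. \<bar>c i k * y k\<bar>) summable_on I"
      using infsum_swap_abs(3)[of F "\<lambda>i k. \<bar>c i k * y k\<bar>" I] F s by (simp add: summable_abs_iff)
    show "(\<lambda>k. \<kappa> * \<bar>y k\<bar>) summable_on I" using ya by (rule summable_on_cmult_right)
    fix k assume "k \<in> I"
    then have "(\<Sum>i\<in>F. \<bar>c i k\<bar>) * \<bar>y k\<bar> \<le> \<kappa> * \<bar>y k\<bar>" by (intro mult_right_mono c) auto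
    then show "(\<Sum>i\<in>F. \<bar>c i k * y k\<bar>) \<le> \<kappa> * \<bar>y k\<bar>" by (simp add: abs_mult sum_distrib_right)
  qed
  also have "\<dots> = \<kappa> * (\<Sum>\<^sub>\<infinity>k\<in>I. \<bar>y k\<bar>)" by (rule infsum_cmult_right) (use ya in auto)
  finally show ?thesis .
qed

lemma l1_norm_leI:
  assumes "\<And>F. \<lbrakk>finite F; F \<subseteq> I\<rbrakk> \<Longrightarrow> (\<Sum>i\<in>F. \<bar>x i\<bar>) \<le> C"
  shows "l1_norm I x \<le> ennreal C"
proof -
  have "l1_norm I x = (SUP F\<in>{F. finite F \<and> F \<subseteq> I}. \<Sum>i\<in>F. ennreal \<bar>x i\<bar>)"
    unfolding l1_norm_def by (rule nonneg_infsum_complete) simp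
  also have "\<dots> \<le> ennreal C"
  proof (rule SUP_least)
    fix F assume "F \<in> {F. finite F \<and> F \<subseteq> I}"
    then show "(\<Sum>i\<in>F. ennreal \<bar>x i\<bar>) \<le> ennreal C"
      using assms[of F] by (simp add: sum_ennreal ennreal_leI)
  qed
  finally show ?thesis .
qed

lemma l1_norm_finite_le:
  assumes "l1_norm I x \<le> ennreal C" "0 \<le> C" "finite F" "F \<subseteq> I"
  shows "(\<Sum>i\<in>F. \<bar>x i\<bar>) \<le> C"
proof -
  have "(\<Sum>i\<in>F. \<bar>x i\<bar>) \<le> (\<Sum>\<^sub>\<infinity>i\<in>I. \<bar>x i\<bar>)"
    using l1_norm_leD(1)[OF assms(1,2)] assms(3,4)
    by (intro finite_sum_le_infsum) (auto simp: summable_abs_iff)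
  then show ?thesis using l1_norm_leD(2)[OF assms(1,2)] by simp
qed

lemma l1_norm_diff_le:
  assumes "l1_norm I y \<le> ennreal C1" "0 \<le> C1" "l1_norm I z \<le> ennreal C2" "0 \<le> C2"
    and eq: "\<And>i. i \<in> I \<Longrightarrow> x i = y i - z i"
  shows "l1_norm I x \<le> ennreal (C1 + C2)"
proof (rule l1_norm_leI)
  fix F assume F: "finite F" "F \<subseteq> I"
  have "(\<Sum>i\<in>F. \<bar>x i\<bar>) \<le> (\<Sum>i\<in>F. \<bar>y i\<bar> + \<bar>z i\<bar>)"
    using eq F by (intro sum_mono) (metis abs_triangle_ineq4 subsetD)
  also have "\<dots> \<le> C1 + C2"
    unfolding sum.distrib by (intro add_mono l1_norm_finite_le[OF assms(1,2) F] l1_norm_finite_le[OF assms(3,4) F])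
  finally show "(\<Sum>i\<in>F. \<bar>x i\<bar>) \<le> C1 + C2" .
qed

lemma mat_norm_diff_le:
  assumes "mat_norm I Y \<le> ennreal C1" "0 \<le> C1" "mat_norm I Z \<le> ennreal C2" "0 \<le> C2"
    and eq: "\<And>i k. \<lbrakk>i \<in> I; k \<in> I\<rbrakk> \<Longrightarrow> X i k = Y i k - Z i k"
  shows "mat_norm I X \<le> ennreal (C1 + C2)"
proof -
  have col: "l1_norm I (\<lambda>i. M i k) \<le> ennreal C" if "mat_norm I M \<le> ennreal C" "k \<in> I" for M C k
    using that(1) unfolding mat_norm_def l1_norm_def
    by (rule order_trans[rotated]) (rule SUP_upper[OF that(2)])
  have "l1_norm I (\<lambda>i. X i k) \<le> ennreal (C1 + C2)" if k: "k \<in> I" for k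
    by (rule l1_norm_diff_le[OF col[OF assms(1) k] assms(2) col[OF assms(3) k] assms(4)]) (rule eq[OF _ k])
  then show ?thesis unfolding mat_norm_def l1_norm_def by (rule SUP_least)
qed

lemma mat_vec_diff:
  fixes X Y :: "nat \<Rightarrow> nat \<Rightarrow> real"
  assumes X: "\<And>k. k \<in> I \<Longrightarrow> \<bar>X i k\<bar> \<le> C" and y: "y summable_on I"
  shows "(\<lambda>k. X i k * y k) summable_on I"
    and "z summable_on I \<Longrightarrow> mat_vec I X (\<lambda>k. y k - z k) i = mat_vec I X y i - mat_vec I X z i"
    and "(\<And>k. k \<in> I \<Longrightarrow> \<bar>Y i k\<bar> \<le> C') \<Longrightarrow>
      mat_vec I (\<lambda>i k. X i k - Y i k) y i = mat_vec I X y i - mat_vec I Y y i"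
proof -
  show s: "(\<lambda>k. X i k * y k) summable_on I" by (rule summable_bounded_mult[OF y X])
  show "mat_vec I X (\<lambda>k. y k - z k) i = mat_vec I X y i - mat_vec I X z i" if z: "z summable_on I"
    unfolding mat_vec_def
    using infsum_add[OF s summable_on_uminus[THEN iffD2, OF summable_bounded_mult[where c = "X i", OF z X]]]
    by (simp add: infsum_uminus right_diff_distrib)
  show "mat_vec I (\<lambda>i k. X i k - Y i k) y i = mat_vec I X y i - mat_vec I Y y i"
    if Y: "\<And>k. k \<in> I \<Longrightarrow> \<bar>Y i k\<bar> \<le> C'"
    unfolding mat_vec_def
    using infsum_add[OF s summable_on_uminus[THEN iffD2, OF summable_bounded_mult[where c = "Y i", OF y Y]]]
    by (simp add: infsum_uminus left_diff_distrib)
qed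

text \<open>
The infimum that defines the decay rate is a genuine lower bound only because the column norms of
\<open>b\<close> bound the rates of the single columns from below.
\<close>

lemma log_norm_le:
  fixes I :: "nat set" and b :: "nat \<Rightarrow> nat \<Rightarrow> real"
  defines "\<alpha> \<equiv> \<lambda>i. - (b i i + (\<Sum>\<^sub>\<infinity>j\<in>I - {i}. \<bar>b j i\<bar>))"
  assumes b: "mat_norm I b \<le> ennreal N" "0 \<le> N" and k: "k \<in> I"
  shows "(INF i\<in>I. \<alpha> i) \<le> \<alpha> k" "(INF i\<in>I. \<alpha> i) \<le> N"
proof -
  have split: "(\<Sum>\<^sub>\<infinity>j\<in>I. \<bar>b j i\<bar>) = \<bar>b i i\<bar> + (\<Sum>\<^sub>\<infinity>j\<in>I - {i}. \<bar>b j i\<bar>)" if "i \<in> I" for i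
  proof -
    have s: "(\<lambda>j. \<bar>b j i\<bar>) summable_on I" using mat_norm_leD(1)[OF b that] by (simp add: summable_abs_iff)
    have "(\<Sum>\<^sub>\<infinity>j\<in>{i} \<union> (I - {i}). \<bar>b j i\<bar>) = (\<Sum>\<^sub>\<infinity>j\<in>{i}. \<bar>b j i\<bar>) + (\<Sum>\<^sub>\<infinity>j\<in>I - {i}. \<bar>b j i\<bar>)"
      by (rule infsum_Un_disjoint) (use s in \<open>auto intro: summable_on_subset_banach\<close>)
    moreover have "{i} \<union> (I - {i}) = I" using that by auto
    ultimately show ?thesis by simp
  qed
  have "- N \<le> \<alpha> i" if "i \<in> I" for i
    using mat_norm_leD(2)[OF b that] split[OF that] unfolding \<alpha>_def by linarith
  then have "bdd_below (\<alpha> ` I)" by (rule bdd_belowI2)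
  then show 1: "(INF i\<in>I. \<alpha> i) \<le> \<alpha> k" using k by (rule cINF_lower)
  have "0 \<le> (\<Sum>\<^sub>\<infinity>j\<in>I - {k}. \<bar>b j k\<bar>)" by (rule infsum_nonneg) auto
  then have "\<alpha> k \<le> N" using mat_norm_entry_le[OF b k k] unfolding \<alpha>_def by linarith
  then show "(INF i\<in>I. \<alpha> i) \<le> N" using 1 by simp
qed

text \<open>
The matrix \<open>N + b\<close> has a nonnegative diagonal, so the absolute sum of its \<open>k\<close>-th column is
\<open>N + b\<^sub>k\<^sub>k + \<Sum>\<^sub>j\<^sub>\<noteq>\<^sub>k \<bar>b\<^sub>j\<^sub>k\<bar> = N - \<alpha>\<^sub>k \<le> N - \<alpha>\<close>.
\<close>

lemma log_norm_dissipation: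
  fixes I :: "nat set" and b :: "nat \<Rightarrow> nat \<Rightarrow> real" and r y :: "nat \<Rightarrow> real"
  defines "\<alpha> \<equiv> (INF i\<in>I. - (b i i + (\<Sum>\<^sub>\<infinity>j\<in>I - {i}. \<bar>b j i\<bar>)))"
  assumes b: "mat_norm I b \<le> ennreal N" "0 \<le> N" and F: "finite F" "F \<subseteq> I" and y: "y summable_on I"
  shows "(\<Sum>i\<in>F. \<bar>N * y i + ((\<Sum>\<^sub>\<infinity>k\<in>I. b i k * y k) + r i)\<bar>)
           \<le> (N - \<alpha>) * (\<Sum>\<^sub>\<infinity>k\<in>I. \<bar>y k\<bar>) + (\<Sum>i\<in>F. \<bar>r i\<bar>)"
proof -
  define c where "c i k = (if i = k then N else 0) + b i k" for i k
  have eq: "N * y i + (\<Sum>\<^sub>\<infinity>k\<in>I. b i k * y k) = (\<Sum>\<^sub>\<infinity>k\<in>I. c i k * y k)" if i: "i \<in> F" for i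
  proof -
    have "(\<Sum>\<^sub>\<infinity>k\<in>I. c i k * y k) = (\<Sum>\<^sub>\<infinity>k\<in>I. (if i = k then N else 0) * y k + b i k * y k)"
      by (simp add: c_def algebra_simps)
    also have "\<dots> = (\<Sum>\<^sub>\<infinity>k\<in>I. (if i = k then N else 0) * y k) + (\<Sum>\<^sub>\<infinity>k\<in>I. b i k * y k)"
    proof (rule infsum_add)
      show "(\<lambda>k. b i k * y k) summable_on I"
        using mat_norm_entry_le[OF b] i F by (intro summable_bounded_mult[OF y, of _ N]) auto
      show "(\<lambda>k. (if i = k then N else 0) * y k) summable_on I"
        using b(2) by (intro summable_bounded_mult[OF y, of _ N]) auto
    qed
    also have "(\<Sum>\<^sub>\<infinity>k\<in>I. (if i = k then N else 0) * y k) = (\<Sum>\<^sub>\<infinity>k\<in>{i}. N * y k)"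
      by (rule infsum_cong_neutral) (use i F in auto)
    finally show ?thesis by simp
  qed
  have col: "(\<Sum>i\<in>F. \<bar>c i k\<bar>) \<le> N - \<alpha>" if k: "k \<in> I" for k :: nat
  proof -
    have s: "(\<lambda>j. \<bar>b j k\<bar>) summable_on I - {k}"
      using mat_norm_leD(1)[OF b k] by (auto simp: summable_abs_iff intro: summable_on_subset_banach)
    have "(\<Sum>i\<in>F. \<bar>c i k\<bar>) \<le> (\<Sum>i\<in>insert k F. \<bar>c i k\<bar>)" using F by (intro sum_mono2) auto
    also have "\<dots> = \<bar>c k k\<bar> + (\<Sum>i\<in>F - {k}. \<bar>c i k\<bar>)" by (rule sum.insert_remove[OF F(1)])
    also have "(\<Sum>i\<in>F - {k}. \<bar>c i k\<bar>) = (\<Sum>i\<in>F - {k}. \<bar>b i k\<bar>)" by (simp add: c_def)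
    also have "\<dots> \<le> (\<Sum>\<^sub>\<infinity>j\<in>I - {k}. \<bar>b j k\<bar>)" using s F by (intro finite_sum_le_infsum) auto
    also have "\<bar>c k k\<bar> = N + b k k" using mat_norm_entry_le[OF b k k] by (simp add: c_def)
    finally show ?thesis using log_norm_le(1)[OF b k] unfolding \<alpha>_def by linarith
  qed
  have "(\<Sum>i\<in>F. \<bar>N * y i + ((\<Sum>\<^sub>\<infinity>k\<in>I. b i k * y k) + r i)\<bar>) \<le> (\<Sum>i\<in>F. \<bar>\<Sum>\<^sub>\<infinity>k\<in>I. c i k * y k\<bar> + \<bar>r i\<bar>)"
  proof (rule sum_mono)
    fix i assume "i \<in> F"
    from eq[OF this] show "\<bar>N * y i + ((\<Sum>\<^sub>\<infinity>k\<in>I. b i k * y k) + r i)\<bar> \<le> \<bar>\<Sum>\<^sub>\<infinity>k\<in>I. c i k * y k\<bar> + \<bar>r i\<bar>"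
      by linarith
  qed
  then show ?thesis using column_bound_l1[of F y I c "N - \<alpha>"] F(1) y col by (simp add: sum.distrib)
qed


section \<open>Weighted tail sums\<close>

lemma pos_states_simps:
  "k \<in> pos_states S \<Longrightarrow> 1 \<le> k"
  "\<lbrakk>k \<in> pos_states S; 1 \<le> i; i \<le> k\<rbrakk> \<Longrightarrow> i \<in> pos_states S"
  "states S = insert 0 (pos_states S)"
  "pos_states S \<subseteq> states S"
proof -
  show "k \<in> pos_states S \<Longrightarrow> 1 \<le> k" by (simp add: pos_states_def)
  show "\<lbrakk>k \<in> pos_states S; 1 \<le> i; i \<le> k\<rbrakk> \<Longrightarrow> i \<in> pos_states S"
    unfolding pos_states_def by (metis (mono_tags, lifting) enat_ord_simps(1) mem_Collect_eq order_trans)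
  have "enat 0 \<le> S" by (metis i0_lb zero_enat_def)
  then show "states S = insert 0 (pos_states S)"
    unfolding states_def pos_states_def by (force simp: Suc_le_eq)
  then show "pos_states S \<subseteq> states S" by auto
qed

lemma zero_notin_pos_states: "0 \<notin> pos_states S"
  by (simp add: pos_states_def)

lemma infsum_states_split:
  fixes g :: "nat \<Rightarrow> real"
  assumes "g summable_on pos_states S"
  shows "(\<Sum>\<^sub>\<infinity>k\<in>states S. g k) = g 0 + (\<Sum>\<^sub>\<infinity>k\<in>pos_states S. g k)"
proof -
  have "(\<Sum>\<^sub>\<infinity>k\<in>{0} \<union> pos_states S. g k) = (\<Sum>\<^sub>\<infinity>k\<in>{0}. g k) + (\<Sum>\<^sub>\<infinity>k\<in>pos_states S. g k)"
    by (rule infsum_Un_disjoint) (use assms zero_notin_pos_states in auto)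
  then show ?thesis by (simp add: pos_states_simps(3))
qed

lemma summable_on_states_iff:
  fixes g :: "nat \<Rightarrow> real"
  shows "g summable_on states S \<longleftrightarrow> g summable_on pos_states S"
proof
  assume "g summable_on states S"
  then show "g summable_on pos_states S"
    by (rule summable_on_subset_banach) (rule pos_states_simps(4))
next
  assume "g summable_on pos_states S"
  then have "g summable_on {0} \<union> pos_states S"
    by (intro summable_on_Un_disjoint) (use zero_notin_pos_states in auto)
  then show "g summable_on states S" by (simp add: pos_states_simps(3))
qed

text \<open>
For a nonnegative vector, exchanging the order of summation gives
\<open>\<parallel>x\<parallel>\<^sub>1\<^sub>D = \<Sum>\<^sub>k (d\<^sub>1 + \<dots> + d\<^sub>k) x\<^sub>k\<close>.
\<close>

definition cum_weight :: "(nat \<Rightarrow> real) \<Rightarrow> nat \<Rightarrow> real" where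
  "cum_weight d k = (\<Sum>i=1..k. d i)"

abbreviation D_vec :: "enat \<Rightarrow> (nat \<Rightarrow> real) \<Rightarrow> (nat \<Rightarrow> real) \<Rightarrow> nat \<Rightarrow> real" where
  "D_vec S d x \<equiv> mat_vec (pos_states S) (D_mat d) x"

lemma infsum_D_mat_column:
  assumes k: "k \<in> states S"
  shows "(\<lambda>i. D_mat d i k * c i) summable_on pos_states S"
    "(\<Sum>\<^sub>\<infinity>i\<in>pos_states S. D_mat d i k * c i) = (\<Sum>i=1..k. d i * c i)"
proof -
  have sub: "{1..k} \<subseteq> pos_states S"
    using k pos_states_simps(2)[of k S] by (auto simp: pos_states_simps(3))
  have "((\<lambda>i. D_mat d i k * c i) has_sum (\<Sum>i=1..k. d i * c i)) {1..k}"
    by (rule has_sum_finiteI) (auto simp: D_mat_def)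
  then have "((\<lambda>i. D_mat d i k * c i) has_sum (\<Sum>i=1..k. d i * c i)) (pos_states S)"
    by (rule has_sum_cong_neutral[THEN iffD1, rotated -1])
       (use sub in \<open>auto simp: D_mat_def dest: pos_states_simps(1)\<close>)
  then show "(\<lambda>i. D_mat d i k * c i) summable_on pos_states S"
    "(\<Sum>\<^sub>\<infinity>i\<in>pos_states S. D_mat d i k * c i) = (\<Sum>i=1..k. d i * c i)"
    by (auto simp: summable_on_def infsumI)
qed

locale weights =
  fixes S :: enat and d :: "nat \<Rightarrow> real"
  assumes d_pos: "1 \<le> i \<Longrightarrow> 0 < d i"
begin

abbreviation I :: "nat set" where
  "I \<equiv> pos_states S"

lemma abs_D_mat [simp]: "i \<in> I \<Longrightarrow> \<bar>D_mat d i j\<bar> = D_mat d i j"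
  using d_pos[of i] pos_states_simps(1)[of i S] by (auto simp: D_mat_def)

lemma D_mat_le: "i \<in> I \<Longrightarrow> D_mat d i j \<le> d i"
  "i \<in> I \<Longrightarrow> 0 \<le> D_mat d i j"
  using d_pos[of i] pos_states_simps(1)[of i S] by (auto simp: D_mat_def)

lemma summable_D_mat_row:
  assumes "x summable_on I" "i \<in> I"
  shows "(\<lambda>j. D_mat d i j * x j) summable_on I"
  using summable_bounded_mult[OF assms(1), of "D_mat d i" "d i"] D_mat_le(1)[OF assms(2)] assms(2) by simp

lemma D_vec_diff:
  assumes "x summable_on I" "y summable_on I" "i \<in> I"
  shows "D_vec S d (\<lambda>j. x j - y j) i = D_vec S d x i - D_vec S d y i"
  unfolding mat_vec_def
  using infsum_add[OF summable_D_mat_row[OF assms(1,3)]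
      summable_on_uminus[THEN iffD2, OF summable_D_mat_row[OF assms(2,3)]]]
  by (simp add: infsum_uminus right_diff_distrib)

lemma abs_column_sum:
  assumes "j \<in> states S"
  shows "(\<Sum>\<^sub>\<infinity>i\<in>I. \<bar>D_mat d i j * x j\<bar>) = cum_weight d j * \<bar>x j\<bar>"
proof -
  have "(\<Sum>\<^sub>\<infinity>i\<in>I. \<bar>D_mat d i j * x j\<bar>) = (\<Sum>\<^sub>\<infinity>i\<in>I. D_mat d i j * \<bar>x j\<bar>)"
    by (rule infsum_cong) (simp add: abs_mult)
  also have "\<dots> = (\<Sum>i=1..j. d i * \<bar>x j\<bar>)" by (rule infsum_D_mat_column(2)[OF assms])
  finally show ?thesis by (simp add: cum_weight_def sum_distrib_right)
qed

lemma cum_weight_nonneg: "0 \<le> cum_weight d k"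
  unfolding cum_weight_def
proof (rule sum_nonneg)
  fix i assume "i \<in> {1..k}"
  then show "0 \<le> d i" using d_pos[of i] by simp
qed

lemma d1_le_cum_weight:
  assumes "1 \<le> k"
  shows "d 1 \<le> cum_weight d k"
  unfolding cum_weight_def
proof (rule member_le_sum)
  fix i assume "i \<in> {1..k} - {1}"
  then show "0 \<le> d i" using d_pos[of i] by simp
qed (use assms in auto)

text \<open>
Finiteness of \<open>\<Sum>\<^sub>k (d\<^sub>1 + \<dots> + d\<^sub>k) \<bar>x\<^sub>k\<bar>\<close> is stronger than finiteness of the weighted norm of a signed
vector. It is the hypothesis under which all rearrangements are legitimate, it holds for probability
vectors of finite weighted norm, and it passes to their differences.
\<close>

lemma weighted_summable:
  assumes x: "(\<lambda>k. cum_weight d k * \<bar>x k\<bar>) summable_on I"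
  shows "x summable_on I"
    and "D_vec S d x summable_on I"
    and "(\<Sum>\<^sub>\<infinity>i\<in>I. \<bar>D_vec S d x i\<bar>) \<le> (\<Sum>\<^sub>\<infinity>k\<in>I. cum_weight d k * \<bar>x k\<bar>)"
    and "(\<And>k. k \<in> I \<Longrightarrow> 0 \<le> x k) \<Longrightarrow>
         (\<Sum>\<^sub>\<infinity>i\<in>I. \<bar>D_vec S d x i\<bar>) = (\<Sum>\<^sub>\<infinity>k\<in>I. cum_weight d k * \<bar>x k\<bar>)"
    and "(\<Sum>\<^sub>\<infinity>i\<in>I. D_vec S d x i) = (\<Sum>\<^sub>\<infinity>k\<in>I. cum_weight d k * x k)"
proof -
  let ?f = "\<lambda>j i. D_mat d i j * x j"
  have 1: "\<forall>j\<in>I. ?f j summable_on I"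
  proof
    fix j assume "j \<in> I"
    then have "j \<in> states S" using pos_states_simps(4) by auto
    then show "?f j summable_on I" by (rule infsum_D_mat_column(1)[of j S d "\<lambda>_. x j"])
  qed
  have col: "(\<Sum>\<^sub>\<infinity>i\<in>I. \<bar>?f j i\<bar>) = cum_weight d j * \<bar>x j\<bar>" if "j \<in> I" for j
    by (rule abs_column_sum) (use that pos_states_simps(4) in auto)
  have 2: "(\<lambda>j. \<Sum>\<^sub>\<infinity>i\<in>I. \<bar>?f j i\<bar>) summable_on I"
    using x by (rule summable_on_cong[THEN iffD2, rotated]) (rule col)
  note swap = infsum_swap_abs[where f = ?f, OF 1 2]
  have "(\<Sum>\<^sub>\<infinity>i\<in>I. D_vec S d x i) = (\<Sum>\<^sub>\<infinity>j\<in>I. \<Sum>\<^sub>\<infinity>i\<in>I. ?f j i)"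
    unfolding mat_vec_def by (rule swap(1)[symmetric])
  also have "\<dots> = (\<Sum>\<^sub>\<infinity>k\<in>I. cum_weight d k * x k)"
  proof (rule infsum_cong)
    fix j assume "j \<in> I"
    then have "j \<in> states S" using pos_states_simps(4) by auto
    then show "(\<Sum>\<^sub>\<infinity>i\<in>I. ?f j i) = cum_weight d j * x j"
      by (simp add: infsum_D_mat_column(2)[of j S d "\<lambda>_. x j"] cum_weight_def sum_distrib_right)
  qed
  finally show "(\<Sum>\<^sub>\<infinity>i\<in>I. D_vec S d x i) = (\<Sum>\<^sub>\<infinity>k\<in>I. cum_weight d k * x k)" .
  show xs: "x summable_on I"
  proof (rule summable_on_abs_bound)
    show "(\<lambda>k. 1 / d 1 * (cum_weight d k * \<bar>x k\<bar>)) summable_on I"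
      using x by (rule summable_on_cmult_right)
    fix k assume "k \<in> I"
    then have "d 1 * \<bar>x k\<bar> \<le> cum_weight d k * \<bar>x k\<bar>"
      by (intro mult_right_mono d1_le_cum_weight pos_states_simps(1)[of k S]) auto
    then show "\<bar>x k\<bar> \<le> 1 / d 1 * (cum_weight d k * \<bar>x k\<bar>)"
      using d_pos[of 1] by (simp add: field_simps)
  qed
  show s: "D_vec S d x summable_on I" unfolding mat_vec_def[abs_def] by (rule swap(3))
  have "(\<Sum>\<^sub>\<infinity>j\<in>I. \<Sum>\<^sub>\<infinity>i\<in>I. \<bar>?f j i\<bar>) = (\<Sum>\<^sub>\<infinity>k\<in>I. cum_weight d k * \<bar>x k\<bar>)"
    by (rule infsum_cong) (rule col)
  with swap(6) have eq: "(\<Sum>\<^sub>\<infinity>i\<in>I. \<Sum>\<^sub>\<infinity>j\<in>I. \<bar>?f j i\<bar>) = (\<Sum>\<^sub>\<infinity>k\<in>I. cum_weight d k * \<bar>x k\<bar>)"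
    by (rule trans[OF sym])
  have le: "\<bar>D_vec S d x i\<bar> \<le> (\<Sum>\<^sub>\<infinity>j\<in>I. \<bar>?f j i\<bar>)" if "i \<in> I" for i
    unfolding mat_vec_def by (rule abs_infsum_le) (rule swap(4)[OF that])
  show "(\<Sum>\<^sub>\<infinity>i\<in>I. \<bar>D_vec S d x i\<bar>) \<le> (\<Sum>\<^sub>\<infinity>k\<in>I. cum_weight d k * \<bar>x k\<bar>)"
    unfolding eq[symmetric] by (rule infsum_mono[OF _ swap(5) le]) (use s in \<open>simp only: summable_abs_iff\<close>)
  show "(\<Sum>\<^sub>\<infinity>i\<in>I. \<bar>D_vec S d x i\<bar>) = (\<Sum>\<^sub>\<infinity>k\<in>I. cum_weight d k * \<bar>x k\<bar>)"
    if nn: "\<And>k. k \<in> I \<Longrightarrow> 0 \<le> x k"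
  proof -
    have "\<bar>D_vec S d x i\<bar> = (\<Sum>\<^sub>\<infinity>j\<in>I. \<bar>?f j i\<bar>)" if i: "i \<in> I" for i
    proof -
      have "(\<Sum>\<^sub>\<infinity>j\<in>I. \<bar>?f j i\<bar>) = D_vec S d x i"
        unfolding mat_vec_def using nn D_mat_le(2)[OF i] by (intro infsum_cong) (simp add: abs_mult)
      then show ?thesis using infsum_nonneg[of I "\<lambda>j. \<bar>?f j i\<bar>"] by simp
    qed
    then show ?thesis unfolding eq[symmetric] by (rule infsum_cong)
  qed
qed

text \<open>
For nonnegative vectors there are no cancellations, so bounded partial sums of the weighted tails
suffice.
\<close>

lemma weighted_summableI:
  assumes xs: "x summable_on I" and nn: "\<And>k. k \<in> I \<Longrightarrow> 0 \<le> x k"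
    and bnd: "\<And>F. \<lbrakk>finite F; F \<subseteq> I\<rbrakk> \<Longrightarrow> (\<Sum>i\<in>F. D_vec S d x i) \<le> C"
  shows "(\<lambda>k. cum_weight d k * \<bar>x k\<bar>) summable_on I"
    "(\<Sum>\<^sub>\<infinity>k\<in>I. cum_weight d k * \<bar>x k\<bar>) \<le> C"
proof -
  let ?f = "\<lambda>i j. D_mat d i j * x j"
  have eq: "(\<Sum>\<^sub>\<infinity>j\<in>I. \<bar>?f i j\<bar>) = D_vec S d x i" if i: "i \<in> I" for i
    unfolding mat_vec_def using nn D_mat_le(2)[OF i] by (intro infsum_cong) (simp add: abs_mult)
  have nn': "0 \<le> D_vec S d x i" if "i \<in> I" for i
    using eq[OF that] infsum_nonneg[of I "\<lambda>j. \<bar>?f i j\<bar>"] by simp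
  have Ds: "D_vec S d x summable_on I"
    by (intro nonneg_bdd_above_summable_on bdd_aboveI2[of _ _ C]) (use bnd nn' in auto)
  have 1: "\<forall>i\<in>I. ?f i summable_on I" using summable_D_mat_row[OF xs] by blast
  have 2: "(\<lambda>i. \<Sum>\<^sub>\<infinity>j\<in>I. \<bar>?f i j\<bar>) summable_on I"
    using Ds by (rule summable_on_cong[THEN iffD2, rotated]) (rule eq)
  note swap = infsum_swap_abs[where f = ?f, OF 1 2]
  have col: "(\<Sum>\<^sub>\<infinity>i\<in>I. \<bar>?f i j\<bar>) = cum_weight d j * \<bar>x j\<bar>" if "j \<in> I" for j
    by (rule abs_column_sum) (use that pos_states_simps(4) in auto)
  show "(\<lambda>k. cum_weight d k * \<bar>x k\<bar>) summable_on I"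
    using swap(5) by (rule summable_on_cong[THEN iffD1, rotated]) (rule col)
  have "(\<Sum>\<^sub>\<infinity>k\<in>I. cum_weight d k * \<bar>x k\<bar>) = (\<Sum>\<^sub>\<infinity>j\<in>I. \<Sum>\<^sub>\<infinity>i\<in>I. \<bar>?f i j\<bar>)"
    by (rule infsum_cong[symmetric]) (rule col)
  also have "\<dots> = (\<Sum>\<^sub>\<infinity>i\<in>I. \<Sum>\<^sub>\<infinity>j\<in>I. \<bar>?f i j\<bar>)" by (rule swap(6)[symmetric])
  also have "\<dots> = (\<Sum>\<^sub>\<infinity>i\<in>I. D_vec S d x i)" by (rule infsum_cong) (rule eq)
  also have "\<dots> \<le> C" by (rule infsum_le_finite_sums[OF Ds]) (use bnd in auto)
  finally show "(\<Sum>\<^sub>\<infinity>k\<in>I. cum_weight d k * \<bar>x k\<bar>) \<le> C" .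
qed

lemma l1D_weighted:
  assumes nn: "\<And>k. k \<in> I \<Longrightarrow> 0 \<le> x k" and xs: "x summable_on I"
  shows "x \<in> l1D S d \<longleftrightarrow> (\<lambda>k. cum_weight d k * \<bar>x k\<bar>) summable_on I"
proof
  assume "x \<in> l1D S d"
  then have fin: "l1_norm I (D_vec S d x) < \<infinity>" by (simp add: l1D_def norm1D_def)
  have s: "D_vec S d x summable_on I" by (rule l1_norm_finiteD[OF fin])
  have nn': "0 \<le> D_vec S d x i" if "i \<in> I" for i
    unfolding mat_vec_def using nn D_mat_le(2)[OF that] by (intro infsum_nonneg) auto
  show "(\<lambda>k. cum_weight d k * \<bar>x k\<bar>) summable_on I"
  proof (rule weighted_summableI[OF xs nn])
    fix F assume "finite F" "F \<subseteq> I"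
    then show "(\<Sum>i\<in>F. D_vec S d x i) \<le> infsum (D_vec S d x) I"
      using s nn' by (intro finite_sum_le_infsum) auto
  qed
next
  assume w: "(\<lambda>k. cum_weight d k * \<bar>x k\<bar>) summable_on I"
  show "x \<in> l1D S d"
    unfolding l1D_def norm1D_def l1_norm_eq[OF weighted_summable(2)[OF w]]
    using summable_D_mat_row[OF xs] by (simp add: l1_norm_eq[OF weighted_summable(2)[OF w]])
qed

lemma norm1D_eq:
  assumes "(\<lambda>k. cum_weight d k * \<bar>x k\<bar>) summable_on I"
  shows "norm1D S d x = ennreal (\<Sum>\<^sub>\<infinity>i\<in>I. \<bar>D_vec S d x i\<bar>)"
  unfolding norm1D_def by (rule l1_norm_eq[OF weighted_summable(2)[OF assms]])

end


section \<open>Generators acting on tail sums\<close>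

text \<open>
The properties of the transposed intensity matrix at a time where the row sums of the intensities
converge and are bounded by \<open>L\<close>.
\<close>

definition generator :: "enat \<Rightarrow> real \<Rightarrow> (nat \<Rightarrow> nat \<Rightarrow> real) \<Rightarrow> bool" where
  "generator S L A \<longleftrightarrow> (\<forall>k\<in>states S.
     (\<forall>j\<in>states S - {k}. 0 \<le> A j k) \<and>
     (\<lambda>j. A j k) summable_on (states S - {k}) \<and>
     A k k = - (\<Sum>\<^sub>\<infinity>j\<in>states S - {k}. A j k) \<and> \<bar>A k k\<bar> \<le> L)"

lemma generator_column:
  assumes A: "generator S L A" and k: "k \<in> states S"
  shows "(\<lambda>j. A j k) summable_on states S" "(\<Sum>\<^sub>\<infinity>j\<in>states S. A j k) = 0"
    "(\<Sum>\<^sub>\<infinity>j\<in>states S. \<bar>A j k\<bar>) \<le> 2 * L" "0 \<le> L"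
    "\<And>j. \<lbrakk>j \<in> states S; j \<noteq> k\<rbrakk> \<Longrightarrow> 0 \<le> A j k"
proof -
  note A' = A[unfolded generator_def, rule_format, OF k]
  show nn: "\<And>j. \<lbrakk>j \<in> states S; j \<noteq> k\<rbrakk> \<Longrightarrow> 0 \<le> A j k" and "0 \<le> L" using A' by auto
  have split: "f summable_on states S \<and> (\<Sum>\<^sub>\<infinity>j\<in>states S. f j) = f k + (\<Sum>\<^sub>\<infinity>j\<in>states S - {k}. f j)"
    if "f summable_on (states S - {k})" for f :: "nat \<Rightarrow> real"
    using summable_on_Un_disjoint[of f "{k}" "states S - {k}"] infsum_Un_disjoint[of f "{k}" "states S - {k}"] that
    by (simp add: insert_absorb[OF k])
  show "(\<lambda>j. A j k) summable_on states S" "(\<Sum>\<^sub>\<infinity>j\<in>states S. A j k) = 0"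
    using split[of "\<lambda>j. A j k"] A' by auto
  have "(\<Sum>\<^sub>\<infinity>j\<in>states S - {k}. \<bar>A j k\<bar>) = (\<Sum>\<^sub>\<infinity>j\<in>states S - {k}. A j k)"
    by (rule infsum_cong) (use nn in auto)
  then have "(\<Sum>\<^sub>\<infinity>j\<in>states S. \<bar>A j k\<bar>) = \<bar>A k k\<bar> - A k k"
    using split[of "\<lambda>j. \<bar>A j k\<bar>"] A' by (simp add: summable_abs_iff)
  then show "(\<Sum>\<^sub>\<infinity>j\<in>states S. \<bar>A j k\<bar>) \<le> 2 * L" using A' by linarith
qed

text \<open>
The entry is \<open>d\<^sub>i \<Sum>\<^sub>j\<^sub>\<ge>\<^sub>i a\<^sub>j\<^sub>k\<close>: the weighted rate at which state \<open>k\<close> feeds the set \<open>{i, i + 1, \<dots>}\<close>.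
\<close>

abbreviation tail_flow :: "enat \<Rightarrow> (nat \<Rightarrow> real) \<Rightarrow> (nat \<Rightarrow> nat \<Rightarrow> real) \<Rightarrow> nat \<Rightarrow> nat \<Rightarrow> real" where
  "tail_flow S d A \<equiv> mat_mult (pos_states S) (D_mat d) A"

lemma D_mat_0: "i \<in> pos_states S \<Longrightarrow> D_mat d i 0 = 0"
  using pos_states_simps(1)[of i S] by (simp add: D_mat_def)

context weights
begin

lemma tail_flow_eq_D_vec: "tail_flow S d X i k = D_vec S d (\<lambda>j. X j k) i"
  by (simp add: mat_mult_def mat_vec_def)

lemma conj_D_entry:
  assumes k: "k \<in> I"
  shows "conj_D S d X i k * d k = tail_flow S d X i k - (if k = 1 then 0 else tail_flow S d X i (k - 1))"
proof -
  have k1: "1 \<le> k" by (rule pos_states_simps(1)[OF k])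
  let ?F = "{k - 1, k} \<inter> I"
  have "conj_D S d X i k = (\<Sum>j\<in>?F. tail_flow S d X i j * Dinv_mat d j k)"
    unfolding conj_D_def mat_mult_def[of _ _ "Dinv_mat d"]
    by (rule infsum_pos_states_finite) (auto simp: Dinv_mat_def)
  also have "\<dots> * d k = tail_flow S d X i k - (if k = 1 then 0 else tail_flow S d X i (k - 1))"
  proof (cases "k = 1")
    case True
    then have "?F = {k}" using k zero_notin_pos_states by auto
    then show ?thesis using True d_pos[of k] by (simp add: Dinv_mat_def)
  next
    case False
    then have "k - 1 \<in> I" using k k1 by (intro pos_states_simps(2)[OF k]) auto
    then have F: "?F = {k - 1, k}" "k - 1 \<noteq> k" using k k1 by auto
    have "(\<Sum>j\<in>?F. tail_flow S d X i j * Dinv_mat d j k) = tail_flow S d X i (k - 1) * (- 1 / d k) + tail_flow S d X i k * (1 / d k)"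
      unfolding F(1) using F(2) k1 by (simp add: Dinv_mat_def)
    then show ?thesis using False d_pos[OF k1] by (simp add: field_simps)
  qed
  finally show ?thesis .
qed

lemma D_mat_row_summable:
  assumes "y summable_on states S" "i \<in> I"
  shows "(\<lambda>j. D_mat d i j * y j) summable_on I"
  using summable_D_mat_row[where x = y] assms by (simp add: summable_on_states_iff)

text \<open>
In column form: the entries of \<open>B\<^sup>*\<^sup>*\<close> are the increments of the tail flow from one state to the
next, since right multiplication by \<open>D\<^sup>-\<^sup>1\<close> takes differences of neighbouring columns. The
subtracted column \<open>a\<^sub>i\<^sub>0\<close> cancels, except in the first difference, where it supplies the term for
state 0.
\<close>

lemma conj_D_B:
  assumes A: "generator S L A" and i: "i \<in> I" and k: "k \<in> I"
  shows "conj_D S d (\<lambda>i j. A i j - A i 0) i k * d k = tail_flow S d A i k - tail_flow S d A i (k - 1)"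
proof -
  have st: "j \<in> states S" if "j \<le> k" for j
    using pos_states_simps(2)[OF k, of j] that pos_states_simps(3)[of S] by (cases "j = 0") auto
  have sum0: "(\<lambda>i. A i j) summable_on states S" if "j \<le> k" for j
    by (rule generator_column(1)[OF A st[OF that]])
  have "tail_flow S d (\<lambda>i j. A i j - A i 0) i j = tail_flow S d A i j - tail_flow S d A i 0" if "j \<le> k" for j
    unfolding tail_flow_eq_D_vec using sum0[OF that] sum0[of 0]
    by (intro D_vec_diff i) (simp_all add: summable_on_states_iff)
  then show ?thesis by (subst conj_D_entry[OF k]) auto
qed

lemma tail_flow_telescope:
  assumes A: "generator S L A" and i: "i \<in> I" and k: "k \<in> states S"
  shows "tail_flow S d A i k = tail_flow S d A i 0 + (\<Sum>m=1..k. d m * conj_D S d (\<lambda>i j. A i j - A i 0) i m)"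
  using k
proof (induction k)
  case (Suc k)
  have Sk: "Suc k \<in> I" using Suc.prems by (simp add: pos_states_simps(3))
  then have "k \<in> states S" using pos_states_simps(2)[OF Sk, of k] by (cases "k = 0") (auto simp: pos_states_simps(3))
  then show ?case using Suc.IH conj_D_B[OF A i Sk] by (simp add: algebra_simps)
qed simp

lemma tail_flow_abs_bound:
  assumes A: "generator S L A" and i: "i \<in> I" and k: "k \<in> states S"
  shows "(\<Sum>\<^sub>\<infinity>j\<in>I. \<bar>D_mat d i j * A j k\<bar>) \<le> d i * (2 * L)" "\<bar>tail_flow S d A i k\<bar> \<le> d i * (2 * L)"
proof -
  note s = generator_column(1)[OF A k]
  have sa: "(\<lambda>j. \<bar>A j k\<bar>) summable_on states S" using s by (simp add: summable_abs_iff)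
  have di: "0 \<le> d i" using d_pos[OF pos_states_simps(1)[OF i]] by simp
  have sI: "(\<lambda>j. \<bar>A j k\<bar>) summable_on I" using sa summable_on_states_iff by blast
  have "(\<Sum>\<^sub>\<infinity>j\<in>I. \<bar>D_mat d i j * A j k\<bar>) \<le> (\<Sum>\<^sub>\<infinity>j\<in>I. d i * \<bar>A j k\<bar>)"
  proof (rule infsum_mono)
    show "(\<lambda>j. \<bar>D_mat d i j * A j k\<bar>) summable_on I"
      using D_mat_row_summable[OF s i] by (simp add: summable_abs_iff)
    show "(\<lambda>j. d i * \<bar>A j k\<bar>) summable_on I" using sI by (rule summable_on_cmult_right)
    show "\<bar>D_mat d i j * A j k\<bar> \<le> d i * \<bar>A j k\<bar>" for j
      using di by (auto simp: D_mat_def abs_mult)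
  qed
  also have "\<dots> = d i * (\<Sum>\<^sub>\<infinity>j\<in>I. \<bar>A j k\<bar>)" by (rule infsum_cmult_right) (use sI in auto)
  also have "\<dots> \<le> d i * (2 * L)"
  proof (rule mult_left_mono[OF _ di])
    have "(\<Sum>\<^sub>\<infinity>j\<in>I. \<bar>A j k\<bar>) \<le> (\<Sum>\<^sub>\<infinity>j\<in>states S. \<bar>A j k\<bar>)"
      by (rule infsum_mono2[OF sI sa pos_states_simps(4)]) auto
    then show "(\<Sum>\<^sub>\<infinity>j\<in>I. \<bar>A j k\<bar>) \<le> 2 * L" using generator_column(3)[OF A k] by simp
  qed
  finally show 1: "(\<Sum>\<^sub>\<infinity>j\<in>I. \<bar>D_mat d i j * A j k\<bar>) \<le> d i * (2 * L)" .
  have "\<bar>tail_flow S d A i k\<bar> \<le> (\<Sum>\<^sub>\<infinity>j\<in>I. \<bar>D_mat d i j * A j k\<bar>)"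
    unfolding mat_mult_def by (rule abs_infsum_le[OF D_mat_row_summable[OF s i]])
  then show "\<bar>tail_flow S d A i k\<bar> \<le> d i * (2 * L)" using 1 by simp
qed

text \<open>
Column sums of a generator vanish. From a state inside the set \<open>{i, i + 1, \<dots>}\<close> probability can only
leave it, so the net flow into it is not positive.
\<close>

lemma tail_flow_nonpos:
  assumes A: "generator S L A" and i: "i \<in> I" and k: "k \<in> states S" and ik: "i \<le> k"
  shows "tail_flow S d A i k \<le> 0"
proof -
  note s = generator_column(1)[OF A k]
  have di: "0 \<le> d i" using d_pos[OF pos_states_simps(1)[OF i]] by simp
  have "tail_flow S d A i k = (\<Sum>\<^sub>\<infinity>j\<in>states S. D_mat d i j * A j k)"
    unfolding mat_mult_def using infsum_states_split[OF D_mat_row_summable[OF s i]] D_mat_0[OF i] by simp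
  also have "\<dots> \<le> (\<Sum>\<^sub>\<infinity>j\<in>states S. d i * A j k)"
  proof (rule infsum_mono)
    show "(\<lambda>j. D_mat d i j * A j k) summable_on states S"
      using D_mat_row_summable[OF s i] by (simp add: summable_on_states_iff)
    show "(\<lambda>j. d i * A j k) summable_on states S" using s by (rule summable_on_cmult_right)
    fix j assume "j \<in> states S"
    then show "D_mat d i j * A j k \<le> d i * A j k"
      using generator_column(5)[OF A k, of j] di ik by (auto simp: D_mat_def)
  qed
  also have "\<dots> = d i * (\<Sum>\<^sub>\<infinity>j\<in>states S. A j k)" by (rule infsum_cmult_right) (use s in auto)
  finally show ?thesis using generator_column(2)[OF A k] by simp
qed

text \<open>
The derivative of a weighted tail sum along the forward equation; only \<open>l\<^sub>1\<close> is needed for this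
exchange of summation.
\<close>

lemma D_vec_generator:
  assumes A: "generator S L A" and i: "i \<in> I" and x: "x summable_on states S"
  shows "mat_vec (states S) A x summable_on I"
    "D_vec S d (mat_vec (states S) A x) i = (\<Sum>\<^sub>\<infinity>k\<in>states S. tail_flow S d A i k * x k)"
proof -
  have xa: "(\<lambda>k. \<bar>x k\<bar>) summable_on states S" using x by (simp add: summable_abs_iff)
  have 1: "\<forall>k\<in>states S. (\<lambda>j. A j k * x k) summable_on states S"
    using generator_column(1)[OF A] by (auto intro: summable_on_cmult_left)
  have "(\<lambda>k. \<Sum>\<^sub>\<infinity>j\<in>states S. \<bar>A j k * x k\<bar>) summable_on states S"
  proof (rule summable_on_abs_bound)
    show "(\<lambda>k. 2 * L * \<bar>x k\<bar>) summable_on states S" using xa by (rule summable_on_cmult_right)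
    fix k assume k: "k \<in> states S"
    have s: "(\<lambda>j. \<bar>A j k\<bar>) summable_on states S" using generator_column(1)[OF A k] by (simp add: summable_abs_iff)
    have "(\<Sum>\<^sub>\<infinity>j\<in>states S. \<bar>A j k * x k\<bar>) = (\<Sum>\<^sub>\<infinity>j\<in>states S. \<bar>A j k\<bar>) * \<bar>x k\<bar>"
      unfolding abs_mult by (rule infsum_cmult_left) (use s in auto)
    also have "\<dots> \<le> 2 * L * \<bar>x k\<bar>" by (intro mult_right_mono generator_column(3)[OF A k]) auto
    finally show "\<bar>\<Sum>\<^sub>\<infinity>j\<in>states S. \<bar>A j k * x k\<bar>\<bar> \<le> 2 * L * \<bar>x k\<bar>"
      by (subst abs_of_nonneg) (auto intro: infsum_nonneg)
  qed
  note sw = infsum_swap_abs[where f = "\<lambda>k j. A j k * x k", OF 1 this]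
  have vs: "mat_vec (states S) A x summable_on states S" unfolding mat_vec_def[abs_def] by (rule sw(3))
  then show v: "mat_vec (states S) A x summable_on I" by (simp add: summable_on_states_iff)
  have di: "0 \<le> d i" using d_pos[OF pos_states_simps(1)[OF i]] by simp
  let ?f = "\<lambda>k j. D_mat d i j * A j k * x k"
  have 2: "\<forall>k\<in>states S. ?f k summable_on I"
    by (intro ballI summable_on_cmult_left D_mat_row_summable[OF generator_column(1)[OF A] i])
  have "(\<lambda>k. \<Sum>\<^sub>\<infinity>j\<in>I. \<bar>?f k j\<bar>) summable_on states S"
  proof (rule summable_on_abs_bound)
    show "(\<lambda>k. d i * (2 * L) * \<bar>x k\<bar>) summable_on states S" using xa by (rule summable_on_cmult_right)
    fix k assume k: "k \<in> states S"
    have s: "(\<lambda>j. \<bar>D_mat d i j * A j k\<bar>) summable_on I"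
      using D_mat_row_summable[OF generator_column(1)[OF A k] i] by (simp add: summable_abs_iff)
    have "(\<Sum>\<^sub>\<infinity>j\<in>I. \<bar>?f k j\<bar>) = (\<Sum>\<^sub>\<infinity>j\<in>I. \<bar>D_mat d i j * A j k\<bar>) * \<bar>x k\<bar>"
      unfolding abs_mult[of _ "x k"] by (rule infsum_cmult_left) (use s in auto)
    also have "\<dots> \<le> d i * (2 * L) * \<bar>x k\<bar>" by (intro mult_right_mono tail_flow_abs_bound(1)[OF A i k]) auto
    finally show "\<bar>\<Sum>\<^sub>\<infinity>j\<in>I. \<bar>?f k j\<bar>\<bar> \<le> d i * (2 * L) * \<bar>x k\<bar>"
      by (subst abs_of_nonneg) (auto intro: infsum_nonneg)
  qed
  note sw2 = infsum_swap_abs[where f = ?f, OF 2 this]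
  have "D_vec S d (mat_vec (states S) A x) i = (\<Sum>\<^sub>\<infinity>j\<in>I. \<Sum>\<^sub>\<infinity>k\<in>states S. ?f k j)"
    unfolding mat_vec_def by (intro infsum_cong) (simp add: infsum_cmult_right' mult.assoc)
  also have "\<dots> = (\<Sum>\<^sub>\<infinity>k\<in>states S. \<Sum>\<^sub>\<infinity>j\<in>I. ?f k j)" by (rule sw2(1)[symmetric])
  also have "\<dots> = (\<Sum>\<^sub>\<infinity>k\<in>states S. tail_flow S d A i k * x k)"
    unfolding mat_mult_def by (intro infsum_cong) (simp add: infsum_cmult_left')
  finally show "D_vec S d (mat_vec (states S) A x) i = (\<Sum>\<^sub>\<infinity>k\<in>states S. tail_flow S d A i k * x k)" .
qed

text \<open>
The forward equation in tail coordinates: \<open>D A x = B\<^sup>*\<^sup>* D x\<close> plus the total mass times \<open>D f\<close>. The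
proof writes the tail flow as a telescoping sum of entries of \<open>B\<^sup>*\<^sup>*\<close> and exchanges summation, which
turns the cumulative sums over \<open>m \<le> k\<close> into tail sums of \<open>x\<close>.
\<close>

lemma tail_flow_summation_by_parts:
  assumes A: "generator S L A" and i: "i \<in> I"
    and w: "(\<lambda>k. cum_weight d k * \<bar>x k\<bar>) summable_on I"
  defines "b \<equiv> conj_D S d (\<lambda>i j. A i j - A i 0)"
  assumes C: "\<And>m. m \<in> I \<Longrightarrow> \<bar>b i m\<bar> \<le> C"
  shows "(\<Sum>\<^sub>\<infinity>k\<in>states S. tail_flow S d A i k * x k)
     = tail_flow S d A i 0 * (\<Sum>\<^sub>\<infinity>k\<in>states S. x k) + (\<Sum>\<^sub>\<infinity>m\<in>I. b i m * D_vec S d x m)"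
proof -
  let ?f = "\<lambda>k m. D_mat d m k * (b i m * x k)"
  note xs = weighted_summable(1)[OF w]
  have st: "k \<in> states S" if "k \<in> I" for k using that pos_states_simps(4) by auto
  have 1: "\<forall>k\<in>I. ?f k summable_on I"
  proof
    fix k assume "k \<in> I"
    show "?f k summable_on I" by (rule infsum_D_mat_column(1)[OF st[OF \<open>k \<in> I\<close>]])
  qed
  have 2: "(\<lambda>k. \<Sum>\<^sub>\<infinity>m\<in>I. \<bar>?f k m\<bar>) summable_on I"
  proof (rule summable_on_abs_bound)
    show "(\<lambda>k. C * (cum_weight d k * \<bar>x k\<bar>)) summable_on I" using w by (rule summable_on_cmult_right)
    fix k assume k: "k \<in> I"
    have "(\<Sum>\<^sub>\<infinity>m\<in>I. \<bar>?f k m\<bar>) = (\<Sum>\<^sub>\<infinity>m\<in>I. D_mat d m k * (\<bar>b i m\<bar> * \<bar>x k\<bar>))"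
      by (rule infsum_cong) (simp add: abs_mult abs_D_mat)
    also have "\<dots> = (\<Sum>m=1..k. d m * (\<bar>b i m\<bar> * \<bar>x k\<bar>))" by (rule infsum_D_mat_column(2)[OF st[OF k]])
    also have "\<dots> \<le> (\<Sum>m=1..k. d m * (C * \<bar>x k\<bar>))"
    proof (rule sum_mono)
      fix m assume m: "m \<in> {1..k}"
      have "\<bar>b i m\<bar> \<le> C" by (rule C, rule pos_states_simps(2)[OF k]) (use m in auto)
      moreover have "0 \<le> d m" using d_pos[of m] m by simp
      ultimately show "d m * (\<bar>b i m\<bar> * \<bar>x k\<bar>) \<le> d m * (C * \<bar>x k\<bar>)"
        by (intro mult_left_mono mult_right_mono) auto
    qed
    also have "\<dots> = C * (cum_weight d k * \<bar>x k\<bar>)"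
      by (simp add: cum_weight_def sum_distrib_left sum_distrib_right mult_ac)
    finally show "\<bar>\<Sum>\<^sub>\<infinity>m\<in>I. \<bar>?f k m\<bar>\<bar> \<le> C * (cum_weight d k * \<bar>x k\<bar>)"
      by (subst abs_of_nonneg) (auto intro: infsum_nonneg)
  qed
  note sw = infsum_swap_abs[where f = ?f, OF 1 2]
  have inner: "tail_flow S d A i k * x k = tail_flow S d A i 0 * x k + (\<Sum>\<^sub>\<infinity>m\<in>I. ?f k m)" if k: "k \<in> I" for k
  proof -
    have "(\<Sum>\<^sub>\<infinity>m\<in>I. ?f k m) = (\<Sum>m=1..k. d m * (b i m * x k))" by (rule infsum_D_mat_column(2)[OF st[OF k]])
    also have "\<dots> = (\<Sum>m=1..k. d m * b i m) * x k" by (simp add: sum_distrib_right mult.assoc)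
    finally show ?thesis using tail_flow_telescope[OF A i st[OF k]] by (simp add: b_def distrib_right)
  qed
  have s0: "(\<lambda>k. tail_flow S d A i 0 * x k) summable_on I" using xs by (rule summable_on_cmult_right)
  have sI: "(\<lambda>k. tail_flow S d A i k * x k) summable_on I"
    by (rule summable_on_cong[THEN iffD2, OF inner]) (auto intro: summable_on_add s0 sw(2))
  have "(\<Sum>\<^sub>\<infinity>k\<in>I. tail_flow S d A i k * x k) = (\<Sum>\<^sub>\<infinity>k\<in>I. tail_flow S d A i 0 * x k + (\<Sum>\<^sub>\<infinity>m\<in>I. ?f k m))"
    by (rule infsum_cong) (rule inner)
  also have "\<dots> = (\<Sum>\<^sub>\<infinity>k\<in>I. tail_flow S d A i 0 * x k) + (\<Sum>\<^sub>\<infinity>k\<in>I. \<Sum>\<^sub>\<infinity>m\<in>I. ?f k m)"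
    by (rule infsum_add[OF s0 sw(2)])
  also have "(\<Sum>\<^sub>\<infinity>k\<in>I. tail_flow S d A i 0 * x k) = tail_flow S d A i 0 * (\<Sum>\<^sub>\<infinity>k\<in>I. x k)"
    by (rule infsum_cmult_right) (use xs in auto)
  also have "(\<Sum>\<^sub>\<infinity>k\<in>I. \<Sum>\<^sub>\<infinity>m\<in>I. ?f k m) = (\<Sum>\<^sub>\<infinity>m\<in>I. \<Sum>\<^sub>\<infinity>k\<in>I. ?f k m)" by (rule sw(1))
  also have "\<dots> = (\<Sum>\<^sub>\<infinity>m\<in>I. b i m * D_vec S d x m)"
  proof (rule infsum_cong)
    fix m
    have "(\<Sum>\<^sub>\<infinity>k\<in>I. ?f k m) = (\<Sum>\<^sub>\<infinity>k\<in>I. b i m * (D_mat d m k * x k))"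
      by (rule infsum_cong) simp
    then show "(\<Sum>\<^sub>\<infinity>k\<in>I. ?f k m) = b i m * D_vec S d x m" by (simp add: mat_vec_def infsum_cmult_right')
  qed
  finally show ?thesis
    using infsum_states_split[OF sI] infsum_states_split[OF xs] by (simp add: algebra_simps)
qed

text \<open>
The drift condition for the weight \<open>d\<^sub>1 + \<dots> + d\<^bsub>min k n\<^esub>\<close>. For \<open>k \<le> n\<close> it comes from the column
norms of \<open>B\<^sup>*\<^sup>*\<close> and the norm of \<open>f\<close>. For \<open>k > n\<close> the weight is maximal at \<open>k\<close> and the chain
can only lower it. The constants do not depend on \<open>n\<close>.
\<close>

lemma tail_flow_truncated_drift:
  fixes n :: nat
  assumes A: "generator S L A" and k: "k \<in> states S"
  defines "b \<equiv> conj_D S d (\<lambda>i j. A i j - A i 0)" and "F \<equiv> {1..n} \<inter> I"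
  assumes b: "mat_norm I b \<le> ennreal C" "0 \<le> C"
    and f: "l1_norm I (\<lambda>i. tail_flow S d A i 0) \<le> ennreal c" "0 \<le> c"
  shows "(\<Sum>i\<in>F. tail_flow S d A i k) \<le> c + C * (\<Sum>i\<in>F. D_mat d i k)"
proof -
  have F: "finite F" "F \<subseteq> I" by (auto simp: F_def)
  have D0: "0 \<le> (\<Sum>i\<in>F. D_mat d i k)"
    using F D_mat_le(2) by (intro sum_nonneg) auto
  show ?thesis
  proof (cases "k \<le> n")
    case False
    have "(\<Sum>i\<in>F. tail_flow S d A i k) \<le> 0"
      using tail_flow_nonpos[OF A _ k] False by (intro sum_nonpos) (auto simp: F_def)
    also have "0 \<le> c + C * (\<Sum>i\<in>F. D_mat d i k)" using D0 f b by simp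
    finally show ?thesis .
  next
    case True
    have kI: "m \<in> I" if "m \<in> {1..k}" for m
      using that k pos_states_simps(2)[of k S m] by (auto simp: pos_states_simps(3))
    have "(\<Sum>i\<in>F. tail_flow S d A i k) = (\<Sum>i\<in>F. tail_flow S d A i 0) + (\<Sum>i\<in>F. \<Sum>m=1..k. d m * b i m)"
      using tail_flow_telescope[OF A _ k] F by (auto simp: b_def simp flip: sum.distrib intro!: sum.cong)
    also have "(\<Sum>i\<in>F. \<Sum>m=1..k. d m * b i m) = (\<Sum>m=1..k. d m * (\<Sum>i\<in>F. b i m))"
      by (subst sum.swap) (simp add: sum_distrib_left)
    also have "\<dots> \<le> (\<Sum>m=1..k. d m * C)"
    proof (rule sum_mono)
      fix m assume m: "m \<in> {1..k}"
      have "(\<Sum>i\<in>F. b i m) \<le> (\<Sum>i\<in>F. \<bar>b i m\<bar>)" by (rule sum_mono) simp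
      also have "\<dots> \<le> C" by (rule mat_norm_finite_le[OF b kI[OF m] F])
      finally show "d m * (\<Sum>i\<in>F. b i m) \<le> d m * C" using d_pos[of m] m by (intro mult_left_mono) auto
    qed
    also have "\<dots> = C * (\<Sum>i\<in>F. D_mat d i k)"
    proof -
      have "(\<Sum>i\<in>F. D_mat d i k) = (\<Sum>i\<in>{1..k}. d i)"
        by (rule sum.mono_neutral_cong_right) (use True kI F in \<open>auto simp: F_def D_mat_def\<close>)
      then show ?thesis by (simp add: sum_distrib_left mult.commute)
    qed
    also have "(\<Sum>i\<in>F. tail_flow S d A i 0) \<le> c"
    proof -
      note l = l1_norm_leD[OF f]
      have "(\<Sum>i\<in>F. tail_flow S d A i 0) \<le> (\<Sum>i\<in>F. \<bar>tail_flow S d A i 0\<bar>)" by (rule sum_mono) simp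
      also have "\<dots> \<le> (\<Sum>\<^sub>\<infinity>i\<in>I. \<bar>tail_flow S d A i 0\<bar>)"
        by (rule finite_sum_le_infsum) (use l F in \<open>auto simp: summable_abs_iff\<close>)
      finally show ?thesis using l(2) by simp
    qed
    finally show ?thesis by simp
  qed
qed

end


section \<open>The forward system in tail coordinates\<close>

lemma summable_pmf: "pmf p summable_on A"
  using pmf_abs_summable[of p A] unfolding abs_summable_equivalent[symmetric]
  by (simp add: summable_abs_iff)

lemma infsum_pmf_eq_1:
  assumes "set_pmf p \<subseteq> A"
  shows "(\<Sum>\<^sub>\<infinity>i\<in>A. pmf p i) = 1"
  using infsetsum_pmf_eq_1[OF assms] infsetsum_infsum[OF pmf_abs_summable, of p A] by simp

abbreviation drift ::
  "enat \<Rightarrow> (nat \<Rightarrow> real) \<Rightarrow> (nat \<Rightarrow> nat \<Rightarrow> real \<Rightarrow> real) \<Rightarrow> (real \<Rightarrow> nat pmf) \<Rightarrow> real \<Rightarrow> nat \<Rightarrow> real" where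
  "drift S d q p t i \<equiv> (\<Sum>\<^sub>\<infinity>k\<in>states S. tail_flow S d (A_mat S q t) i k * pmf (p t) k)"

lemma D_vec_cmult: "D_vec S d (\<lambda>j. x j / h) i = D_vec S d x i / h"
  unfolding mat_vec_def times_divide_eq_right divide_inverse
  by (simp add: infsum_cmult_left' flip: mult.assoc)

lemma forward_solution_later:
  assumes fs: "forward_solution S q s p" and "s \<le> s'"
  shows "forward_solution S q s' p"
proof -
  have "l1_abs_continuous_on (states S) s' T (\<lambda>t. pmf (p t))" if "s' \<le> T" for T
    unfolding l1_abs_continuous_on_def
  proof (intro allI impI)
    fix \<epsilon> :: real assume "0 < \<epsilon>"
    moreover have "l1_abs_continuous_on (states S) s T (\<lambda>t. pmf (p t))"
      using fs that assms(2) by (simp add: forward_solution_def)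
    ultimately obtain \<delta> where "0 < \<delta>" and \<delta>: "\<forall>(n::nat) a b.
        (\<forall>k<n. s \<le> a k \<and> a k \<le> b k \<and> b k \<le> T) \<longrightarrow>
        (\<forall>k<n. \<forall>l<n. k \<noteq> l \<longrightarrow> {a k<..<b k} \<inter> {a l<..<b l} = {}) \<longrightarrow>
        (\<Sum>k<n. b k - a k) < \<delta> \<longrightarrow>
        (\<Sum>k<n. l1_norm (states S) (\<lambda>i. pmf (p (b k)) i - pmf (p (a k)) i)) < ennreal \<epsilon>"
      unfolding l1_abs_continuous_on_def by blast
    show "\<exists>\<delta>>0. \<forall>(n::nat) a b.
        (\<forall>k<n. s' \<le> a k \<and> a k \<le> b k \<and> b k \<le> T) \<longrightarrow>
        (\<forall>k<n. \<forall>l<n. k \<noteq> l \<longrightarrow> {a k<..<b k} \<inter> {a l<..<b l} = {}) \<longrightarrow>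
        (\<Sum>k<n. b k - a k) < \<delta> \<longrightarrow>
        (\<Sum>k<n. l1_norm (states S) (\<lambda>i. pmf (p (b k)) i - pmf (p (a k)) i)) < ennreal \<epsilon>"
    proof (intro exI[of _ \<delta>] conjI allI impI)
      fix n :: nat and a b
      assume 1: "\<forall>k<n. s' \<le> a k \<and> a k \<le> b k \<and> b k \<le> T"
        and 2: "\<forall>k<n. \<forall>l<n. k \<noteq> l \<longrightarrow> {a k<..<b k} \<inter> {a l<..<b l} = {}"
        and 3: "(\<Sum>k<n. b k - a k) < \<delta>"
      have "\<forall>k<n. s \<le> a k \<and> a k \<le> b k \<and> b k \<le> T" using 1 assms(2) by force
      then show "(\<Sum>k<n. l1_norm (states S) (\<lambda>i. pmf (p (b k)) i - pmf (p (a k)) i)) < ennreal \<epsilon>"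
        using \<delta>[rule_format, of n a b] 2 3 by blast
    qed fact
  qed
  moreover have "AE t in lebesgue. s' < t \<longrightarrow>
        has_l1_derivative (states S) (\<lambda>t. pmf (p t)) (mat_vec (states S) (A_mat S q t) (pmf (p t))) t"
    using fs assms(2) unfolding forward_solution_def by (auto elim!: eventually_mono)
  ultimately show ?thesis using fs assms(2) unfolding forward_solution_def by auto
qed

lemma AE_generator:
  assumes "bounded_intensities S q"
  obtains L where "AE t in lebesgue. 0 \<le> t \<longrightarrow> generator S L (A_mat S q t)"
proof -
  from assms obtain L where nn: "\<And>i j t. \<lbrakk>i \<in> states S; j \<in> states S; i \<noteq> j; 0 \<le> t\<rbrakk> \<Longrightarrow> 0 \<le> q i j t"
    and L: "AE t in lebesgue. 0 \<le> t \<longrightarrow>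
        (\<forall>i\<in>states S. (\<lambda>k. q i k t) summable_on (states S - {i}) \<and> \<bar>A_mat S q t i i\<bar> \<le> L)"
    unfolding bounded_intensities_def by blast
  from L have "AE t in lebesgue. 0 \<le> t \<longrightarrow> generator S L (A_mat S q t)"
  proof eventually_elim
    case (elim t)
    show ?case unfolding generator_def
    proof (intro impI ballI)
      fix k assume t: "0 \<le> t" and k: "k \<in> states S"
      have off: "A_mat S q t j k = q k j t" if "j \<in> states S - {k}" for j
        using that by (simp add: A_mat_def)
      have "(\<lambda>j. A_mat S q t j k) summable_on (states S - {k})"
        using elim t k by (subst summable_on_cong[OF off]) auto
      moreover have "A_mat S q t k k = - (\<Sum>\<^sub>\<infinity>j\<in>states S - {k}. A_mat S q t j k)"
      proof -
        have "(\<Sum>\<^sub>\<infinity>j\<in>states S - {k}. A_mat S q t j k) = (\<Sum>\<^sub>\<infinity>j\<in>states S - {k}. q k j t)"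
          by (rule infsum_cong) (rule off)
        then show ?thesis by (simp add: A_mat_def[of S q t k k])
      qed
      ultimately show "(\<forall>j\<in>states S - {k}. 0 \<le> A_mat S q t j k) \<and>
          (\<lambda>j. A_mat S q t j k) summable_on (states S - {k}) \<and>
          A_mat S q t k k = - (\<Sum>\<^sub>\<infinity>j\<in>states S - {k}. A_mat S q t j k) \<and> \<bar>A_mat S q t k k\<bar> \<le> L"
        using elim t k off nn by auto
    qed
  qed
  then show thesis by (rule that)
qed

context weights
begin

lemma D_vec_abs_le:
  assumes y: "y summable_on states S" and i: "i \<in> I"
  shows "\<bar>D_vec S d y i\<bar> \<le> d i * (\<Sum>\<^sub>\<infinity>j\<in>states S. \<bar>y j\<bar>)"
proof -
  have di: "0 < d i" using d_pos pos_states_simps(1)[OF i] by auto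
  have s: "(\<lambda>j. D_mat d i j * y j) summable_on I" by (rule D_mat_row_summable[OF y i])
  have ya: "(\<lambda>j. \<bar>y j\<bar>) summable_on states S" using y by (simp add: summable_abs_iff)
  then have yI: "(\<lambda>j. \<bar>y j\<bar>) summable_on I" using summable_on_states_iff by blast
  have "\<bar>D_vec S d y i\<bar> \<le> (\<Sum>\<^sub>\<infinity>j\<in>I. \<bar>D_mat d i j * y j\<bar>)"
    unfolding mat_vec_def by (rule abs_infsum_le[OF s])
  also have "\<dots> \<le> (\<Sum>\<^sub>\<infinity>j\<in>I. d i * \<bar>y j\<bar>)"
  proof (rule infsum_mono)
    show "(\<lambda>j. \<bar>D_mat d i j * y j\<bar>) summable_on I" using s by (simp add: summable_abs_iff)
    show "(\<lambda>j. d i * \<bar>y j\<bar>) summable_on I" using yI by (rule summable_on_cmult_right)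
  qed (use di in \<open>auto simp: D_mat_def abs_mult\<close>)
  also have "\<dots> = d i * (\<Sum>\<^sub>\<infinity>j\<in>I. \<bar>y j\<bar>)" by (rule infsum_cmult_right) (use yI in auto)
  also have "\<dots> \<le> d i * (\<Sum>\<^sub>\<infinity>j\<in>states S. \<bar>y j\<bar>)"
    using di by (intro mult_left_mono infsum_mono2[OF yI ya pos_states_simps(4)]) auto
  finally show ?thesis .
qed

lemma forward_abs_cont:
  assumes fs: "forward_solution S q s p" and i: "i \<in> I" and "s \<le> T"
  shows "abs_cont_on s T (\<lambda>t. D_vec S d (pmf (p t)) i)"
  unfolding abs_cont_on_def
proof (intro allI impI)
  fix \<epsilon> :: real assume \<epsilon>: "0 < \<epsilon>"
  have di: "0 < d i" using d_pos pos_states_simps(1)[OF i] by auto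
  have "l1_abs_continuous_on (states S) s T (\<lambda>t. pmf (p t))"
    using fs \<open>s \<le> T\<close> by (simp add: forward_solution_def)
  moreover have "0 < \<epsilon> / d i" using \<epsilon> di by simp
  ultimately obtain \<delta> where "0 < \<delta>" and \<delta>: "\<forall>(n::nat) a b.
        (\<forall>k<n. s \<le> a k \<and> a k \<le> b k \<and> b k \<le> T) \<longrightarrow>
        (\<forall>k<n. \<forall>l<n. k \<noteq> l \<longrightarrow> {a k<..<b k} \<inter> {a l<..<b l} = {}) \<longrightarrow>
        (\<Sum>k<n. b k - a k) < \<delta> \<longrightarrow>
        (\<Sum>k<n. l1_norm (states S) (\<lambda>i. pmf (p (b k)) i - pmf (p (a k)) i)) < ennreal (\<epsilon> / d i)"
    unfolding l1_abs_continuous_on_def by blast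
  show "\<exists>\<delta>>0. small_variation s T (\<lambda>t. D_vec S d (pmf (p t)) i) \<delta> \<epsilon>"
  proof (intro exI conjI)
    show "small_variation s T (\<lambda>t. D_vec S d (pmf (p t)) i) \<delta> \<epsilon>"
      unfolding small_variation_def
    proof (intro allI impI)
      fix n :: nat and a b
      assume 1: "\<forall>k<n. s \<le> a k \<and> a k \<le> b k \<and> b k \<le> T"
        and 2: "\<forall>k<n. \<forall>l<n. k \<noteq> l \<longrightarrow> {a k<..<b k} \<inter> {a l<..<b l} = {}"
        and 3: "(\<Sum>k<n. b k - a k) < \<delta>"
      define N where "N k = (\<Sum>\<^sub>\<infinity>j\<in>states S. \<bar>pmf (p (b k)) j - pmf (p (a k)) j\<bar>)" for k
      have sm: "(\<lambda>j. pmf (p (b k)) j - pmf (p (a k)) j) summable_on states S" for k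
        using summable_on_add[OF summable_pmf summable_on_uminus[THEN iffD2, OF summable_pmf]] by simp
      have N0: "0 \<le> N k" for k unfolding N_def by (rule infsum_nonneg) auto
      have "(\<Sum>k<n. l1_norm (states S) (\<lambda>i. pmf (p (b k)) i - pmf (p (a k)) i)) < ennreal (\<epsilon> / d i)"
        using \<delta>[rule_format, of n a b] 1 2 3 by blast
      also have "(\<Sum>k<n. l1_norm (states S) (\<lambda>i. pmf (p (b k)) i - pmf (p (a k)) i)) = ennreal (\<Sum>k<n. N k)"
        unfolding l1_norm_eq[OF sm] N_def[symmetric] by (rule sum_ennreal) (rule N0)
      finally have "(\<Sum>k<n. N k) < \<epsilon> / d i"
        by (subst (asm) ennreal_less_iff) (auto intro: sum_nonneg N0)
      then have "d i * (\<Sum>k<n. N k) < \<epsilon>" using di by (simp add: field_simps)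
      moreover have "\<bar>D_vec S d (pmf (p (b k))) i - D_vec S d (pmf (p (a k))) i\<bar> \<le> d i * N k" for k
        unfolding N_def D_vec_diff[OF summable_pmf summable_pmf i, symmetric] by (rule D_vec_abs_le[OF sm i])
      then have "(\<Sum>k<n. \<bar>D_vec S d (pmf (p (b k))) i - D_vec S d (pmf (p (a k))) i\<bar>) \<le> d i * (\<Sum>k<n. N k)"
        unfolding sum_distrib_left by (rule sum_mono)
      ultimately show "(\<Sum>k<n. \<bar>D_vec S d (pmf (p (b k))) i - D_vec S d (pmf (p (a k))) i\<bar>) < \<epsilon>" by linarith
    qed
  qed fact
qed

lemma forward_has_derivative:
  assumes der: "has_l1_derivative (states S) (\<lambda>t. pmf (p t)) v t" and v: "v summable_on states S"
    and i: "i \<in> I"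
  shows "((\<lambda>t. D_vec S d (pmf (p t)) i) has_real_derivative D_vec S d v i) (at t)"
proof -
  let ?y = "\<lambda>h j. (pmf (p (t + h)) j - pmf (p t) j) / h - v j"
  let ?N = "\<lambda>h. \<Sum>\<^sub>\<infinity>j\<in>states S. \<bar>?y h j\<bar>"
  have s1: "(\<lambda>j. (pmf (p (t + h)) j - pmf (p t) j)) summable_on A" for h A
    using summable_on_add[OF summable_pmf summable_on_uminus[THEN iffD2, OF summable_pmf]] by simp
  have s2: "(\<lambda>j. (pmf (p (t + h)) j - pmf (p t) j) / h) summable_on A" for h A
    using summable_on_cmult_left[OF s1, where c = "inverse h"] by (simp add: divide_inverse)
  have sy: "?y h summable_on states S" for h
    using summable_on_add[OF s2 summable_on_uminus[THEN iffD2, OF v]] by simp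
  have N0: "0 \<le> ?N h" for h by (rule infsum_nonneg) auto
  have "((\<lambda>h. ennreal (?N h)) \<longlongrightarrow> ennreal 0) (at 0)"
    using der unfolding has_l1_derivative_def l1_norm_eq[OF sy] by simp
  then have "(?N \<longlongrightarrow> 0) (at 0)"
    by (subst (asm) tendsto_ennreal_iff) (auto simp: N0)
  then have lim: "((\<lambda>h. d i * ?N h) \<longlongrightarrow> 0) (at 0)" by (rule tendsto_mult_right_zero)
  have vI: "v summable_on I" using v summable_on_states_iff by blast
  have "((\<lambda>h. (D_vec S d (pmf (p (t + h))) i - D_vec S d (pmf (p t)) i) / h - D_vec S d v i) \<longlongrightarrow> 0) (at 0)"
  proof (rule Lim_null_comparison[OF always_eventually lim], rule allI)
    fix h
    have "(D_vec S d (pmf (p (t + h))) i - D_vec S d (pmf (p t)) i) / h - D_vec S d v i = D_vec S d (?y h) i"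
      by (simp add: D_vec_diff[OF s2 vI i] D_vec_cmult D_vec_diff[OF summable_pmf summable_pmf i])
    then show "norm ((D_vec S d (pmf (p (t + h))) i - D_vec S d (pmf (p t)) i) / h - D_vec S d v i) \<le> d i * ?N h"
      using D_vec_abs_le[OF sy i] by simp
  qed
  then show ?thesis unfolding DERIV_def by (rule LIM_zero_cancel)
qed

text \<open>
The integrated forward equation for one tail coordinate, with an exponential factor built in
since the energy estimate and the Lyapunov bound use it for different rates \<open>c\<close>. Absolute integrability
comes from boundedness, as the intensities out of a state are bounded by \<open>L\<close>.
\<close>

lemma forward_weak_form:
  fixes c :: real
  assumes q: "bounded_intensities S q" and fs: "forward_solution S q s p" and s: "0 \<le> s" "s \<le> T"
    and i: "i \<in> I"
  defines "g \<equiv> \<lambda>t. exp (c * t) * (c * D_vec S d (pmf (p t)) i + drift S d q p t i)"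
  shows "g absolutely_integrable_on {s..T}"
    and "\<And>r t. \<lbrakk>s \<le> r; r \<le> t; t \<le> T\<rbrakk> \<Longrightarrow>
      (g has_integral (exp (c * t) * D_vec S d (pmf (p t)) i - exp (c * r) * D_vec S d (pmf (p r)) i)) {r..t}"
proof -
  obtain L where L: "AE t in lebesgue. 0 \<le> t \<longrightarrow> generator S L (A_mat S q t)"
    using AE_generator[OF q] .
  have der: "AE t in lebesgue. s < t \<longrightarrow> has_l1_derivative (states S) (\<lambda>t. pmf (p t))
          (mat_vec (states S) (A_mat S q t) (pmf (p t))) t"
    using fs by (simp add: forward_solution_def)
  have "AE t in lebesgue. s < t \<longrightarrow> generator S L (A_mat S q t) \<and> has_l1_derivative (states S) (\<lambda>t. pmf (p t))
          (mat_vec (states S) (A_mat S q t) (pmf (p t))) t"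
    using L der by eventually_elim (use s in auto)
  then obtain N where N: "N \<in> null_sets lebesgue"
    and good: "\<And>t. \<lbrakk>t \<notin> N; s < t\<rbrakk> \<Longrightarrow> generator S L (A_mat S q t) \<and>
       has_l1_derivative (states S) (\<lambda>t. pmf (p t)) (mat_vec (states S) (A_mat S q t) (pmf (p t))) t"
    by (auto simp: eventually_ae_filter)
  let ?u = "\<lambda>t. D_vec S d (pmf (p t)) i"
  have di: "0 < d i" using d_pos pos_states_simps(1)[OF i] by auto
  have deriv: "(?u has_real_derivative drift S d q p t i) (at t)" if "t \<notin> N" "s < t" for t
  proof -
    have gen: "generator S L (A_mat S q t)"
      and der: "has_l1_derivative (states S) (\<lambda>t. pmf (p t)) (mat_vec (states S) (A_mat S q t) (pmf (p t))) t"
      using good[OF that] by auto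
    have v: "mat_vec (states S) (A_mat S q t) (pmf (p t)) summable_on states S"
      unfolding summable_on_states_iff by (rule D_vec_generator(1)[OF gen i summable_pmf])
    show ?thesis
      by (rule DERIV_cong[OF forward_has_derivative[OF der v i]])
         (rule D_vec_generator(2)[OF gen i summable_pmf])
  qed
  have ac: "abs_cont_on s T (\<lambda>t. exp (c * t) * ?u t)"
    by (intro abs_cont_on_mult abs_cont_on_exp forward_abs_cont[OF fs i s(2)])
  show int: "(g has_integral (exp (c * t) * ?u t - exp (c * r) * ?u r)) {r..t}"
    if rt: "s \<le> r" "r \<le> t" "t \<le> T" for r t
  proof (rule abs_cont_fundamental_theorem[OF rt(2) abs_cont_on_subset[OF ac rt(1,3)] N])
    fix x assume "r < x" "x < t" "x \<notin> N"
    then have "(?u has_real_derivative drift S d q p x i) (at x)" using deriv rt by auto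
    then show "((\<lambda>t. exp (c * t) * ?u t) has_real_derivative g x) (at x)"
      unfolding g_def by (auto intro!: derivative_eq_intros simp: algebra_simps)
  qed
  let ?N = "insert s N"
  define C where "C = exp (\<bar>c\<bar> * max \<bar>s\<bar> \<bar>T\<bar>) * (\<bar>c\<bar> * d i + d i * (2 * L))"
  have bound: "\<bar>g t\<bar> \<le> C" if t: "t \<in> {s..T}" "t \<notin> ?N" for t
  proof -
    have gen: "generator S L (A_mat S q t)" using good[of t] t by auto
    have "c * t \<le> \<bar>c\<bar> * \<bar>t\<bar>" by (metis abs_ge_self abs_mult)
    also have "\<dots> \<le> \<bar>c\<bar> * max \<bar>s\<bar> \<bar>T\<bar>" using t by (intro mult_left_mono) auto
    finally have e: "exp (c * t) \<le> exp (\<bar>c\<bar> * max \<bar>s\<bar> \<bar>T\<bar>)" by simp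
    have sub: "set_pmf (p t) \<subseteq> states S" using fs t by (auto simp: forward_solution_def)
    have "\<bar>?u t\<bar> \<le> d i * 1"
      using D_vec_abs_le[OF summable_pmf i, of "p t"] infsum_pmf_eq_1[OF sub] by simp
    then have 1: "\<bar>c * ?u t\<bar> \<le> \<bar>c\<bar> * d i" by (simp add: abs_mult mult_left_mono)
    have dab: "\<bar>tail_flow S d (A_mat S q t) i k\<bar> \<le> d i * (2 * L)" if "k \<in> states S" for k
      by (rule tail_flow_abs_bound(2)[OF gen i that])
    have "(\<Sum>j\<in>{i}. \<bar>drift S d q p t j\<bar>) \<le> d i * (2 * L) * (\<Sum>\<^sub>\<infinity>k\<in>states S. \<bar>pmf (p t) k\<bar>)"
      by (rule column_bound_l1[OF _ summable_pmf]) (use dab in auto)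
    then have 2: "\<bar>drift S d q p t i\<bar> \<le> d i * (2 * L)" using infsum_pmf_eq_1[OF sub] by simp
    have "\<bar>c * ?u t + drift S d q p t i\<bar> \<le> \<bar>c\<bar> * d i + d i * (2 * L)" using 1 2 by linarith
    then show ?thesis unfolding g_def C_def abs_mult using e by (intro mult_mono) auto
  qed
  have neg: "negligible ?N" using N by (simp add: negligible_iff_null_sets)
  define g' where "g' t = (if t \<in> ?N then 0 else g t)" for t
  have "g integrable_on {s..T}" using int[of s T] s by auto
  then have "g' integrable_on {s..T}"
    by (rule integrable_spike[OF _ neg]) (auto simp: g'_def)
  then have "g' \<in> borel_measurable (lebesgue_on {s..T})" by (rule integrable_imp_measurable)
  then have "g' absolutely_integrable_on {s..T}"
  proof (rule measurable_bounded_by_integrable_imp_absolutely_integrable)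
    show "(\<lambda>_. \<bar>C\<bar>) integrable_on {s..T}" by (rule integrable_const_ivl)
    show "norm (g' t) \<le> \<bar>C\<bar>" if "t \<in> {s..T}" for t
      using bound[OF that] by (auto simp: g'_def)
  qed auto
  then show "g absolutely_integrable_on {s..T}"
    by (rule absolutely_integrable_spike[OF _ neg]) (auto simp: g'_def)
qed

end


section \<open>A Lyapunov bound for the weighted mass\<close>

lemma B_mat_eq: "B_mat S q t = (\<lambda>i j. A_mat S q t i j - A_mat S q t i 0)"
  by (intro ext) (simp add: B_mat_def)

lemma D_vec_f_vec: "D_vec S d (f_vec S q t) i = tail_flow S d (A_mat S q t) i 0"
  by (simp add: mat_vec_def mat_mult_def f_vec_def)

definition bounded_chain :: "enat \<Rightarrow> (nat \<Rightarrow> real) \<Rightarrow> (nat \<Rightarrow> nat \<Rightarrow> real \<Rightarrow> real) \<Rightarrow> real \<Rightarrow> real \<Rightarrow> bool" where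
  "bounded_chain S d q C c \<longleftrightarrow> bounded_intensities S q \<and> 0 \<le> C \<and> 0 \<le> c \<and>
     (AE t in lebesgue. 0 \<le> t \<longrightarrow> mat_norm1D S d (B_mat S q t) \<le> ennreal C) \<and>
     (AE t in lebesgue. 0 \<le> t \<longrightarrow> norm1D S d (f_vec S q t) \<le> ennreal c)"

text \<open>
What almost every time provides, in the pointwise form used by the algebraic lemmas.
\<close>

definition regular_time :: "enat \<Rightarrow> (nat \<Rightarrow> real) \<Rightarrow> (nat \<Rightarrow> nat \<Rightarrow> real \<Rightarrow> real) \<Rightarrow> real \<Rightarrow> real \<Rightarrow> real \<Rightarrow> real \<Rightarrow> bool" where
  "regular_time S d q L C c t \<longleftrightarrow> generator S L (A_mat S q t) \<and>
     mat_norm (pos_states S) (B_star2 S q d t) \<le> ennreal C \<and>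
     l1_norm (pos_states S) (\<lambda>i. tail_flow S d (A_mat S q t) i 0) \<le> ennreal c"

lemma AE_regular_time:
  assumes "bounded_chain S d q C c"
  obtains L where "AE t in lebesgue. 0 \<le> t \<longrightarrow> regular_time S d q L C c t"
proof -
  obtain L where L: "AE t in lebesgue. 0 \<le> t \<longrightarrow> generator S L (A_mat S q t)"
    using AE_generator[of S q] assms unfolding bounded_chain_def by blast
  have "AE t in lebesgue. 0 \<le> t \<longrightarrow> mat_norm1D S d (B_mat S q t) \<le> ennreal C"
    "AE t in lebesgue. 0 \<le> t \<longrightarrow> norm1D S d (f_vec S q t) \<le> ennreal c"
    using assms by (auto simp: bounded_chain_def)
  with L have "AE t in lebesgue. 0 \<le> t \<longrightarrow> regular_time S d q L C c t"
  proof eventually_elim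
    case (elim t)
    then show ?case
      unfolding regular_time_def B_star2_def mat_norm1D_def norm1D_def D_vec_f_vec by auto
  qed
  then show thesis by (rule that)
qed

context weights
begin

abbreviation weighted_l1 :: "(nat \<Rightarrow> real) \<Rightarrow> bool" where
  "weighted_l1 x \<equiv> (\<lambda>k. cum_weight d k * \<bar>x k\<bar>) summable_on I"

abbreviation norm_D :: "(nat \<Rightarrow> real) \<Rightarrow> real" where
  "norm_D x \<equiv> (\<Sum>\<^sub>\<infinity>i\<in>I. \<bar>D_vec S d x i\<bar>)"

lemma norm_D_nonneg: "0 \<le> norm_D x"
  by (rule infsum_nonneg) auto

lemma D_vec_pmf_nonneg: "i \<in> I \<Longrightarrow> 0 \<le> D_vec S d (pmf p) i"
  unfolding mat_vec_def using D_mat_le(2) by (intro infsum_nonneg) auto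

lemma finite_sum_D_vec_le:
  assumes "weighted_l1 x" "finite F" "F \<subseteq> I"
  shows "(\<Sum>i\<in>F. \<bar>D_vec S d x i\<bar>) \<le> norm_D x"
  using weighted_summable(2)[OF assms(1)] assms(2,3)
  by (intro finite_sum_le_infsum) (auto simp: summable_abs_iff)

text \<open>
The weighted mass of a solution grows at most exponentially. The truncated functional
\<open>g = \<Sum>\<^sub>i\<^sub>\<le>\<^sub>n u\<^sub>i\<close> satisfies \<open>g' \<le> c + C g\<close> by the truncated drift condition, with constants that do not
depend on \<open>n\<close>. Hence a solution that starts in the weighted space stays there.
\<close>

lemma lyapunov_weighted:
  assumes ch: "bounded_chain S d q C c" and fs: "forward_solution S q s p"
    and s: "0 \<le> s" "s \<le> T" and w: "weighted_l1 (pmf (p s))"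
  shows "weighted_l1 (pmf (p T))" "norm_D (pmf (p T)) \<le> exp (C * T) * (norm_D (pmf (p s)) + c * (T - s))"
proof -
  let ?u = "\<lambda>t i. D_vec S d (pmf (p t)) i"
  let ?K = "exp (C * T) * (norm_D (pmf (p s)) + c * (T - s))"
  have q: "bounded_intensities S q" and Cc: "0 \<le> C" "0 \<le> c" using ch by (auto simp: bounded_chain_def)
  obtain L where L: "AE t in lebesgue. 0 \<le> t \<longrightarrow> regular_time S d q L C c t"
    using AE_regular_time[OF ch] .
  have trunc: "(\<Sum>i\<in>F. ?u T i) \<le> ?K" if F: "F = {1..n} \<inter> I" for F and n :: nat
  proof -
    have Ff: "finite F" "F \<subseteq> I" using F by auto
    let ?g = "\<lambda>i t. exp (- C * t) * (- C * ?u t i + drift S d q p t i)"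
    have gi: "(?g i has_integral (exp (- C * T) * ?u T i - exp (- C * s) * ?u s i)) {s..T}" if "i \<in> F" for i
      by (rule forward_weak_form(2)[OF q fs s _ order_refl s(2) order_refl])
         (use that Ff in auto)
    then have sum: "((\<lambda>t. \<Sum>i\<in>F. ?g i t) has_integral (\<Sum>i\<in>F. exp (- C * T) * ?u T i - exp (- C * s) * ?u s i)) {s..T}"
      by (intro has_integral_sum Ff(1))
    have "(\<Sum>i\<in>F. exp (- C * T) * ?u T i - exp (- C * s) * ?u s i) = integral {s..T} (\<lambda>t. \<Sum>i\<in>F. ?g i t)"
      using sum by (simp add: integral_unique)
    also have "\<dots> \<le> integral {s..T} (\<lambda>t. c)"
    proof (rule integral_le_AE)
      show "(\<lambda>t. \<Sum>i\<in>F. ?g i t) integrable_on {s..T}" using sum by blast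
      show "AE t in lebesgue. s \<le> t \<longrightarrow> t \<le> T \<longrightarrow> (\<Sum>i\<in>F. ?g i t) \<le> c"
        using L
      proof eventually_elim
        case (elim t)
        show ?case
        proof (intro impI)
          assume t: "s \<le> t" "t \<le> T"
          then have R: "generator S L (A_mat S q t)"
            "mat_norm I (conj_D S d (\<lambda>i j. A_mat S q t i j - A_mat S q t i 0)) \<le> ennreal C"
            "l1_norm I (\<lambda>i. tail_flow S d (A_mat S q t) i 0) \<le> ennreal c"
            using elim s by (auto simp: regular_time_def B_star2_def B_mat_eq)
          have sub: "set_pmf (p t) \<subseteq> states S" using fs t by (auto simp: forward_solution_def)
          let ?A = "A_mat S q t"
          have s1: "\<forall>i\<in>F. (\<lambda>k. tail_flow S d ?A i k * pmf (p t) k) summable_on states S"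
          proof
            fix i assume "i \<in> F"
            then have "\<bar>tail_flow S d ?A i k\<bar> \<le> d i * (2 * L)" if "k \<in> states S" for k
              using Ff that by (intro tail_flow_abs_bound(2)[OF R(1)]) auto
            then show "(\<lambda>k. tail_flow S d ?A i k * pmf (p t) k) summable_on states S"
              by (rule summable_bounded_mult[OF summable_pmf])
          qed
          have s2: "\<forall>i\<in>F. (\<lambda>k. D_mat d i k * pmf (p t) k) summable_on states S"
          proof
            fix i assume "i \<in> F"
            then show "(\<lambda>k. D_mat d i k * pmf (p t) k) summable_on states S"
              unfolding summable_on_states_iff
              using Ff by (intro summable_D_mat_row[OF summable_pmf]) auto
          qed
          note sw1 = infsum_swap_abs[where f = "\<lambda>i k. tail_flow S d ?A i k * pmf (p t) k", OF s1 summable_on_finite[OF Ff(1)]]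
          note sw2 = infsum_swap_abs[where f = "\<lambda>i k. D_mat d i k * pmf (p t) k", OF s2 summable_on_finite[OF Ff(1)]]
          have u: "?u t i = (\<Sum>\<^sub>\<infinity>k\<in>states S. D_mat d i k * pmf (p t) k)" if "i \<in> F" for i
          proof -
            have "(\<lambda>k. D_mat d i k * pmf (p t) k) summable_on I"
              using s2 that by (simp add: summable_on_states_iff)
            from infsum_states_split[OF this] show ?thesis
              using that Ff D_mat_0[of i S d] by (simp add: mat_vec_def subset_iff)
          qed
          have "(\<Sum>i\<in>F. drift S d q p t i) = (\<Sum>\<^sub>\<infinity>k\<in>states S. \<Sum>i\<in>F. tail_flow S d ?A i k * pmf (p t) k)"
            using sw1(1) Ff(1) by simp
          also have "\<dots> \<le> (\<Sum>\<^sub>\<infinity>k\<in>states S. c * pmf (p t) k + C * (\<Sum>i\<in>F. D_mat d i k * pmf (p t) k))"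
          proof (rule infsum_mono)
            show "(\<lambda>k. \<Sum>i\<in>F. tail_flow S d ?A i k * pmf (p t) k) summable_on states S"
              using sw1(3) Ff(1) by simp
            show "(\<lambda>k. c * pmf (p t) k + C * (\<Sum>i\<in>F. D_mat d i k * pmf (p t) k)) summable_on states S"
              using sw2(3) Ff(1) by (intro summable_on_add summable_on_cmult_right summable_pmf) simp
            fix k assume k: "k \<in> states S"
            have "(\<Sum>i\<in>F. tail_flow S d ?A i k) \<le> c + C * (\<Sum>i\<in>F. D_mat d i k)"
              unfolding F by (rule tail_flow_truncated_drift[OF R(1) k R(2) Cc(1) R(3) Cc(2)])
            then have "(\<Sum>i\<in>F. tail_flow S d ?A i k) * pmf (p t) k \<le> (c + C * (\<Sum>i\<in>F. D_mat d i k)) * pmf (p t) k"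
              by (rule mult_right_mono) simp
            then show "(\<Sum>i\<in>F. tail_flow S d ?A i k * pmf (p t) k) \<le> c * pmf (p t) k + C * (\<Sum>i\<in>F. D_mat d i k * pmf (p t) k)"
              by (simp add: sum_distrib_right distrib_right mult.assoc)
          qed
          also have "\<dots> = (\<Sum>\<^sub>\<infinity>k\<in>states S. c * pmf (p t) k) + (\<Sum>\<^sub>\<infinity>k\<in>states S. C * (\<Sum>i\<in>F. D_mat d i k * pmf (p t) k))"
            using sw2(3) Ff(1) by (intro infsum_add summable_on_cmult_right summable_pmf) simp
          also have "\<dots> = c + C * (\<Sum>i\<in>F. ?u t i)"
            using sw2(1) Ff(1) infsum_pmf_eq_1[OF sub] u by (simp add: infsum_cmult_right')
          finally have dr: "(\<Sum>i\<in>F. drift S d q p t i) \<le> c + C * (\<Sum>i\<in>F. ?u t i)" .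
          have "(\<Sum>i\<in>F. ?g i t) = exp (- C * t) * ((\<Sum>i\<in>F. drift S d q p t i) - C * (\<Sum>i\<in>F. ?u t i))"
            by (simp add: sum_distrib_left sum_subtractf right_diff_distrib algebra_simps sum.distrib)
          also have "\<dots> \<le> exp (- C * t) * c" using dr by (intro mult_left_mono) auto
          also have "\<dots> \<le> 1 * c" using t s Cc by (intro mult_right_mono) auto
          finally show "(\<Sum>i\<in>F. ?g i t) \<le> c" by simp
        qed
      qed
    qed (rule integrable_const_ivl)
    also have "\<dots> = c * (T - s)" using s by simp
    finally have "exp (- C * T) * (\<Sum>i\<in>F. ?u T i) \<le> exp (- C * s) * (\<Sum>i\<in>F. ?u s i) + c * (T - s)"
      by (simp add: sum_subtractf sum_distrib_left)
    also have "exp (- C * s) * (\<Sum>i\<in>F. ?u s i) \<le> 1 * norm_D (pmf (p s))"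
    proof (rule mult_mono)
      have "(\<Sum>i\<in>F. ?u s i) \<le> (\<Sum>i\<in>F. \<bar>?u s i\<bar>)" by (rule sum_mono) simp
      also have "\<dots> \<le> norm_D (pmf (p s))" by (rule finite_sum_D_vec_le[OF w Ff])
      finally show "(\<Sum>i\<in>F. ?u s i) \<le> norm_D (pmf (p s))" .
    qed (use s Cc Ff D_vec_pmf_nonneg in \<open>auto intro!: sum_nonneg\<close>)
    finally have "exp (C * T) * (exp (- C * T) * (\<Sum>i\<in>F. ?u T i)) \<le> exp (C * T) * (norm_D (pmf (p s)) + c * (T - s))"
      by (intro mult_left_mono) auto
    then show ?thesis by (simp flip: exp_add mult.assoc)
  qed
  have fin: "(\<Sum>i\<in>F. ?u T i) \<le> ?K" if F: "finite F" "F \<subseteq> I" for F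
  proof -
    have "(\<Sum>i\<in>F. ?u T i) \<le> (\<Sum>i\<in>{1..Max (insert 1 F)} \<inter> I. ?u T i)"
    proof (rule sum_mono2)
      show "F \<subseteq> {1..Max (insert 1 F)} \<inter> I"
      proof
        fix i assume "i \<in> F"
        then show "i \<in> {1..Max (insert 1 F)} \<inter> I"
          using F pos_states_simps(1)[of i S] by (auto intro: Max_ge)
      qed
    qed (use D_vec_pmf_nonneg in auto)
    also have "\<dots> \<le> ?K" by (rule trunc) simp
    finally show ?thesis .
  qed
  note wI = weighted_summableI[where x = "pmf (p T)", OF summable_pmf pmf_nonneg fin]
  show w: "weighted_l1 (pmf (p T))" by (rule wI(1))
  show "norm_D (pmf (p T)) \<le> ?K"
    using weighted_summable(3)[OF w] wI(2) by simp
qed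

end


section \<open>Decay under a perturbed drift\<close>

text \<open>
The decay condition forces integrability: the integral of a function that is not integrable is 0
by convention, so the left side of the condition would be 1 on long intervals, where the
right side is small.
\<close>

lemma alpha_integrable_of_decay:
  fixes \<alpha> :: "real \<Rightarrow> real"
  assumes M: "0 < M" and a: "0 < a"
    and decay: "\<And>s t. 0 \<le> s \<Longrightarrow> s \<le> t \<Longrightarrow>
      exp (- (LINT \<tau>:{s..t}|lebesgue. \<alpha> \<tau>)) \<le> M * exp (- a * (t - s))"
    and st: "0 \<le> s" "s \<le> t"
  shows "\<alpha> absolutely_integrable_on {s..t}"
    and "exp (- integral {s..t} \<alpha>) \<le> M * exp (- a * (t - s))"
proof -
  \<comment> \<open>beyond this time the right side of the decay condition is less than 1\<close>
  define T where "T = max t (\<bar>ln M\<bar> / a + 1)"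
  have T: "t \<le> T" "\<bar>ln M\<bar> / a + 1 \<le> T" by (auto simp: T_def)
  have lnM: "\<bar>ln M\<bar> < a * T" using T(2) a by (simp add: field_simps)
  have "M * exp (- a * T) < 1"
  proof -
    have "M * exp (- a * T) = exp (ln M - a * T)" using M by (simp add: exp_diff exp_minus field_simps)
    also have "\<dots> < 1" using lnM by simp
    finally show ?thesis .
  qed
  moreover have "exp (- (LINT \<tau>:{0..T}|lebesgue. \<alpha> \<tau>)) \<le> M * exp (- a * T)"
    using decay[of 0 T] st T by simp
  ultimately have "(LINT \<tau>:{0..T}|lebesgue. \<alpha> \<tau>) \<noteq> 0" by auto
  then have "\<alpha> absolutely_integrable_on {0..T}"
    unfolding set_lebesgue_integral_def set_integrable_def
    using not_integrable_integral_eq by blast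
  then show ai: "\<alpha> absolutely_integrable_on {s..t}"
    by (rule set_integrable_subset) (use st T in auto)
  show "exp (- integral {s..t} \<alpha>) \<le> M * exp (- a * (t - s))"
    using decay[OF st] set_lebesgue_integral_eq_integral(2)[OF ai] by simp
qed

text \<open>
The two smallness conditions on the perturbation in tail coordinates.
\<close>

definition close_time ::
  "enat \<Rightarrow> (nat \<Rightarrow> real) \<Rightarrow> (nat \<Rightarrow> nat \<Rightarrow> real \<Rightarrow> real) \<Rightarrow> (nat \<Rightarrow> nat \<Rightarrow> real \<Rightarrow> real) \<Rightarrow> real \<Rightarrow> real \<Rightarrow> real \<Rightarrow> bool" where
  "close_time S d q q' \<Delta>B \<Delta>f t \<longleftrightarrow>
     mat_norm (pos_states S) (\<lambda>i k. B_star2 S q d t i k - B_star2 S q' d t i k) \<le> ennreal \<Delta>B \<and>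
     l1_norm (pos_states S) (\<lambda>i. tail_flow S d (A_mat S q t) i 0 - tail_flow S d (A_mat S q' t) i 0) \<le> ennreal \<Delta>f"

context weights
begin

lemma conj_D_diff:
  assumes X: "\<And>k. k \<in> states S \<Longrightarrow> (\<lambda>j. X j k) summable_on states S"
    and Y: "\<And>k. k \<in> states S \<Longrightarrow> (\<lambda>j. Y j k) summable_on states S"
    and i: "i \<in> I" and k: "k \<in> I"
  shows "conj_D S d (\<lambda>i j. X i j - Y i j) i k = conj_D S d X i k - conj_D S d Y i k"
proof -
  have st: "k \<in> states S" "k - 1 \<in> states S"
    using pos_states_simps(2)[OF k, of "k - 1"] k pos_states_simps(3)[of S] by (cases "k \<le> 1"; force)+
  have D: "tail_flow S d (\<lambda>i j. X i j - Y i j) i l = tail_flow S d X i l - tail_flow S d Y i l" if "l \<in> states S" for l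
    unfolding tail_flow_eq_D_vec using X[OF that] Y[OF that]
    by (intro D_vec_diff i) (simp_all add: summable_on_states_iff)
  have "conj_D S d (\<lambda>i j. X i j - Y i j) i k * d k = (conj_D S d X i k - conj_D S d Y i k) * d k"
    unfolding left_diff_distrib conj_D_entry[OF k] using D[OF st(1)] D[OF st(2)] by simp
  then show ?thesis using d_pos[OF pos_states_simps(1)[OF k]] by simp
qed

lemma B_mat_column_summable:
  assumes "generator S L (A_mat S q t)" "k \<in> states S"
  shows "(\<lambda>j. B_mat S q t j k) summable_on states S"
proof -
  have "0 \<in> states S" by (simp add: pos_states_simps(3))
  then show ?thesis unfolding B_mat_eq
    using summable_on_add[OF generator_column(1)[OF assms] summable_on_uminus[THEN iffD2, OF generator_column(1)[OF assms(1), of 0]]]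
    by simp
qed

text \<open>
Conjugation by \<open>D\<close> is additive on matrices with summable columns, so the perturbation of \<open>B\<close>
becomes the difference of the two matrices \<open>B\<^sup>*\<^sup>*\<close>. The triangle inequality then bounds the norms of
the perturbed chain.
\<close>

lemma AE_close_time:
  assumes ch: "bounded_chain S d q C c" and ch': "bounded_intensities S q'"
    and B: "AE t in lebesgue. 0 \<le> t \<longrightarrow>
         mat_norm1D S d (\<lambda>i j. B_mat S q t i j - B_mat S q' t i j) \<le> ennreal \<Delta>B"
    and f: "AE t in lebesgue. 0 \<le> t \<longrightarrow>
         norm1D S d (\<lambda>i. f_vec S q t i - f_vec S q' t i) \<le> ennreal \<Delta>f"
    and nn: "0 \<le> \<Delta>B" "0 \<le> \<Delta>f"
  shows "AE t in lebesgue. 0 \<le> t \<longrightarrow> close_time S d q q' \<Delta>B \<Delta>f t"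
    and "bounded_chain S d q' (C + \<Delta>B) (c + \<Delta>f)"
proof -
  obtain L where L: "AE t in lebesgue. 0 \<le> t \<longrightarrow> regular_time S d q L C c t" using AE_regular_time[OF ch] .
  obtain L' where L': "AE t in lebesgue. 0 \<le> t \<longrightarrow> generator S L' (A_mat S q' t)" using AE_generator[OF ch'] .
  show close: "AE t in lebesgue. 0 \<le> t \<longrightarrow> close_time S d q q' \<Delta>B \<Delta>f t"
    using L L' B f
  proof eventually_elim
    case (elim t)
    show ?case
    proof
      assume "0 \<le> t"
      with elim have R: "regular_time S d q L C c t" "generator S L' (A_mat S q' t)"
        "mat_norm I (conj_D S d (\<lambda>i j. B_mat S q t i j - B_mat S q' t i j)) \<le> ennreal \<Delta>B"
        "l1_norm I (D_vec S d (\<lambda>i. f_vec S q t i - f_vec S q' t i)) \<le> ennreal \<Delta>f"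
        by (auto simp: mat_norm1D_def norm1D_def)
      have g: "generator S L (A_mat S q t)" using R(1) by (simp add: regular_time_def)
      have 1: "conj_D S d (\<lambda>i j. B_mat S q t i j - B_mat S q' t i j) i k = B_star2 S q d t i k - B_star2 S q' d t i k"
        if "i \<in> I" "k \<in> I" for i k
        unfolding B_star2_def
        by (rule conj_D_diff[OF B_mat_column_summable[OF g] B_mat_column_summable[OF R(2)] that])
      have "mat_norm I (\<lambda>i k. B_star2 S q d t i k - B_star2 S q' d t i k)
          = mat_norm I (conj_D S d (\<lambda>i j. B_mat S q t i j - B_mat S q' t i j))"
        unfolding mat_norm_def by (intro SUP_cong refl infsum_cong) (simp add: 1)
      moreover have z: "0 \<in> states S" by (simp add: pos_states_simps(3))
      have "D_vec S d (\<lambda>i. f_vec S q t i - f_vec S q' t i) i = tail_flow S d (A_mat S q t) i 0 - tail_flow S d (A_mat S q' t) i 0"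
        if "i \<in> I" for i
        unfolding tail_flow_eq_D_vec f_vec_def using generator_column(1)[OF g z] generator_column(1)[OF R(2) z]
        by (intro D_vec_diff that) (simp_all add: summable_on_states_iff)
      then have "l1_norm I (\<lambda>i. tail_flow S d (A_mat S q t) i 0 - tail_flow S d (A_mat S q' t) i 0)
          = l1_norm I (D_vec S d (\<lambda>i. f_vec S q t i - f_vec S q' t i))"
        unfolding l1_norm_def by (intro infsum_cong) simp
      ultimately show "close_time S d q q' \<Delta>B \<Delta>f t" using R by (simp add: close_time_def)
    qed
  qed
  have Cc: "0 \<le> C" "0 \<le> c" using ch by (auto simp: bounded_chain_def)
  have "AE t in lebesgue. 0 \<le> t \<longrightarrow> mat_norm1D S d (B_mat S q' t) \<le> ennreal (C + \<Delta>B) \<and>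
      norm1D S d (f_vec S q' t) \<le> ennreal (c + \<Delta>f)"
    using L close
  proof eventually_elim
    case (elim t)
    show ?case
    proof
      assume "0 \<le> t"
      with elim have R: "regular_time S d q L C c t" "close_time S d q q' \<Delta>B \<Delta>f t" by auto
      have "mat_norm I (B_star2 S q' d t) \<le> ennreal (C + \<Delta>B)"
        by (rule mat_norm_diff_le[OF _ Cc(1) _ nn(1)]) (use R in \<open>auto simp: regular_time_def close_time_def\<close>)
      moreover have "l1_norm I (\<lambda>i. tail_flow S d (A_mat S q' t) i 0) \<le> ennreal (c + \<Delta>f)"
        by (rule l1_norm_diff_le[where y = "\<lambda>i. tail_flow S d (A_mat S q t) i 0", OF _ Cc(2) _ nn(2)])
           (use R in \<open>auto simp: regular_time_def close_time_def\<close>)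
      ultimately show "mat_norm1D S d (B_mat S q' t) \<le> ennreal (C + \<Delta>B) \<and>
          norm1D S d (f_vec S q' t) \<le> ennreal (c + \<Delta>f)"
        unfolding mat_norm1D_def norm1D_def B_star2_def[symmetric] D_vec_f_vec by simp
    qed
  qed
  then show "bounded_chain S d q' (C + \<Delta>B) (c + \<Delta>f)"
    using ch' nn Cc unfolding bounded_chain_def by (auto elim: eventually_mono)
qed

text \<open>
The energy estimate for \<open>u' = B\<^sup>*\<^sup>* u + r\<close>, where \<open>r\<close> contains both an inhomogeneity of norm \<open>G\<close> and a
perturbation of the matrix of norm \<open>\<delta>\<close>; the latter costs \<open>\<delta>\<close> in the decay rate. In this form the
decay rate \<open>\<alpha>\<close> of the unperturbed chain serves for the perturbed chain as well.
\<close>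

lemma perturbed_energy:
  fixes u h :: "real \<Rightarrow> nat \<Rightarrow> real" and M a \<delta> G :: real
  assumes ch: "bounded_chain S d q C c"
    and M: "0 < M" and a: "0 < a"
    and decay: "\<And>s t. 0 \<le> s \<Longrightarrow> s \<le> t \<Longrightarrow>
      exp (- (LINT \<tau>:{s..t}|lebesgue. alpha S q d \<tau>)) \<le> M * exp (- a * (t - s))"
    and \<delta>: "0 \<le> \<delta>" "\<delta> < a" and G: "0 \<le> G" and sT: "0 \<le> s" "s \<le> T"
    and summ: "\<And>t. \<lbrakk>s \<le> t; t \<le> T\<rbrakk> \<Longrightarrow> u t summable_on I"
    and bnd: "\<And>t. \<lbrakk>s \<le> t; t \<le> T\<rbrakk> \<Longrightarrow> (\<Sum>\<^sub>\<infinity>i\<in>I. \<bar>u t i\<bar>) \<le> K"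
    and ai: "\<And>i. i \<in> I \<Longrightarrow> (\<lambda>t. exp (C * t) * (C * u t i + h t i)) absolutely_integrable_on {s..T}"
    and weak: "\<And>i r t. \<lbrakk>i \<in> I; s \<le> r; r \<le> t; t \<le> T\<rbrakk> \<Longrightarrow>
        ((\<lambda>\<tau>. exp (C * \<tau>) * (C * u \<tau> i + h \<tau> i)) has_integral (exp (C * t) * u t i - exp (C * r) * u r i)) {r..t}"
    and rep: "AE t in lebesgue. s \<le> t \<longrightarrow> t \<le> T \<longrightarrow>
       (\<exists>r. (\<forall>i\<in>I. h t i = (\<Sum>\<^sub>\<infinity>k\<in>I. B_star2 S q d t i k * u t k) + r i) \<and>
         (\<forall>F. finite F \<longrightarrow> F \<subseteq> I \<longrightarrow> (\<Sum>i\<in>F. \<bar>r i\<bar>) \<le> \<delta> * (\<Sum>\<^sub>\<infinity>i\<in>I. \<bar>u t i\<bar>) + G))"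
  shows "(\<Sum>\<^sub>\<infinity>i\<in>I. \<bar>u T i\<bar>) \<le> M * exp (- (a - \<delta>) * (T - s)) * (\<Sum>\<^sub>\<infinity>i\<in>I. \<bar>u s i\<bar>) + G * M / (a - \<delta>)"
proof (cases "I = {}")
  case True
  \<comment> \<open>the chain has only the state 0, and \<open>\<alpha>\<close> is an infimum over the empty set\<close>
  then show ?thesis using G M \<delta> by simp
next
  case False
  then obtain k0 where k0: "k0 \<in> I" by blast
  obtain L where L: "AE t in lebesgue. 0 \<le> t \<longrightarrow> regular_time S d q L C c t" using AE_regular_time[OF ch] .
  have C: "0 \<le> C" using ch by (simp add: bounded_chain_def)
  let ?\<gamma> = "\<lambda>t. alpha S q d t - \<delta>"
  have al: "alpha S q d absolutely_integrable_on {s..t}"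
    "exp (- integral {s..t} (alpha S q d)) \<le> M * exp (- a * (t - s))" if "0 \<le> s" "s \<le> t" for s t
    using alpha_integrable_of_decay[OF M a _ that, of "alpha S q d"] decay by auto
  have al_eq: "alpha S q d t = (INF i\<in>I. - (B_star2 S q d t i i + (\<Sum>\<^sub>\<infinity>j\<in>I - {i}. \<bar>B_star2 S q d t j i\<bar>)))" for t
    by (simp add: alpha_def alpha_i_def)
  show ?thesis
  proof (rule l1_energy_decay[where \<gamma> = ?\<gamma> and c = C and h = h and C = K])
    show "?\<gamma> absolutely_integrable_on {s..T}"
      by (intro set_integral_diff(1) al(1) sT) auto
    show "AE t in lebesgue. s \<le> t \<longrightarrow> t \<le> T \<longrightarrow> ?\<gamma> t \<le> C"
      using L
    proof eventually_elim
      case (elim t)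
      show ?case
      proof (intro impI)
        assume "s \<le> t" "t \<le> T"
        then have "mat_norm I (B_star2 S q d t) \<le> ennreal C" using elim sT by (simp add: regular_time_def)
        from log_norm_le(2)[OF this C k0] show "?\<gamma> t \<le> C" using \<delta> unfolding al_eq by linarith
      qed
    qed
    show "exp (- integral {t..T} ?\<gamma>) \<le> M * exp (- (a - \<delta>) * (T - t))" if t: "s \<le> t" "t \<le> T" for t
    proof -
      have t0: "0 \<le> t" using t sT by simp
      have "alpha S q d integrable_on {t..T}"
        using al(1)[OF t0 t(2)] by (rule set_lebesgue_integral_eq_integral(1))
      then have "integral {t..T} ?\<gamma> = integral {t..T} (alpha S q d) - \<delta> * (T - t)"
        using Henstock_Kurzweil_Integration.integral_diff[of "alpha S q d" "{t..T}" "\<lambda>_. \<delta>"] t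
        by (simp add: integrable_const_ivl mult.commute)
      then have "exp (- integral {t..T} ?\<gamma>) = exp (- integral {t..T} (alpha S q d)) * exp (\<delta> * (T - t))"
        by (simp flip: exp_add)
      also have "\<dots> \<le> M * exp (- a * (T - t)) * exp (\<delta> * (T - t))"
        by (rule mult_right_mono[OF al(2)[OF t0 t(2)]]) simp
      also have "\<dots> = M * exp (- (a - \<delta>) * (T - t))"
        by (simp add: mult.assoc algebra_simps flip: exp_add)
      finally show ?thesis .
    qed
    show "AE t in lebesgue. s \<le> t \<longrightarrow> t \<le> T \<longrightarrow> (\<forall>F. finite F \<longrightarrow> F \<subseteq> I \<longrightarrow>
         (\<Sum>i\<in>F. \<bar>C * u t i + h t i\<bar>) \<le> (C - ?\<gamma> t) * (\<Sum>\<^sub>\<infinity>i\<in>I. \<bar>u t i\<bar>) + G)"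
      using L rep
    proof eventually_elim
      case (elim t)
      show ?case
      proof (intro impI allI)
        fix F assume t: "s \<le> t" "t \<le> T" and F: "finite F" "F \<subseteq> I"
        from t have b: "mat_norm I (B_star2 S q d t) \<le> ennreal C" using elim(1) sT by (simp add: regular_time_def)
        from elim(2) t obtain r where r: "\<And>i. i \<in> I \<Longrightarrow> h t i = (\<Sum>\<^sub>\<infinity>k\<in>I. B_star2 S q d t i k * u t k) + r i"
          and rb: "(\<Sum>i\<in>F. \<bar>r i\<bar>) \<le> \<delta> * (\<Sum>\<^sub>\<infinity>i\<in>I. \<bar>u t i\<bar>) + G"
          using F by blast
        have "(\<Sum>i\<in>F. \<bar>C * u t i + h t i\<bar>) = (\<Sum>i\<in>F. \<bar>C * u t i + ((\<Sum>\<^sub>\<infinity>k\<in>I. B_star2 S q d t i k * u t k) + r i)\<bar>)"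
          using r F by (intro sum.cong) auto
        also have "\<dots> \<le> (C - alpha S q d t) * (\<Sum>\<^sub>\<infinity>k\<in>I. \<bar>u t k\<bar>) + (\<Sum>i\<in>F. \<bar>r i\<bar>)"
          unfolding al_eq by (rule log_norm_dissipation[OF b C F summ[OF t]])
        also have "\<dots> \<le> (C - alpha S q d t) * (\<Sum>\<^sub>\<infinity>k\<in>I. \<bar>u t k\<bar>) + (\<delta> * (\<Sum>\<^sub>\<infinity>i\<in>I. \<bar>u t i\<bar>) + G)"
          using rb by simp
        finally show "(\<Sum>i\<in>F. \<bar>C * u t i + h t i\<bar>) \<le> (C - ?\<gamma> t) * (\<Sum>\<^sub>\<infinity>i\<in>I. \<bar>u t i\<bar>) + G"
          by (simp add: algebra_simps)
      qed
    qed
  qed (use sT M \<delta> G summ bnd ai weak in \<open>auto simp: summable_abs_iff\<close>)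
qed

lemma drift_expansion:
  assumes R: "regular_time S d q L C c t" and C: "0 \<le> C" and i: "i \<in> I"
    and sub: "set_pmf (p t) \<subseteq> states S" and w: "weighted_l1 (pmf (p t))"
  shows "drift S d q p t i = (\<Sum>\<^sub>\<infinity>m\<in>I. B_star2 S q d t i m * D_vec S d (pmf (p t)) m) + tail_flow S d (A_mat S q t) i 0"
proof -
  have g: "generator S L (A_mat S q t)" and b: "mat_norm I (B_star2 S q d t) \<le> ennreal C"
    using R by (auto simp: regular_time_def)
  have "\<bar>conj_D S d (\<lambda>i j. A_mat S q t i j - A_mat S q t i 0) i m\<bar> \<le> C" if "m \<in> I" for m
    using mat_norm_entry_le[OF b C that i] by (simp add: B_star2_def B_mat_eq)
  from tail_flow_summation_by_parts[OF g i w this] show ?thesis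
    using infsum_pmf_eq_1[OF sub] by (simp add: B_star2_def B_mat_eq)
qed

lemma weighted_l1_diff:
  assumes x: "weighted_l1 x" and y: "weighted_l1 y"
  shows "weighted_l1 (\<lambda>k. x k - y k)"
    and "norm_D (\<lambda>k. x k - y k) \<le> norm_D x + norm_D y"
proof -
  show w: "weighted_l1 (\<lambda>k. x k - y k)"
  proof (rule summable_on_abs_bound[OF summable_on_add[OF x y]])
    fix k
    have "\<bar>cum_weight d k * \<bar>x k - y k\<bar>\<bar> = cum_weight d k * \<bar>x k - y k\<bar>"
      using cum_weight_nonneg[of k] by (simp add: abs_mult)
    also have "\<dots> \<le> cum_weight d k * (\<bar>x k\<bar> + \<bar>y k\<bar>)"
      using cum_weight_nonneg[of k] by (intro mult_left_mono) auto
    finally show "\<bar>cum_weight d k * \<bar>x k - y k\<bar>\<bar> \<le> cum_weight d k * \<bar>x k\<bar> + cum_weight d k * \<bar>y k\<bar>"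
      by (simp add: distrib_left)
  qed
  note ws = weighted_summable
  have sx: "(\<lambda>i. \<bar>D_vec S d x i\<bar>) summable_on I" "(\<lambda>i. \<bar>D_vec S d y i\<bar>) summable_on I"
    "(\<lambda>i. \<bar>D_vec S d (\<lambda>k. x k - y k) i\<bar>) summable_on I"
    using ws(2)[OF x] ws(2)[OF y] ws(2)[OF w] by (simp_all add: summable_abs_iff)
  have "norm_D (\<lambda>k. x k - y k) \<le> (\<Sum>\<^sub>\<infinity>i\<in>I. \<bar>D_vec S d x i\<bar> + \<bar>D_vec S d y i\<bar>)"
    by (rule infsum_mono[OF sx(3) summable_on_add[OF sx(1,2)]])
       (simp add: D_vec_diff[OF ws(1)[OF x] ws(1)[OF y]])
  then show "norm_D (\<lambda>k. x k - y k) \<le> norm_D x + norm_D y" by (simp add: infsum_add[OF sx(1,2)])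
qed

end


section \<open>Contraction, boundedness and stability\<close>

context weights
begin

lemma difference_weak_form:
  fixes C :: real
  assumes q1: "bounded_intensities S q1" and fs1: "forward_solution S q1 s p1"
    and q2: "bounded_intensities S q2" and fs2: "forward_solution S q2 s p2"
    and s: "0 \<le> s" "s \<le> T" and i: "i \<in> I"
  defines "u \<equiv> \<lambda>t. D_vec S d (\<lambda>j. pmf (p1 t) j - pmf (p2 t) j) i"
    and "h \<equiv> \<lambda>t. drift S d q1 p1 t i - drift S d q2 p2 t i"
  shows "(\<lambda>t. exp (C * t) * (C * u t + h t)) absolutely_integrable_on {s..T}"
    and "\<And>r t. \<lbrakk>s \<le> r; r \<le> t; t \<le> T\<rbrakk> \<Longrightarrow>
      ((\<lambda>t. exp (C * t) * (C * u t + h t)) has_integral (exp (C * t) * u t - exp (C * r) * u r)) {r..t}"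
proof -
  note w1 = forward_weak_form[OF q1 fs1 s i, where c = C] and w2 = forward_weak_form[OF q2 fs2 s i, where c = C]
  have u: "u t = D_vec S d (pmf (p1 t)) i - D_vec S d (pmf (p2 t)) i" for t
    unfolding u_def by (rule D_vec_diff[OF summable_pmf summable_pmf i])
  have eq: "exp (C * t) * (C * u t + h t)
     = exp (C * t) * (C * D_vec S d (pmf (p1 t)) i + drift S d q1 p1 t i)
     - exp (C * t) * (C * D_vec S d (pmf (p2 t)) i + drift S d q2 p2 t i)" for t
    unfolding u h_def by (simp add: algebra_simps)
  show "(\<lambda>t. exp (C * t) * (C * u t + h t)) absolutely_integrable_on {s..T}"
    unfolding eq by (rule set_integral_diff(1)[OF w1(1) w2(1)])
  fix r t assume rt: "s \<le> r" "r \<le> t" "t \<le> T"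
  have "exp (C * t) * u t - exp (C * r) * u r
     = (exp (C * t) * D_vec S d (pmf (p1 t)) i - exp (C * r) * D_vec S d (pmf (p1 r)) i)
     - (exp (C * t) * D_vec S d (pmf (p2 t)) i - exp (C * r) * D_vec S d (pmf (p2 r)) i)"
    unfolding u by (simp add: algebra_simps)
  then show "((\<lambda>t. exp (C * t) * (C * u t + h t)) has_integral (exp (C * t) * u t - exp (C * r) * u r)) {r..t}"
    unfolding eq using has_integral_diff[OF w1(2)[OF rt] w2(2)[OF rt]] by simp
qed

lemma lyapunov_uniform:
  assumes ch: "bounded_chain S d q C c" and fs: "forward_solution S q s p"
    and s: "0 \<le> s" and t: "s \<le> t" "t \<le> T" and w: "weighted_l1 (pmf (p s))"
  shows "norm_D (pmf (p t)) \<le> exp (C * T) * (norm_D (pmf (p s)) + c * (T - s))"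
proof -
  have Cc: "0 \<le> C" "0 \<le> c" using ch by (auto simp: bounded_chain_def)
  have "norm_D (pmf (p t)) \<le> exp (C * t) * (norm_D (pmf (p s)) + c * (t - s))"
    by (rule lyapunov_weighted(2)[OF ch fs s t(1) w])
  also have "\<dots> \<le> exp (C * T) * (norm_D (pmf (p s)) + c * (T - s))"
    using Cc t s norm_D_nonneg[of "pmf (p s)"] by (intro mult_mono add_mono) (auto intro: mult_left_mono add_nonneg_nonneg)
  finally show ?thesis .
qed

end

locale decaying_chain = weights +
  fixes q :: "nat \<Rightarrow> nat \<Rightarrow> real \<Rightarrow> real" and C c M a :: real
  assumes chain: "bounded_chain S d q C c"
    and M: "0 < M" and a: "0 < a"
    and decay: "\<And>s t. 0 \<le> s \<Longrightarrow> s \<le> t \<Longrightarrow>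
      exp (- (LINT \<tau>:{s..t}|lebesgue. alpha S q d \<tau>)) \<le> M * exp (- a * (t - s))"
begin

lemma M_ge_1: "1 \<le> M"
  using alpha_integrable_of_decay(2)[OF M a decay, of 0 0] by simp

lemma C_nonneg: "0 \<le> C" "0 \<le> c"
  using chain by (auto simp: bounded_chain_def)

lemma solution_bound:
  assumes fs: "forward_solution S q s p" and s: "0 \<le> s" "s \<le> T" and w: "weighted_l1 (pmf (p s))"
  shows "norm_D (pmf (p T)) \<le> M * exp (- a * (T - s)) * norm_D (pmf (p s)) + c * M / a"
proof -
  have q: "bounded_intensities S q" using chain by (simp add: bounded_chain_def)
  obtain L where L: "AE t in lebesgue. 0 \<le> t \<longrightarrow> regular_time S d q L C c t" using AE_regular_time[OF chain] .
  have w': "weighted_l1 (pmf (p t))" if "s \<le> t" for t by (rule lyapunov_weighted(1)[OF chain fs s(1) that w])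
  have "norm_D (pmf (p T)) \<le> M * exp (- (a - 0) * (T - s)) * norm_D (pmf (p s)) + c * M / (a - 0)"
  proof (rule perturbed_energy[OF chain M a decay _ _ C_nonneg(2) s, where h = "\<lambda>t. drift S d q p t"])
    show "D_vec S d (pmf (p t)) summable_on I" if "s \<le> t" for t
      by (rule weighted_summable(2)[OF w'[OF that]])
    show "norm_D (pmf (p t)) \<le> exp (C * T) * (norm_D (pmf (p s)) + c * (T - s))" if "s \<le> t" "t \<le> T" for t
      by (rule lyapunov_uniform[OF chain fs s(1) that w])
    show "AE t in lebesgue. s \<le> t \<longrightarrow> t \<le> T \<longrightarrow>
       (\<exists>r. (\<forall>i\<in>I. drift S d q p t i = (\<Sum>\<^sub>\<infinity>k\<in>I. B_star2 S q d t i k * D_vec S d (pmf (p t)) k) + r i) \<and>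
         (\<forall>F. finite F \<longrightarrow> F \<subseteq> I \<longrightarrow> (\<Sum>i\<in>F. \<bar>r i\<bar>) \<le> 0 * norm_D (pmf (p t)) + c))"
      using L
    proof eventually_elim
      case (elim t)
      show ?case
      proof (intro impI exI[of _ "\<lambda>i. tail_flow S d (A_mat S q t) i 0"] conjI ballI allI)
        assume t: "s \<le> t" "t \<le> T"
        then have R: "regular_time S d q L C c t" using elim s by simp
        have sub: "set_pmf (p t) \<subseteq> states S" using fs t by (auto simp: forward_solution_def)
        fix i assume "i \<in> I"
        then show "drift S d q p t i = (\<Sum>\<^sub>\<infinity>k\<in>I. B_star2 S q d t i k * D_vec S d (pmf (p t)) k) + tail_flow S d (A_mat S q t) i 0"
          by (rule drift_expansion[where p = p, OF R C_nonneg(1) _ sub w'[OF t(1)]])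
      next
        fix F assume t: "s \<le> t" "t \<le> T" and F: "finite F" "F \<subseteq> I"
        then have "l1_norm I (\<lambda>i. tail_flow S d (A_mat S q t) i 0) \<le> ennreal c"
          using elim s by (simp add: regular_time_def)
        then show "(\<Sum>i\<in>F. \<bar>tail_flow S d (A_mat S q t) i 0\<bar>) \<le> 0 * norm_D (pmf (p t)) + c"
          using l1_norm_finite_le[OF _ C_nonneg(2) F] by simp
      qed
    qed
  qed (use a forward_weak_form[OF q fs s] in auto)
  then show ?thesis by simp
qed

text \<open>
The two solutions may belong to different chains. The Lyapunov bound for each of them provides the a
priori bound that the energy estimate needs, so only the form of the drift difference is
left to the applications.
\<close>

lemma difference_energy:
  assumes ch1: "bounded_chain S d q1 C1 c1" and fs1: "forward_solution S q1 s p1" and w1: "weighted_l1 (pmf (p1 s))"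
    and ch2: "bounded_chain S d q2 C2 c2" and fs2: "forward_solution S q2 s p2" and w2: "weighted_l1 (pmf (p2 s))"
    and \<delta>: "0 \<le> \<delta>" "\<delta> < a" and G: "0 \<le> G" and s: "0 \<le> s" "s \<le> T"
  defines "x \<equiv> \<lambda>t j. pmf (p1 t) j - pmf (p2 t) j"
  assumes rep: "AE t in lebesgue. s \<le> t \<longrightarrow> t \<le> T \<longrightarrow>
     (\<exists>r. (\<forall>i\<in>I. drift S d q1 p1 t i - drift S d q2 p2 t i
            = mat_vec I (B_star2 S q d t) (D_vec S d (x t)) i + r i) \<and>
       (\<forall>F. finite F \<longrightarrow> F \<subseteq> I \<longrightarrow> (\<Sum>i\<in>F. \<bar>r i\<bar>) \<le> \<delta> * norm_D (x t) + G))"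
  shows "norm_D (x T) \<le> M * exp (- (a - \<delta>) * (T - s)) * norm_D (x s) + G * M / (a - \<delta>)"
proof -
  have q: "bounded_intensities S q1" "bounded_intensities S q2"
    using ch1 ch2 by (simp_all add: bounded_chain_def)
  have w1': "weighted_l1 (pmf (p1 t))" and w2': "weighted_l1 (pmf (p2 t))" if "s \<le> t" for t
    by (rule lyapunov_weighted(1)[OF ch1 fs1 s(1) that w1] lyapunov_weighted(1)[OF ch2 fs2 s(1) that w2])+
  let ?K = "exp (C1 * T) * (norm_D (pmf (p1 s)) + c1 * (T - s)) +
            exp (C2 * T) * (norm_D (pmf (p2 s)) + c2 * (T - s))"
  show ?thesis
  proof (rule perturbed_energy[OF chain M a decay \<delta> G s,
        where h = "\<lambda>t i. drift S d q1 p1 t i - drift S d q2 p2 t i" and K = ?K])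
    show "D_vec S d (x t) summable_on I" if "s \<le> t" for t
      unfolding x_def by (rule weighted_summable(2)[OF weighted_l1_diff(1)[OF w1'[OF that] w2'[OF that]]])
    show "norm_D (x t) \<le> ?K" if t: "s \<le> t" "t \<le> T" for t
      using weighted_l1_diff(2)[OF w1'[OF t(1)] w2'[OF t(1)]] lyapunov_uniform[OF ch1 fs1 s(1) t w1]
        lyapunov_uniform[OF ch2 fs2 s(1) t w2] unfolding x_def by linarith
  qed (use difference_weak_form[OF q(1) fs1 q(2) fs2 s] rep in \<open>auto simp: x_def mat_vec_def[of _ "B_star2 S q d _"]\<close>)
qed

end

locale perturbed_chain = decaying_chain +
  fixes q' :: "nat \<Rightarrow> nat \<Rightarrow> real \<Rightarrow> real" and \<Delta>B \<Delta>f :: real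
  assumes q': "bounded_intensities S q'"
    and \<Delta>B: "0 \<le> \<Delta>B" "\<Delta>B < a" and \<Delta>f: "0 \<le> \<Delta>f"
    and B_close: "AE t in lebesgue. 0 \<le> t \<longrightarrow>
         mat_norm1D S d (\<lambda>i j. B_mat S q t i j - B_mat S q' t i j) \<le> ennreal \<Delta>B"
    and f_close: "AE t in lebesgue. 0 \<le> t \<longrightarrow>
         norm1D S d (\<lambda>i. f_vec S q t i - f_vec S q' t i) \<le> ennreal \<Delta>f"
begin

lemmas close = AE_close_time(1)[OF chain q' B_close f_close \<Delta>B(1) \<Delta>f]
lemmas chain' = AE_close_time(2)[OF chain q' B_close f_close \<Delta>B(1) \<Delta>f]

lemma AE_regular:
  obtains L L' where "AE t in lebesgue. 0 \<le> t \<longrightarrow> regular_time S d q L C c t \<and>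
     regular_time S d q' L' (C + \<Delta>B) (c + \<Delta>f) t \<and> close_time S d q q' \<Delta>B \<Delta>f t"
proof -
  obtain L where L: "AE t in lebesgue. 0 \<le> t \<longrightarrow> regular_time S d q L C c t" using AE_regular_time[OF chain] .
  obtain L' where L': "AE t in lebesgue. 0 \<le> t \<longrightarrow> regular_time S d q' L' (C + \<Delta>B) (c + \<Delta>f) t"
    using AE_regular_time[OF chain'] .
  have "AE t in lebesgue. 0 \<le> t \<longrightarrow> regular_time S d q L C c t \<and>
     regular_time S d q' L' (C + \<Delta>B) (c + \<Delta>f) t \<and> close_time S d q q' \<Delta>B \<Delta>f t"
    using L L' close by eventually_elim auto
  then show thesis by (rule that)
qed

lemma C'_nonneg: "0 \<le> C + \<Delta>B" "0 \<le> c + \<Delta>f"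
  using C_nonneg \<Delta>B \<Delta>f by auto

lemma star_entries:
  assumes "regular_time S d q L C c t" "regular_time S d q' L' (C + \<Delta>B) (c + \<Delta>f) t"
    and "i \<in> I" "k \<in> I"
  shows "\<bar>B_star2 S q d t i k\<bar> \<le> C" "\<bar>B_star2 S q' d t i k\<bar> \<le> C + \<Delta>B"
  using mat_norm_entry_le[OF _ C_nonneg(1) assms(4,3)] mat_norm_entry_le[OF _ C'_nonneg(1) assms(4,3)] assms(1,2)
  by (auto simp: regular_time_def)

lemma perturbation_l1:
  assumes ct: "close_time S d q q' \<Delta>B \<Delta>f t" and F: "finite F" "F \<subseteq> I"
    and y: "y summable_on I"
  shows "(\<Sum>i\<in>F. \<bar>mat_vec I (\<lambda>i k. B_star2 S q d t i k - B_star2 S q' d t i k) y i\<bar>)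
     \<le> \<Delta>B * (\<Sum>\<^sub>\<infinity>k\<in>I. \<bar>y k\<bar>)"
  unfolding mat_vec_def
proof (rule column_bound_l1[OF F(1) y])
  fix k assume "k \<in> I"
  then show "(\<Sum>i\<in>F. \<bar>B_star2 S q d t i k - B_star2 S q' d t i k\<bar>) \<le> \<Delta>B"
    using mat_norm_finite_le[of "I" "\<lambda>i k. B_star2 S q d t i k - B_star2 S q' d t i k" \<Delta>B k F] ct F \<Delta>B
    by (simp add: close_time_def)
qed

text \<open>
Two solutions of the perturbed chain: the terms \<open>D f'\<close> cancel and \<open>B'\<^sup>*\<^sup>* v = B\<^sup>*\<^sup>* v - (B\<^sup>*\<^sup>* - B'\<^sup>*\<^sup>*) v\<close>.
\<close>

lemma contraction:
  assumes fs1: "forward_solution S q' s p1" and fs2: "forward_solution S q' s p2"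
    and s: "0 \<le> s" "s \<le> T" and w1: "weighted_l1 (pmf (p1 s))" and w2: "weighted_l1 (pmf (p2 s))"
  shows "norm_D (\<lambda>j. pmf (p1 T) j - pmf (p2 T) j)
     \<le> M * exp (- (a - \<Delta>B) * (T - s)) * norm_D (\<lambda>j. pmf (p1 s) j - pmf (p2 s) j)"
proof -
  obtain L L' where L: "AE t in lebesgue. 0 \<le> t \<longrightarrow> regular_time S d q L C c t \<and>
     regular_time S d q' L' (C + \<Delta>B) (c + \<Delta>f) t \<and> close_time S d q q' \<Delta>B \<Delta>f t"
    using AE_regular .
  let ?v = "\<lambda>t. D_vec S d (\<lambda>j. pmf (p1 t) j - pmf (p2 t) j)"
  have w1': "weighted_l1 (pmf (p1 t))" and w2': "weighted_l1 (pmf (p2 t))" if "s \<le> t" for t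
    by (rule lyapunov_weighted(1)[OF chain' fs1 s(1) that w1] lyapunov_weighted(1)[OF chain' fs2 s(1) that w2])+
  have wd: "weighted_l1 (\<lambda>j. pmf (p1 t) j - pmf (p2 t) j)" if "s \<le> t" for t
    by (rule weighted_l1_diff(1)[OF w1'[OF that] w2'[OF that]])
  have "norm_D (\<lambda>j. pmf (p1 T) j - pmf (p2 T) j) \<le>
      M * exp (- (a - \<Delta>B) * (T - s)) * norm_D (\<lambda>j. pmf (p1 s) j - pmf (p2 s) j) + 0 * M / (a - \<Delta>B)"
  proof (rule difference_energy[OF chain' fs1 w1 chain' fs2 w2 \<Delta>B order_refl s])
    show "AE t in lebesgue. s \<le> t \<longrightarrow> t \<le> T \<longrightarrow>
       (\<exists>r. (\<forall>i\<in>I. drift S d q' p1 t i - drift S d q' p2 t i = mat_vec I (B_star2 S q d t) (?v t) i + r i) \<and>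
         (\<forall>F. finite F \<longrightarrow> F \<subseteq> I \<longrightarrow> (\<Sum>i\<in>F. \<bar>r i\<bar>) \<le> \<Delta>B * norm_D (\<lambda>j. pmf (p1 t) j - pmf (p2 t) j) + 0))"
      using L
    proof eventually_elim
      case (elim t)
      let ?b = "B_star2 S q d t" and ?b' = "B_star2 S q' d t"
      show ?case
      proof (intro impI exI[of _ "\<lambda>i. - mat_vec I (\<lambda>i k. ?b i k - ?b' i k) (?v t) i"] conjI ballI allI)
        assume t: "s \<le> t" "t \<le> T"
        then have R: "regular_time S d q L C c t" "regular_time S d q' L' (C + \<Delta>B) (c + \<Delta>f) t"
          using elim s by auto
        have sub: "set_pmf (p1 t) \<subseteq> states S" "set_pmf (p2 t) \<subseteq> states S"
          using fs1 fs2 t by (auto simp: forward_solution_def)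
        have u: "D_vec S d (pmf (p1 t)) summable_on I" "D_vec S d (pmf (p2 t)) summable_on I" "?v t summable_on I"
          by (rule weighted_summable(2)[OF w1'[OF t(1)]] weighted_summable(2)[OF w2'[OF t(1)]]
            weighted_summable(2)[OF wd[OF t(1)]])+
        fix i assume i: "i \<in> I"
        have "drift S d q' p1 t i - drift S d q' p2 t i
            = mat_vec I ?b' (D_vec S d (pmf (p1 t))) i - mat_vec I ?b' (D_vec S d (pmf (p2 t))) i"
          unfolding drift_expansion[where p = p1, OF R(2) C'_nonneg(1) i sub(1) w1'[OF t(1)]]
            drift_expansion[where p = p2, OF R(2) C'_nonneg(1) i sub(2) w2'[OF t(1)]] by (simp add: mat_vec_def)
        also have "\<dots> = mat_vec I ?b' (\<lambda>k. D_vec S d (pmf (p1 t)) k - D_vec S d (pmf (p2 t)) k) i"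
          by (rule mat_vec_diff(2)[where X = ?b', OF star_entries(2)[OF R i] u(1,2), symmetric])
        also have "\<dots> = mat_vec I ?b' (?v t) i"
          unfolding mat_vec_def[of I ?b'] by (rule infsum_cong) (simp add: D_vec_diff[OF summable_pmf summable_pmf])
        also have "\<dots> = mat_vec I ?b (?v t) i - mat_vec I (\<lambda>i k. ?b i k - ?b' i k) (?v t) i"
          using mat_vec_diff(3)[where X = ?b and Y = ?b', OF star_entries(1)[OF R i] u(3) star_entries(2)[OF R i]] by simp
        finally show "drift S d q' p1 t i - drift S d q' p2 t i = mat_vec I ?b (?v t) i
            + - mat_vec I (\<lambda>i k. ?b i k - ?b' i k) (?v t) i" by simp
      next
        fix F assume t: "s \<le> t" "t \<le> T" and F: "finite F" "F \<subseteq> I"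
        have ct: "close_time S d q q' \<Delta>B \<Delta>f t" using elim t s by auto
        show "(\<Sum>i\<in>F. \<bar>- mat_vec I (\<lambda>i k. ?b i k - ?b' i k) (?v t) i\<bar>)
            \<le> \<Delta>B * norm_D (\<lambda>j. pmf (p1 t) j - pmf (p2 t) j) + 0"
          using perturbation_l1[OF ct F weighted_summable(2)[OF wd[OF t(1)]]] by simp
      qed
    qed
  qed
  then show ?thesis by simp
qed

text \<open>
One solution of each chain: with \<open>\<delta> = B\<^sup>*\<^sup>* - B'\<^sup>*\<^sup>*\<close>, the difference of the drifts is \<open>B\<^sup>*\<^sup>* v + \<delta> u\<^sub>1 - \<delta> v + D (f - f')\<close>.
Here \<open>\<delta> v\<close> lowers the decay rate by \<open>\<Delta>B\<close>, and only \<open>\<delta> u\<^sub>1\<close>, which involves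
the solution of the unperturbed chain, counts as an inhomogeneity.
\<close>

lemma stability:
  assumes fs1: "forward_solution S q s p1" and fs2: "forward_solution S q' s p2"
    and s: "0 \<le> s" "s \<le> T" and w1: "weighted_l1 (pmf (p1 s))" and w2: "weighted_l1 (pmf (p2 s))"
    and Z: "\<And>t. s \<le> t \<Longrightarrow> norm_D (pmf (p1 t)) \<le> Z"
  shows "norm_D (\<lambda>j. pmf (p1 T) j - pmf (p2 T) j)
     \<le> M * exp (- (a - \<Delta>B) * (T - s)) * norm_D (\<lambda>j. pmf (p1 s) j - pmf (p2 s) j)
       + (\<Delta>B * Z + \<Delta>f) * M / (a - \<Delta>B)"
proof -
  obtain L L' where L: "AE t in lebesgue. 0 \<le> t \<longrightarrow> regular_time S d q L C c t \<and>
     regular_time S d q' L' (C + \<Delta>B) (c + \<Delta>f) t \<and> close_time S d q q' \<Delta>B \<Delta>f t"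
    using AE_regular .
  let ?v = "\<lambda>t. D_vec S d (\<lambda>j. pmf (p1 t) j - pmf (p2 t) j)"
  have w1': "weighted_l1 (pmf (p1 t))" and w2': "weighted_l1 (pmf (p2 t))" if "s \<le> t" for t
    by (rule lyapunov_weighted(1)[OF chain fs1 s(1) that w1] lyapunov_weighted(1)[OF chain' fs2 s(1) that w2])+
  have wd: "weighted_l1 (\<lambda>j. pmf (p1 t) j - pmf (p2 t) j)" if "s \<le> t" for t
    by (rule weighted_l1_diff(1)[OF w1'[OF that] w2'[OF that]])
  have Z0: "0 \<le> Z" using Z[OF order_refl] norm_D_nonneg[of "pmf (p1 s)"] by linarith
  then have G0: "0 \<le> \<Delta>B * Z + \<Delta>f" using \<Delta>B \<Delta>f by simp
  show ?thesis
  proof (rule difference_energy[OF chain fs1 w1 chain' fs2 w2 \<Delta>B G0 s])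
    show "AE t in lebesgue. s \<le> t \<longrightarrow> t \<le> T \<longrightarrow>
       (\<exists>r. (\<forall>i\<in>I. drift S d q p1 t i - drift S d q' p2 t i = mat_vec I (B_star2 S q d t) (?v t) i + r i) \<and>
         (\<forall>F. finite F \<longrightarrow> F \<subseteq> I \<longrightarrow> (\<Sum>i\<in>F. \<bar>r i\<bar>) \<le>
            \<Delta>B * norm_D (\<lambda>j. pmf (p1 t) j - pmf (p2 t) j) + (\<Delta>B * Z + \<Delta>f)))"
      using L
    proof eventually_elim
      case (elim t)
      let ?b = "B_star2 S q d t" and ?b' = "B_star2 S q' d t"
      let ?\<delta> = "\<lambda>i k. ?b i k - ?b' i k"
      let ?g = "\<lambda>i. tail_flow S d (A_mat S q t) i 0 - tail_flow S d (A_mat S q' t) i 0"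
      let ?u1 = "D_vec S d (pmf (p1 t))" and ?u2 = "D_vec S d (pmf (p2 t))"
      show ?case
      proof (intro impI exI[of _ "\<lambda>i. (mat_vec I ?\<delta> ?u1 i - mat_vec I ?\<delta> (?v t) i) + ?g i"] conjI ballI allI)
        assume t: "s \<le> t" "t \<le> T"
        then have R: "regular_time S d q L C c t" "regular_time S d q' L' (C + \<Delta>B) (c + \<Delta>f) t"
          using elim s by auto
        have sub: "set_pmf (p1 t) \<subseteq> states S" "set_pmf (p2 t) \<subseteq> states S"
          using fs1 fs2 t by (auto simp: forward_solution_def)
        have u: "?u1 summable_on I" "?u2 summable_on I" "?v t summable_on I"
          by (rule weighted_summable(2)[OF w1'[OF t(1)]] weighted_summable(2)[OF w2'[OF t(1)]]
            weighted_summable(2)[OF wd[OF t(1)]])+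
        fix i assume i: "i \<in> I"
        note e = star_entries(1)[OF R i] and e' = star_entries(2)[OF R i]
        have v: "mat_vec I X (?v t) i = mat_vec I X (\<lambda>k. ?u1 k - ?u2 k) i" for X
          unfolding mat_vec_def[of I X] by (rule infsum_cong) (simp add: D_vec_diff[OF summable_pmf summable_pmf])
        have "drift S d q p1 t i - drift S d q' p2 t i = mat_vec I ?b ?u1 i - mat_vec I ?b' ?u2 i + ?g i"
          unfolding drift_expansion[where p = p1, OF R(1) C_nonneg(1) i sub(1) w1'[OF t(1)]]
            drift_expansion[where p = p2, OF R(2) C'_nonneg(1) i sub(2) w2'[OF t(1)]] by (simp add: mat_vec_def)
        moreover have "mat_vec I ?b (?v t) i = mat_vec I ?b ?u1 i - mat_vec I ?b ?u2 i"
          unfolding v by (rule mat_vec_diff(2)[where X = ?b, OF e u(1,2)])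
        moreover have "mat_vec I ?b' (?v t) i = mat_vec I ?b' ?u1 i - mat_vec I ?b' ?u2 i"
          unfolding v by (rule mat_vec_diff(2)[where X = ?b', OF e' u(1,2)])
        moreover have "mat_vec I ?\<delta> ?u1 i = mat_vec I ?b ?u1 i - mat_vec I ?b' ?u1 i"
          by (rule mat_vec_diff(3)[where X = ?b and Y = ?b', OF e u(1) e'])
        moreover have "mat_vec I ?\<delta> (?v t) i = mat_vec I ?b (?v t) i - mat_vec I ?b' (?v t) i"
          by (rule mat_vec_diff(3)[where X = ?b and Y = ?b', OF e u(3) e'])
        ultimately show "drift S d q p1 t i - drift S d q' p2 t i = mat_vec I ?b (?v t) i
            + ((mat_vec I ?\<delta> ?u1 i - mat_vec I ?\<delta> (?v t) i) + ?g i)"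
          by linarith
      next
        fix F assume t: "s \<le> t" "t \<le> T" and F: "finite F" "F \<subseteq> I"
        have ct: "close_time S d q q' \<Delta>B \<Delta>f t" using elim t s by auto
        have "(\<Sum>i\<in>F. \<bar>(mat_vec I ?\<delta> ?u1 i - mat_vec I ?\<delta> (?v t) i) + ?g i\<bar>)
           \<le> (\<Sum>i\<in>F. \<bar>mat_vec I ?\<delta> ?u1 i\<bar> + \<bar>mat_vec I ?\<delta> (?v t) i\<bar> + \<bar>?g i\<bar>)"
          by (rule sum_mono) linarith
        also have "\<dots> = (\<Sum>i\<in>F. \<bar>mat_vec I ?\<delta> ?u1 i\<bar>) + (\<Sum>i\<in>F. \<bar>mat_vec I ?\<delta> (?v t) i\<bar>) + (\<Sum>i\<in>F. \<bar>?g i\<bar>)"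
          by (simp add: sum.distrib)
        also have "\<dots> \<le> \<Delta>B * norm_D (pmf (p1 t)) + \<Delta>B * norm_D (\<lambda>j. pmf (p1 t) j - pmf (p2 t) j) + \<Delta>f"
        proof (intro add_mono)
          show "(\<Sum>i\<in>F. \<bar>mat_vec I ?\<delta> ?u1 i\<bar>) \<le> \<Delta>B * norm_D (pmf (p1 t))"
            by (rule perturbation_l1[OF ct F weighted_summable(2)[OF w1'[OF t(1)]]])
          show "(\<Sum>i\<in>F. \<bar>mat_vec I ?\<delta> (?v t) i\<bar>) \<le> \<Delta>B * norm_D (\<lambda>j. pmf (p1 t) j - pmf (p2 t) j)"
            by (rule perturbation_l1[OF ct F weighted_summable(2)[OF wd[OF t(1)]]])
          show "(\<Sum>i\<in>F. \<bar>?g i\<bar>) \<le> \<Delta>f"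
            by (rule l1_norm_finite_le[OF _ \<Delta>f F]) (use ct in \<open>simp add: close_time_def\<close>)
        qed
        also have "\<Delta>B * norm_D (pmf (p1 t)) \<le> \<Delta>B * Z" by (rule mult_left_mono[OF Z[OF t(1)] \<Delta>B(1)])
        finally show "(\<Sum>i\<in>F. \<bar>(mat_vec I ?\<delta> ?u1 i - mat_vec I ?\<delta> (?v t) i) + ?g i\<bar>)
            \<le> \<Delta>B * norm_D (\<lambda>j. pmf (p1 t) j - pmf (p2 t) j) + (\<Delta>B * Z + \<Delta>f)" by simp
      qed
    qed
  qed
qed

end


section \<open>Means and the limiting estimates\<close>

lemma expectation_pmf_states:
  assumes sub: "set_pmf p \<subseteq> states S" and s: "(\<lambda>k. real k * pmf p k) summable_on pos_states S"
  shows "integrable (measure_pmf p) real"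
    and "measure_pmf.expectation p real = (\<Sum>\<^sub>\<infinity>k\<in>pos_states S. real k * pmf p k)"
proof -
  let ?f = "\<lambda>k. pmf p k * real k"
  have zero: "?f k = 0" if "k \<notin> pos_states S" for k
    using that sub by (cases "k = 0") (auto simp: pos_states_simps(3) set_pmf_iff)
  have "?f summable_on pos_states S" using s by (simp add: mult.commute)
  then have "?f summable_on UNIV"
    by (rule summable_on_cong_neutral[THEN iffD1, rotated -1]) (use zero in auto)
  then have su: "Infinite_Set_Sum.abs_summable_on ?f UNIV"
    unfolding abs_summable_equivalent[symmetric] by (simp add: summable_abs_iff)
  have d: "measure_pmf p = density (count_space UNIV) (\<lambda>x. ennreal (pmf p x))"
    by (rule measure_pmf_eq_density)
  show "integrable (measure_pmf p) real"
    unfolding d using su by (subst integrable_density) (auto simp: abs_summable_on_def)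
  have "measure_pmf.expectation p real = infsetsum ?f UNIV"
    unfolding d by (subst integral_density) (auto simp: infsetsum_def)
  also have "\<dots> = (\<Sum>\<^sub>\<infinity>k\<in>UNIV. ?f k)" by (rule infsetsum_infsum[OF su])
  also have "\<dots> = (\<Sum>\<^sub>\<infinity>k\<in>pos_states S. real k * pmf p k)"
    by (rule infsum_cong_neutral) (use zero in \<open>auto simp: mult.commute\<close>)
  finally show "measure_pmf.expectation p real = (\<Sum>\<^sub>\<infinity>k\<in>pos_states S. real k * pmf p k)" .
qed

context weights
begin

lemma l1D_pmf_iff: "pmf p \<in> l1D S d \<longleftrightarrow> weighted_l1 (pmf p)"
  by (rule l1D_weighted) (auto intro: summable_pmf)

lemma weighted_l1_return_pmf: "weighted_l1 (pmf (return_pmf k))"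
proof -
  have "(\<lambda>j. cum_weight d j * \<bar>pmf (return_pmf k) j\<bar>) summable_on ({k} \<inter> I)" by simp
  then show ?thesis
    by (rule summable_on_cong_neutral[THEN iffD1, rotated -1]) (auto simp: pmf_return indicator_def split: if_splits)
qed

text \<open>
With all weights equal to 1 the cumulative weight of \<open>k\<close> is \<open>k\<close>, so the mean is the sum of the
unweighted tails. The \<open>i\<close>-th weighted tail is \<open>d\<^sub>i \<ge> W\<close> times the unweighted one.
\<close>

lemma weighted_mean:
  assumes W: "0 < W" "\<And>i. i \<in> I \<Longrightarrow> W \<le> d i / real i" and x: "weighted_l1 x"
  shows "(\<lambda>k. real k * x k) summable_on I"
    and "\<bar>\<Sum>\<^sub>\<infinity>k\<in>I. real k * x k\<bar> \<le> norm_D x / W"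
proof -
  have one: "weights (\<lambda>_. 1)" by unfold_locales simp
  have cw: "cum_weight (\<lambda>_. 1) k = real k" for k by (simp add: cum_weight_def)
  have Wd: "W \<le> d i" if i: "i \<in> I" for i
  proof -
    have "W * 1 \<le> W * real i" using W(1) pos_states_simps(1)[OF i] by (intro mult_left_mono) auto
    also have "\<dots> \<le> d i" using W(2)[OF i] pos_states_simps(1)[OF i] by (simp add: field_simps)
    finally show ?thesis by simp
  qed
  have cwd: "W * real k \<le> cum_weight d k" if k: "k \<in> I" for k
  proof -
    have "(\<Sum>i=1..k. W) \<le> (\<Sum>i=1..k. d i)"
      by (rule sum_mono) (use Wd pos_states_simps(2)[OF k] in auto)
    then show ?thesis by (simp add: cum_weight_def mult.commute)
  qed
  have w1: "(\<lambda>k. cum_weight (\<lambda>_. 1) k * \<bar>x k\<bar>) summable_on I"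
  proof (rule summable_on_abs_bound)
    show "(\<lambda>k. 1 / W * (cum_weight d k * \<bar>x k\<bar>)) summable_on I"
      using x by (rule summable_on_cmult_right)
    fix k assume "k \<in> I"
    then have "W * real k * \<bar>x k\<bar> \<le> cum_weight d k * \<bar>x k\<bar>" by (intro mult_right_mono cwd) auto
    then show "\<bar>cum_weight (\<lambda>_. 1) k * \<bar>x k\<bar>\<bar> \<le> 1 / W * (cum_weight d k * \<bar>x k\<bar>)"
      using W(1) by (simp add: cw abs_mult field_simps)
  qed
  then have "(\<lambda>k. \<bar>real k * x k\<bar>) summable_on I" by (simp add: cw abs_mult)
  then show "(\<lambda>k. real k * x k) summable_on I" by (simp only: summable_abs_iff)
  have s1: "D_vec S (\<lambda>_. 1) x summable_on I" by (rule weights.weighted_summable(2)[OF one w1])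
  have sd: "D_vec S d x summable_on I" by (rule weighted_summable(2)[OF x])
  have "(\<Sum>\<^sub>\<infinity>k\<in>I. real k * x k) = (\<Sum>\<^sub>\<infinity>i\<in>I. D_vec S (\<lambda>_. 1) x i)"
    using weights.weighted_summable(5)[OF one w1] by (simp add: cw)
  also have "\<bar>\<dots>\<bar> \<le> (\<Sum>\<^sub>\<infinity>i\<in>I. \<bar>D_vec S (\<lambda>_. 1) x i\<bar>)" by (rule abs_infsum_le[OF s1])
  also have "\<dots> \<le> (\<Sum>\<^sub>\<infinity>i\<in>I. \<bar>D_vec S d x i\<bar> * (1 / W))"
  proof (rule infsum_mono)
    show "(\<lambda>i. \<bar>D_vec S (\<lambda>_. 1) x i\<bar>) summable_on I" using s1 by (simp add: summable_abs_iff)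
    show "(\<lambda>i. \<bar>D_vec S d x i\<bar> * (1 / W)) summable_on I"
      using sd by (intro summable_on_cmult_left) (simp add: summable_abs_iff)
    fix i assume i: "i \<in> I"
    have "D_vec S d x i = d i * D_vec S (\<lambda>_. 1) x i"
      unfolding mat_vec_def infsum_cmult_right'[symmetric]
      by (rule infsum_cong) (simp add: D_mat_def)
    then have "W * \<bar>D_vec S (\<lambda>_. 1) x i\<bar> \<le> \<bar>D_vec S d x i\<bar>"
      using Wd[OF i] W(1) by (simp add: abs_mult mult_right_mono)
    then show "\<bar>D_vec S (\<lambda>_. 1) x i\<bar> \<le> \<bar>D_vec S d x i\<bar> * (1 / W)"
      using W(1) by (simp add: field_simps)
  qed
  also have "\<dots> = norm_D x / W" by (simp add: infsum_cmult_left' del: mult_1_right times_divide_eq_right) simp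
  finally show "\<bar>\<Sum>\<^sub>\<infinity>k\<in>I. real k * x k\<bar> \<le> norm_D x / W" .
qed

lemma expectation_difference:
  assumes W: "0 < W" "\<And>i. i \<in> I \<Longrightarrow> W \<le> d i / real i"
    and sub: "set_pmf p1 \<subseteq> states S" "set_pmf p2 \<subseteq> states S" and w: "weighted_l1 (pmf p1)" "weighted_l1 (pmf p2)"
  shows "integrable (measure_pmf p1) real"
    and "\<bar>measure_pmf.expectation p1 real - measure_pmf.expectation p2 real\<bar>
      \<le> norm_D (\<lambda>j. pmf p1 j - pmf p2 j) / W"
proof -
  note m1 = weighted_mean(1)[OF W w(1)] and m2 = weighted_mean(1)[OF W w(2)]
  note e1 = expectation_pmf_states[OF sub(1) m1] and e2 = expectation_pmf_states[OF sub(2) m2]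
  show "integrable (measure_pmf p1) real" by (rule e1(1))
  have "measure_pmf.expectation p1 real - measure_pmf.expectation p2 real
      = (\<Sum>\<^sub>\<infinity>k\<in>I. real k * (pmf p1 k - pmf p2 k))"
    using infsum_add[OF m1 summable_on_uminus[THEN iffD2, OF m2]] e1(2) e2(2)
    by (simp add: infsum_uminus right_diff_distrib)
  then show "\<bar>measure_pmf.expectation p1 real - measure_pmf.expectation p2 real\<bar>
      \<le> norm_D (\<lambda>j. pmf p1 j - pmf p2 j) / W"
    using weighted_mean(2)[OF W weighted_l1_diff(1)[OF w]] by simp
qed

end

context perturbed_chain
begin

lemma ergodic: "exp_weakly_ergodic_1D S q' d"
  unfolding exp_weakly_ergodic_1D_def
proof (intro exI conjI allI impI)
  show "0 < M" by (rule M)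
  show "0 < a - \<Delta>B" using \<Delta>B by simp
  fix s t :: real and p1 p2
  assume s: "0 \<le> s" "s \<le> t" and fs: "forward_solution S q' s p1" "forward_solution S q' s p2"
    and p: "pmf (p1 s) \<in> l1D S d" "pmf (p2 s) \<in> l1D S d"
  then have w: "weighted_l1 (pmf (p1 s))" "weighted_l1 (pmf (p2 s))" by (simp_all add: l1D_pmf_iff)
  have wt: "weighted_l1 (pmf (p1 t))" "weighted_l1 (pmf (p2 t))"
    by (rule lyapunov_weighted(1)[OF chain' fs(1) s w(1)] lyapunov_weighted(1)[OF chain' fs(2) s w(2)])+
  have "ennreal (norm_D (\<lambda>i. pmf (p1 t) i - pmf (p2 t) i))
      \<le> ennreal (M * exp (- (a - \<Delta>B) * (t - s)) * norm_D (\<lambda>i. pmf (p1 s) i - pmf (p2 s) i))"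
    by (rule ennreal_leI[OF contraction[OF fs s w]])
  then show "norm1D S d (\<lambda>i. pmf (p1 t) i - pmf (p2 t) i)
      \<le> ennreal (M * exp (- (a - \<Delta>B) * (t - s))) * norm1D S d (\<lambda>i. pmf (p1 s) i - pmf (p2 s) i)"
    unfolding norm1D_eq[OF weighted_l1_diff(1)[OF wt]] norm1D_eq[OF weighted_l1_diff(1)[OF w]]
    using M norm_D_nonneg by (simp add: ennreal_mult)
qed

text \<open>
\<open>stability\<close> is applied from a late time \<open>s\<close> on, when the first solution has come close to its
asymptotic bound \<open>c M / a\<close>; then \<open>t\<close> is sent to infinity with \<open>s\<close> fixed.
\<close>

lemma eventually_close:
  assumes fs1: "forward_solution S q 0 p1" and fs2: "forward_solution S q' 0 p2"
    and w1: "weighted_l1 (pmf (p1 0))" and w2: "weighted_l1 (pmf (p2 0))" and \<epsilon>: "0 < \<epsilon>"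
  shows "\<forall>\<^sub>F t in at_top. norm_D (\<lambda>j. pmf (p1 t) j - pmf (p2 t) j)
     \<le> M * (M * \<Delta>B * c + a * \<Delta>f) / (a * (a - \<Delta>B)) + \<epsilon>"
proof -
  define b where "b = a - \<Delta>B"
  have b: "0 < b" using \<Delta>B by (simp add: b_def)
  let ?Z0 = "norm_D (pmf (p1 0))"
  have "((\<lambda>s. (\<Delta>B * (M * ?Z0) * M / b) * exp (- (a * s))) \<longlongrightarrow> (\<Delta>B * (M * ?Z0) * M / b) * 0) at_top"
    using a by (intro tendsto_mult tendsto_const) real_asymp
  then have "\<forall>\<^sub>F s in at_top. (\<Delta>B * (M * ?Z0) * M / b) * exp (- (a * s)) < \<epsilon> / 2"
    using \<epsilon> by (intro order_tendstoD(2)) auto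
  then have "\<forall>\<^sub>F s in at_top. 0 \<le> s \<and> (\<Delta>B * (M * ?Z0) * M / b) * exp (- (a * s)) < \<epsilon> / 2"
    by (rule eventually_conj[OF eventually_ge_at_top])
  \<comment> \<open>from \<open>s\<close> on, the influence of the initial value of the first solution is less than \<open>\<epsilon> / 2\<close>\<close>
  then obtain s where s: "0 \<le> s" "(\<Delta>B * (M * ?Z0) * M / b) * exp (- (a * s)) < \<epsilon> / 2"
    using eventually_happens'[OF trivial_limit_at_top_linorder] by blast
  let ?V = "norm_D (\<lambda>j. pmf (p1 s) j - pmf (p2 s) j)"
  define Z where "Z = M * exp (- (a * s)) * ?Z0 + c * M / a"
  have Z: "norm_D (pmf (p1 t)) \<le> Z" if "s \<le> t" for t
  proof -
    have "norm_D (pmf (p1 t)) \<le> M * exp (- a * (t - 0)) * ?Z0 + c * M / a"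
      by (rule solution_bound[OF fs1 order_refl _ w1]) (use that s in simp)
    also have "\<dots> \<le> Z"
      unfolding Z_def using that a M norm_D_nonneg[of "pmf (p1 0)"]
      by (intro add_right_mono mult_right_mono mult_left_mono) auto
    finally show ?thesis .
  qed
  note fs1' = forward_solution_later[OF fs1 s(1)] and fs2' = forward_solution_later[OF fs2 s(1)]
  have ws: "weighted_l1 (pmf (p1 s))" "weighted_l1 (pmf (p2 s))"
    by (rule lyapunov_weighted(1)[OF chain fs1 order_refl s(1) w1]
             lyapunov_weighted(1)[OF chain' fs2 order_refl s(1) w2])+
  have "((\<lambda>t. (M * ?V * exp (b * s)) * exp (- (b * t))) \<longlongrightarrow> (M * ?V * exp (b * s)) * 0) at_top"
    using b by (intro tendsto_mult tendsto_const) real_asymp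
  then have "\<forall>\<^sub>F t in at_top. (M * ?V * exp (b * s)) * exp (- (b * t)) < \<epsilon> / 2"
    using \<epsilon> by (intro order_tendstoD(2)) auto
  with eventually_ge_at_top[of s] show ?thesis
  proof eventually_elim
    case (elim t)
    have "norm_D (\<lambda>j. pmf (p1 t) j - pmf (p2 t) j) \<le> M * exp (- b * (t - s)) * ?V + (\<Delta>B * Z + \<Delta>f) * M / b"
      unfolding b_def by (rule stability[OF fs1' fs2' s(1) elim(1) ws Z])
    also have "M * exp (- b * (t - s)) * ?V = (M * ?V * exp (b * s)) * exp (- (b * t))"
      by (simp add: algebra_simps flip: exp_add)
    also have "(\<Delta>B * Z + \<Delta>f) * M / b = (\<Delta>B * (M * ?Z0) * M / b) * exp (- (a * s)) + M * (M * \<Delta>B * c + a * \<Delta>f) / (a * b)"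
      using a b by (simp add: Z_def field_simps)
    finally show ?case using elim(2) s(2) unfolding b_def[symmetric] by linarith
  qed
qed

text \<open>
Both denominators are positive and \<open>\<Delta>B \<le> M \<Delta>B\<close> because \<open>M \<ge> 1\<close>.
\<close>

lemma bound_le:
  assumes small: "M * \<Delta>B < a"
  shows "M * (M * \<Delta>B * c + a * \<Delta>f) / (a * (a - \<Delta>B)) \<le> M * (M * \<Delta>B * c + a * \<Delta>f) / (a * (a - M * \<Delta>B))"
proof (rule divide_left_mono)
  have "\<Delta>B \<le> M * \<Delta>B" using mult_right_mono[OF M_ge_1 \<Delta>B(1)] by simp
  then show "a * (a - M * \<Delta>B) \<le> a * (a - \<Delta>B)" using a by (intro mult_left_mono) auto
  show "0 \<le> M * (M * \<Delta>B * c + a * \<Delta>f)"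
    using M a \<Delta>B \<Delta>f C_nonneg by simp
  show "0 < a * (a - \<Delta>B) * (a * (a - M * \<Delta>B))" using small a \<Delta>B by simp
qed

text \<open>
All starting states share the limiting mean of state 0, since solutions contract towards each other.
\<close>

lemma limiting_mean:
  assumes mc: "markov_chain S q' P"
    and W: "0 < W" "\<And>i. i \<in> I \<Longrightarrow> W \<le> d i / real i"
  shows "has_limiting_mean S P (\<lambda>t. mean_from P t 0)"
  unfolding has_limiting_mean_def
proof (intro ballI conjI allI impI)
  fix k assume k: "k \<in> states S"
  have z: "0 \<in> states S" by (simp add: pos_states_simps(3))
  have fs: "forward_solution S q' 0 (\<lambda>t. P 0 t j)" and ini: "P 0 0 j = return_pmf j" if "j \<in> states S" for j
    using mc that by (auto simp: markov_chain_def)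
  have w0: "weighted_l1 (pmf (P 0 0 j))" if "j \<in> states S" for j using ini[OF that] weighted_l1_return_pmf by simp
  have wt: "weighted_l1 (pmf (P 0 t j))" if "j \<in> states S" "0 \<le> t" for j t
    by (rule lyapunov_weighted(1)[OF chain' fs[OF that(1)] order_refl that(2) w0[OF that(1)]])
  have sub: "set_pmf (P 0 t j) \<subseteq> states S" if "j \<in> states S" "0 \<le> t" for j t
    using fs[OF that(1)] that(2) by (auto simp: forward_solution_def)
  show "integrable (measure_pmf (P 0 t k)) real" if "0 \<le> t" for t
    by (rule expectation_difference(1)[OF W sub sub wt wt]) (use that k in auto)
  let ?V = "norm_D (\<lambda>j. pmf (P 0 0 k) j - pmf (P 0 0 0) j)"
  have b: "0 < a - \<Delta>B" using \<Delta>B by simp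
  have "((\<lambda>t. (M * ?V / W) * exp (- ((a - \<Delta>B) * t))) \<longlongrightarrow> (M * ?V / W) * 0) at_top"
    using b by (intro tendsto_mult tendsto_const) real_asymp
  then have lim: "((\<lambda>t. (M * ?V / W) * exp (- ((a - \<Delta>B) * t))) \<longlongrightarrow> 0) at_top" by simp
  show "((\<lambda>t. \<bar>mean_from P t k - mean_from P t 0\<bar>) \<longlongrightarrow> 0) at_top"
  proof (rule Lim_null_comparison[OF _ lim])
    show "\<forall>\<^sub>F t in at_top. norm \<bar>mean_from P t k - mean_from P t 0\<bar> \<le> (M * ?V / W) * exp (- ((a - \<Delta>B) * t))"
      using eventually_ge_at_top[of 0]
    proof eventually_elim
      case (elim t)
      have "\<bar>mean_from P t k - mean_from P t 0\<bar> \<le> norm_D (\<lambda>j. pmf (P 0 t k) j - pmf (P 0 t 0) j) / W"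
        unfolding mean_from_def
        by (rule expectation_difference(2)[OF W sub sub wt wt]) (use elim k z in auto)
      also have "\<dots> \<le> (M * exp (- (a - \<Delta>B) * (t - 0)) * ?V) / W"
        using contraction[OF fs[OF k] fs[OF z] order_refl elim w0[OF k] w0[OF z]] W(1)
        by (intro divide_right_mono) auto
      also have "- (a - \<Delta>B) * (t - 0) = - ((a - \<Delta>B) * t)" by (simp add: algebra_simps)
      finally show ?case by (simp add: mult.assoc mult.commute[of _ ?V])
    qed
  qed
qed

lemma close_within:
  assumes small: "M * \<Delta>B < a"
    and fs1: "forward_solution S q 0 p1" and fs2: "forward_solution S q' 0 p2"
    and w1: "weighted_l1 (pmf (p1 0))" and w2: "weighted_l1 (pmf (p2 0))" and \<epsilon>: "0 < \<epsilon>"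
  shows "\<forall>\<^sub>F t in at_top. norm_D (\<lambda>j. pmf (p1 t) j - pmf (p2 t) j)
     \<le> M * (M * \<Delta>B * c + a * \<Delta>f) / (a * (a - M * \<Delta>B)) + \<epsilon>"
  using eventually_close[OF fs1 fs2 w1 w2 \<epsilon>]
  by eventually_elim (use bound_le[OF small] in linarith)

lemma limsup_distance:
  assumes small: "M * \<Delta>B < a"
    and fs: "forward_solution S q 0 p1" "forward_solution S q' 0 p2"
    and p: "pmf (p1 0) \<in> l1D S d" "pmf (p2 0) \<in> l1D S d"
  shows "Limsup at_top (\<lambda>t. norm1D S d (\<lambda>i. pmf (p1 t) i - pmf (p2 t) i))
     \<le> ennreal (M * (M * \<Delta>B * c + a * \<Delta>f) / (a * (a - M * \<Delta>B)))" (is "_ \<le> ennreal ?b")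
proof (rule ennreal_le_epsilon)
  fix \<epsilon> :: real assume \<epsilon>: "0 < \<epsilon>"
  have b0: "0 \<le> ?b" using M a \<Delta>B \<Delta>f C_nonneg small by simp
  have w: "weighted_l1 (pmf (p1 0))" "weighted_l1 (pmf (p2 0))" using p by (simp_all add: l1D_pmf_iff)
  show "Limsup at_top (\<lambda>t. norm1D S d (\<lambda>i. pmf (p1 t) i - pmf (p2 t) i)) \<le> ennreal ?b + ennreal \<epsilon>"
  proof (rule Limsup_bounded)
    show "\<forall>\<^sub>F t in at_top. norm1D S d (\<lambda>i. pmf (p1 t) i - pmf (p2 t) i) \<le> ennreal ?b + ennreal \<epsilon>"
      using close_within[OF small fs w \<epsilon>] eventually_ge_at_top[of 0]
    proof eventually_elim
      case (elim t)
      have wt: "weighted_l1 (pmf (p1 t))" "weighted_l1 (pmf (p2 t))"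
        by (rule lyapunov_weighted(1)[OF chain fs(1) order_refl elim(2) w(1)]
                 lyapunov_weighted(1)[OF chain' fs(2) order_refl elim(2) w(2)])+
      have "norm1D S d (\<lambda>i. pmf (p1 t) i - pmf (p2 t) i) \<le> ennreal (?b + \<epsilon>)"
        unfolding norm1D_eq[OF weighted_l1_diff(1)[OF wt]] by (rule ennreal_leI[OF elim(1)])
      also have "\<dots> = ennreal ?b + ennreal \<epsilon>" by (rule ennreal_plus) (use b0 \<epsilon> in auto)
      finally show ?case .
    qed
  qed
qed

text \<open>
Each limiting mean is asymptotically the mean of the chain started in state 0, so the distance
of these two means decides.
\<close>

lemma limsup_means:
  assumes small: "M * \<Delta>B < a"
    and mc: "markov_chain S q P" and mc': "markov_chain S q' P'"
    and W: "0 < W" "\<And>i. i \<in> I \<Longrightarrow> W \<le> d i / real i"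
    and \<phi>: "has_limiting_mean S P \<phi>" and \<phi>': "has_limiting_mean S P' \<phi>'"
  shows "Limsup at_top (\<lambda>t. ereal \<bar>\<phi> t - \<phi>' t\<bar>)
     \<le> ereal (M * (M * \<Delta>B * c + a * \<Delta>f) / (W * a * (a - M * \<Delta>B)))"
proof (rule ereal_le_epsilon2)
  fix \<epsilon> :: real assume \<epsilon>: "0 < \<epsilon>"
  let ?b = "M * (M * \<Delta>B * c + a * \<Delta>f) / (a * (a - M * \<Delta>B))"
  have z: "0 \<in> states S" by (simp add: pos_states_simps(3))
  have fs: "forward_solution S q 0 (\<lambda>t. P 0 t 0)" "forward_solution S q' 0 (\<lambda>t. P' 0 t 0)"
    and ini: "P 0 0 0 = return_pmf 0" "P' 0 0 0 = return_pmf 0"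
    using mc mc' z by (auto simp: markov_chain_def)
  have w0: "weighted_l1 (pmf (P 0 0 0))" "weighted_l1 (pmf (P' 0 0 0))" using ini weighted_l1_return_pmf by simp_all
  have m: "((\<lambda>t. \<bar>mean_from P t 0 - \<phi> t\<bar>) \<longlongrightarrow> 0) at_top" "((\<lambda>t. \<bar>mean_from P' t 0 - \<phi>' t\<bar>) \<longlongrightarrow> 0) at_top"
    using \<phi> \<phi>' z by (auto simp: has_limiting_mean_def)
  have e4: "0 < \<epsilon> / 4" "0 < W * (\<epsilon> / 4)" using \<epsilon> W by auto
  have "\<forall>\<^sub>F t in at_top. \<bar>\<phi> t - \<phi>' t\<bar> \<le> ?b / W + \<epsilon>"
    using close_within[OF small fs w0 e4(2)] eventually_ge_at_top[of 0]
      order_tendstoD(2)[OF m(1) e4(1)] order_tendstoD(2)[OF m(2) e4(1)]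
  proof eventually_elim
    case (elim t)
    have wt: "weighted_l1 (pmf (P 0 t 0))" "weighted_l1 (pmf (P' 0 t 0))"
      by (rule lyapunov_weighted(1)[OF chain fs(1) order_refl elim(2) w0(1)]
               lyapunov_weighted(1)[OF chain' fs(2) order_refl elim(2) w0(2)])+
    have sub: "set_pmf (P 0 t 0) \<subseteq> states S" "set_pmf (P' 0 t 0) \<subseteq> states S"
      using fs elim(2) by (auto simp: forward_solution_def)
    have "\<bar>mean_from P t 0 - mean_from P' t 0\<bar> \<le> norm_D (\<lambda>j. pmf (P 0 t 0) j - pmf (P' 0 t 0) j) / W"
      unfolding mean_from_def by (rule expectation_difference(2)[OF W sub wt])
    also have "\<dots> \<le> (?b + W * (\<epsilon> / 4)) / W" using elim(1) W(1) by (intro divide_right_mono) auto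
    also have "\<dots> = ?b / W + \<epsilon> / 4" using W(1) by (simp add: add_divide_distrib)
    finally show ?case using elim(3,4) by linarith
  qed
  then have "\<forall>\<^sub>F t in at_top. ereal \<bar>\<phi> t - \<phi>' t\<bar> \<le> ereal (?b / W + \<epsilon>)"
    by eventually_elim simp
  then have "Limsup at_top (\<lambda>t. ereal \<bar>\<phi> t - \<phi>' t\<bar>) \<le> ereal (?b / W + \<epsilon>)" by (rule Limsup_bounded)
  also have "?b / W = M * (M * \<Delta>B * c + a * \<Delta>f) / (W * a * (a - M * \<Delta>B))" by (simp add: mult_ac)
  finally show "Limsup at_top (\<lambda>t. ereal \<bar>\<phi> t - \<phi>' t\<bar>)
     \<le> ereal (M * (M * \<Delta>B * c + a * \<Delta>f) / (W * a * (a - M * \<Delta>B))) + ereal \<epsilon>" by simp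
qed

end


section \<open>The perturbation theorem\<close>

text \<open>
A chain is its own perturbation of size 0. Facts about perturbed chains thus cover the
original chain.
\<close>

lemma (in decaying_chain) perturbed_chain_self: "perturbed_chain S d q C c M a q 0 0"
proof -
  have "mat_norm1D S d (\<lambda>i j. 0) = 0"
    by (simp add: mat_norm1D_def mat_norm_def conj_D_def mat_mult_def[abs_def] bot_ennreal SUP_constant)
  moreover have "norm1D S d (\<lambda>i. 0) = 0"
    by (simp add: norm1D_def l1_norm_def mat_vec_def)
  ultimately show ?thesis
    using chain a by unfold_locales (auto simp: bounded_chain_def)
qed

theorem theorem5:
  fixes S :: enat
    and d :: "nat \<Rightarrow> real"
    and q qbar :: "nat \<Rightarrow> nat \<Rightarrow> real \<Rightarrow> real"
    and P Pbar :: "real \<Rightarrow> real \<Rightarrow> nat \<Rightarrow> nat pmf"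
    and M a BB ff :: real
  assumes d_pos: "\<And>i. 1 \<le> i \<Longrightarrow> 0 < d i"
    and d1: "d 1 = 1"
    and d_inf: "0 < (INF i\<in>pos_states S. d i)"
    and chain: "markov_chain S q P"
    and bound_nonneg: "0 \<le> BB" "0 \<le> ff"
    and B_bound: "AE t in lebesgue. 0 \<le> t \<longrightarrow> mat_norm1D S d (B_mat S q t) \<le> ennreal BB"
    and f_bound: "AE t in lebesgue. 0 \<le> t \<longrightarrow> norm1D S d (f_vec S q t) \<le> ennreal ff"
    and M_pos: "0 < M" and a_pos: "0 < a"
    and decay: "\<And>s t. 0 \<le> s \<Longrightarrow> s \<le> t \<Longrightarrow>
      exp (- (LINT \<tau>:{s..t}|lebesgue. alpha S q d \<tau>)) \<le> M * exp (- a * (t - s))"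
  shows "exp_weakly_ergodic_1D S q d \<and>
    (\<forall>\<Delta>B \<Delta>f :: real.
      0 \<le> \<Delta>B \<longrightarrow> 0 \<le> \<Delta>f \<longrightarrow> markov_chain S qbar Pbar \<longrightarrow>
      (AE t in lebesgue. 0 \<le> t \<longrightarrow>
         mat_norm1D S d (\<lambda>i j. B_mat S q t i j - B_mat S qbar t i j) \<le> ennreal \<Delta>B) \<longrightarrow>
      (AE t in lebesgue. 0 \<le> t \<longrightarrow>
         norm1D S d (\<lambda>i. f_vec S q t i - f_vec S qbar t i) \<le> ennreal \<Delta>f) \<longrightarrow>
      M * \<Delta>B < a \<longrightarrow>
      exp_weakly_ergodic_1D S qbar d \<and>
      (\<forall>p pbar.
         forward_solution S q 0 p \<longrightarrow> forward_solution S qbar 0 pbar \<longrightarrow>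
         pmf (p 0) \<in> l1D S d \<longrightarrow> pmf (pbar 0) \<in> l1D S d \<longrightarrow>
         Limsup at_top (\<lambda>t. norm1D S d (\<lambda>i. pmf (p t) i - pmf (pbar t) i))
           \<le> ennreal (M * (M * \<Delta>B * ff + a * \<Delta>f) / (a * (a - M * \<Delta>B)))) \<and>
      (\<forall>W. W = (INF i\<in>pos_states S. d i / real i) \<longrightarrow> 0 < W \<longrightarrow>
         (\<exists>\<phi>. has_limiting_mean S P \<phi>) \<and>
         (\<exists>\<phi>bar. has_limiting_mean S Pbar \<phi>bar) \<and>
         (\<forall>\<phi> \<phi>bar. has_limiting_mean S P \<phi> \<longrightarrow> has_limiting_mean S Pbar \<phi>bar \<longrightarrow>
            Limsup at_top (\<lambda>t. ereal \<bar>\<phi> t - \<phi>bar t\<bar>)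
              \<le> ereal (M * (M * \<Delta>B * ff + a * \<Delta>f) / (W * a * (a - M * \<Delta>B))))))"
proof -
  have "bounded_chain S d q BB ff"
    using chain bound_nonneg B_bound f_bound by (simp add: bounded_chain_def markov_chain_def)
  then have base: "decaying_chain S d q BB ff M a"
    by unfold_locales (rule d_pos M_pos a_pos decay | assumption)+
  then have self: "perturbed_chain S d q BB ff M a q 0 0"
    by (rule decaying_chain.perturbed_chain_self)
  have W: "W \<le> d i / real i" if "W = (INF i\<in>pos_states S. d i / real i)" "i \<in> pos_states S" for W i
    unfolding that(1)
  proof (rule cINF_lower[OF bdd_belowI2 that(2)])
    fix j assume "j \<in> pos_states S"
    then show "0 \<le> d j / real j" using d_pos[of j] pos_states_simps(1)[of j S] by simp
  qed
  have pert: "perturbed_chain S d q BB ff M a qbar \<Delta>B \<Delta>f"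
    if "0 \<le> \<Delta>B" "0 \<le> \<Delta>f" "markov_chain S qbar Pbar" "M * \<Delta>B < a"
      "AE t in lebesgue. 0 \<le> t \<longrightarrow>
         mat_norm1D S d (\<lambda>i j. B_mat S q t i j - B_mat S qbar t i j) \<le> ennreal \<Delta>B"
      "AE t in lebesgue. 0 \<le> t \<longrightarrow>
         norm1D S d (\<lambda>i. f_vec S q t i - f_vec S qbar t i) \<le> ennreal \<Delta>f" for \<Delta>B \<Delta>f
  proof -
    have "\<Delta>B < a" using mult_right_mono[OF decaying_chain.M_ge_1[OF base] that(1)] that(4) by simp
    then show ?thesis
      using base that unfolding perturbed_chain_def perturbed_chain_axioms_def markov_chain_def by blast
  qed
  show ?thesis
  proof (intro conjI allI impI perturbed_chain.ergodic[OF self], goal_cases)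
    case (1 \<Delta>B \<Delta>f)
    then show ?case by (intro perturbed_chain.ergodic[OF pert])
  next
    case (2 \<Delta>B \<Delta>f p pbar)
    then show ?case by (intro perturbed_chain.limsup_distance[OF pert])
  next
    case (3 \<Delta>B \<Delta>f W)
    then show ?case using perturbed_chain.limiting_mean[OF self chain, of W] W by blast
  next
    case (4 \<Delta>B \<Delta>f W)
    then show ?case using perturbed_chain.limiting_mean[OF pert, of \<Delta>B \<Delta>f Pbar W] W by blast
  next
    case (5 \<Delta>B \<Delta>f W \<phi> \<phi>bar)
    show ?case
      by (rule perturbed_chain.limsup_means[OF pert _ chain]) (use 5 W in auto)
  qed
qed

end
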